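(* Let $a\in\mathbb{C}$, $a\neq 0$. (i) There exists a unique function $F$, analytic in a neighborhood of the origin, satisfying $$F(z^2)=\frac{F(z)^2}{a\,(F(z)-1)},\qquad F(0)=0,\qquad F'(0)=-a. \quad ( * )$$ This $F$ has only isolated singularities in $\mathbb{C}$ if and only if $a\in\{-2,2,4\}$. In the latter case, the functional equation $( * )$ and the recurrence $$y_{n+1}=\frac{y_n^2}{a(y_n-1)} \quad ( ** )$$ can be solved explicitly: the solution of $( * )$ is $$F(z)=\frac{2z}{z^2+z+1}\ \text{ if } a=-2,\qquad F(z)=\frac{2z}{z-1}\ \text{ if } a=2,\qquad F(z)=-\frac{4z}{(z-1)^2}\ \text{ if } a=4,$$ and correspondingly $y_n=F(w^{2^n})$, with $w$ a constant determined by the initial condition $y_0=F(w)$, solves $( ** )$ (as long as the expressions are defined). If $a\notin\{-2,2,4\}$, then the unit circle $\{z\in\mathbb{C}:|z|=1\}$ (the boundary of the unit disk) is a barrier of singularities of $F$. (ii) If $a\notin\{-2,2,4\}$, then $\partial\mathcal{K}_p$ is a barrier of singularities of the constant of motion $Q=F^{-1}$, where $F^{-1}$ denotes the local inverse of $F$ near the origin with $Q(0)=0$.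
   Context: The recurrence $y_{n+1}=y_n^2/(a(y_n-1))$ is obtained from the logistic map $x_{n+1}=ax_n(1-x_n)$ by setting $y=1/x$. Write $G(y)=y^2/(a(y-1))$, a rational map of the Riemann sphere with a superattracting fixed point at $y=0$. $\mathcal{K}_p$ denotes the connected component containing the origin of the Fatou set of $G$, and $\partial\mathcal{K}_p$ is its boundary. "$F$ has only isolated singularities in $\mathbb{C}$" means that the germ of $F$ at $0$ extends to a single-valued analytic function on $\mathbb{C}$ minus a closed discrete set; by convention, branch points, clusters (accumulation points) of poles and barriers of singularities are not isolated singularities. "Barrier of singularities": let $\Omega$ be a connected open set containing $0$ and $f$ an analytic germ at $0$. The boundary $\partial\Omega$ is a barrier of singularities of $f$ if $f$ cannot be continued analytically beyond $\partial\Omega$: for every path $\gamma:[0,1]\to\overline{\Omega}$ with $\gamma(0)=0$, $\gamma([0,1))\subset\Omega$ and $\gamma(1)\in\partial\Omega$, the germ $f$ has no analytic continuation along $\gamma$ up to and including the endpoint $\gamma(1)$. (Analytic continuations of $f$ inside $\Omega$ may be multivalued, with branch points in $\Omega$.) In (i), $\Omega$ is the open unit disk; in (ii), $\Omega=\mathcal{K}_p$. *)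

theory Defs
  imports "HOL-Complex_Analysis.Complex_Analysis"
begin

subsection \<open>The Riemann sphere with its chordal metric\<close>

datatype riemann_sphere = Fin complex | Infty

text \<open>
  Stereographic projection onto the unit sphere of \<open>complex \<times> real\<close>, which carries the Euclidean
  metric; the chordal metric is pulled back along it.
\<close>

primrec stereo :: "riemann_sphere \<Rightarrow> complex \<times> real" where
  "stereo (Fin z) = (2 * z / of_real (1 + (cmod z)\<^sup>2), ((cmod z)\<^sup>2 - 1) / ((cmod z)\<^sup>2 + 1))"
| "stereo Infty = (0, 1)"

lemma one_plus_norm_sq_pos: "1 + (cmod z)\<^sup>2 > 0"
  by (smt (verit) zero_le_power2)

lemma stereo_Fin_scale:
  "stereo (Fin z) = ((2 / (1 + (cmod z)\<^sup>2)) *\<^sub>R z, 1 - 2 / (1 + (cmod z)\<^sup>2))"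
  using one_plus_norm_sq_pos[of z]
  by (simp add: scaleR_conv_of_real field_simps)

lemma stereo_recover: "fst (stereo (Fin z)) / of_real (1 - snd (stereo (Fin z))) = z"
proof -
  have "2 / (1 + (cmod z)\<^sup>2) \<noteq> 0"
    using one_plus_norm_sq_pos[of z] by simp
  then show ?thesis
    unfolding stereo_Fin_scale fst_conv snd_conv diff_diff_eq2 add_diff_cancel_left'
    by (simp only: scaleR_conv_of_real nonzero_mult_div_cancel_left of_real_eq_0_iff not_False_eq_True)
qed

lemma snd_stereo_neq_1: "snd (stereo (Fin z)) \<noteq> 1"
  by simp

lemma inj_stereo: "inj stereo"
proof (rule injI)
  fix p q assume "stereo p = stereo q"
  then show "p = q"
    by (metis riemann_sphere.exhaust snd_conv snd_stereo_neq_1 stereo.simps(2) stereo_recover)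
qed

instantiation riemann_sphere :: metric_space
begin

definition dist_riemann_sphere :: "riemann_sphere \<Rightarrow> riemann_sphere \<Rightarrow> real" where
  "dist p q = dist (stereo p) (stereo q)"

definition uniformity_riemann_sphere :: "(riemann_sphere \<times> riemann_sphere) filter" where
  "uniformity = (INF e\<in>{0 <..}. principal {(p, q :: riemann_sphere). dist p q < e})"

definition open_riemann_sphere :: "riemann_sphere set \<Rightarrow> bool" where
  "open (U :: riemann_sphere set) =
    (\<forall>p\<in>U. \<forall>\<^sub>F (p', q) in uniformity. p' = p \<longrightarrow> q \<in> U)"

instance
proof
  fix p q r :: riemann_sphere
  show "dist p q = 0 \<longleftrightarrow> p = q"
    using inj_stereo by (auto simp: dist_riemann_sphere_def inj_def)
  show "dist p q \<le> dist p r + dist q r"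
    by (simp add: dist_riemann_sphere_def dist_triangle2)
qed (simp_all only: uniformity_riemann_sphere_def open_riemann_sphere_def)

end

lemma dist_Fin_Fin:
  "dist (Fin z) (Fin w) = 2 * cmod (z - w) / (sqrt (1 + (cmod z)\<^sup>2) * sqrt (1 + (cmod w)\<^sup>2))"
proof -
  define A B where "A = 1 + (cmod z)\<^sup>2" and "B = 1 + (cmod w)\<^sup>2"
  have pos: "A > 0" "B > 0"
    by (simp_all add: A_def B_def one_plus_norm_sq_pos)
  have zz: "z \<bullet> z = A - 1" and ww: "w \<bullet> w = B - 1"
    by (simp_all add: A_def B_def power2_norm_eq_inner)
  have "(dist (Fin z) (Fin w))\<^sup>2 = (cmod ((2 / A) *\<^sub>R z - (2 / B) *\<^sub>R w))\<^sup>2 + (2 / B - 2 / A)\<^sup>2"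
    by (simp add: dist_riemann_sphere_def stereo_Fin_scale dist_Pair_Pair dist_norm norm_Pair del: stereo.simps
        flip: A_def B_def)
  also have "\<dots> = (4 / A\<^sup>2) * (A - 1) - (8 / (A * B)) * (z \<bullet> w) + (4 / B\<^sup>2) * (B - 1) + (2 / B - 2 / A)\<^sup>2"
    unfolding power2_norm_eq_inner inner_diff inner_scaleR_left inner_scaleR_right
    by (simp add: zz ww inner_commute[of w z] power2_eq_square diff_divide_distrib add_divide_distrib ac_simps)
  also have "\<dots> = 4 * (A + B - 2 - 2 * (z \<bullet> w)) / (A * B)"
  proof -
    define u v where "u = 1 / A" and "v = 1 / B"
    have "u * A = 1" "v * B = 1"
      using pos by (simp_all add: u_def v_def)
    then have "4 * u\<^sup>2 * (A - 1) - 8 * (u * v) * (z \<bullet> w) + 4 * v\<^sup>2 * (B - 1) + (2 * v - 2 * u)\<^sup>2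
        = 4 * (A + B - 2 - 2 * (z \<bullet> w)) * (u * v)"
      by algebra
    then show ?thesis
      by (simp add: u_def v_def power_divide)
  qed
  also have "A + B - 2 - 2 * (z \<bullet> w) = (cmod (z - w))\<^sup>2"
    unfolding power2_norm_eq_inner by (simp add: inner_diff inner_commute zz ww)
  finally have "(dist (Fin z) (Fin w))\<^sup>2 = (2 * cmod (z - w) / (sqrt A * sqrt B))\<^sup>2"
    using pos by (simp add: power_divide power_mult_distrib)
  then show ?thesis
    using pos by (simp add: power2_eq_iff_nonneg A_def B_def)
qed

lemma dist_Fin_Infty: "dist (Fin z) Infty = 2 / sqrt (1 + (cmod z)\<^sup>2)"
proof -
  define A where "A = 1 + (cmod z)\<^sup>2"
  have pos: "A > 0"
    by (simp add: A_def one_plus_norm_sq_pos)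
  have zz: "z \<bullet> z = A - 1"
    by (simp add: A_def power2_norm_eq_inner)
  have "(dist (Fin z) Infty)\<^sup>2 = (cmod ((2 / A) *\<^sub>R z))\<^sup>2 + (2 / A)\<^sup>2"
    by (simp add: dist_riemann_sphere_def stereo_Fin_scale dist_Pair_Pair dist_norm norm_Pair power_divide
        del: stereo.simps(1) norm_scaleR flip: A_def)
  also have "\<dots> = 4 / A"
    using pos unfolding power2_norm_eq_inner by (simp add: zz field_simps power2_eq_square)
  finally have "(dist (Fin z) Infty)\<^sup>2 = (2 / sqrt A)\<^sup>2"
    using pos by (simp add: power_divide)
  then show ?thesis
    using pos by (simp add: power2_eq_iff_nonneg A_def)
qed

lemma continuous_on_Fin: "continuous_on S Fin"
proof -
  have "dist (Fin z) (Fin w) \<le> 2 * dist z w" for z w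
  proof -
    have "1 \<le> sqrt (1 + (cmod z)\<^sup>2) * sqrt (1 + (cmod w)\<^sup>2)"
      by (simp add: mult_ge1_I)
    then have "2 * cmod (z - w) / (sqrt (1 + (cmod z)\<^sup>2) * sqrt (1 + (cmod w)\<^sup>2)) \<le> 2 * cmod (z - w) / 1"
      by (intro divide_left_mono) auto
    then show ?thesis
      by (simp add: dist_Fin_Fin dist_norm)
  qed
  then show ?thesis
    by (intro lipschitz_on_continuous_on lipschitz_onI) auto
qed

lemma continuous_on_stereo: "continuous_on S stereo"
  unfolding continuous_on_iff by (auto simp flip: dist_riemann_sphere_def)

lemma range_Fin: "range Fin = - {Infty}"
  using riemann_sphere.exhaust by auto

lemma open_Fin_image:
  assumes "open U"
  shows "open (Fin ` U)"
proof -
  define h where "h p = fst (stereo p) / of_real (1 - snd (stereo p))" for p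
  have h: "h (Fin z) = z" for z
    unfolding h_def by (rule stereo_recover)
  have "continuous_on (range Fin) h"
    unfolding h_def using snd_stereo_neq_1
    by (intro continuous_intros continuous_on_stereo) (auto simp: simp del: stereo.simps)
  moreover have "open (range Fin)"
    unfolding range_Fin by (intro open_Compl closed_singleton)
  ultimately have "open (range Fin \<inter> h -` U)"
    using assms by (simp add: continuous_on_open_vimage Int_commute)
  moreover have "range Fin \<inter> h -` U = Fin ` U"
    by (auto simp: h)
  ultimately show ?thesis
    by simp
qed

lemma frontier_unit_disk: "frontier (Fin ` ball 0 1) = Fin ` sphere 0 1"
proof -
  have "closure (Fin ` ball 0 1) = Fin ` cball 0 1"
  proof
    have "compact (Fin ` cball 0 1)"
      by (intro compact_continuous_image continuous_on_Fin compact_cball)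
    then show "closure (Fin ` ball 0 1) \<subseteq> Fin ` cball 0 1"
      by (intro closure_minimal image_mono ball_subset_cball compact_imp_closed)
    have "Fin ` closure (ball 0 1) \<subseteq> closure (Fin ` ball 0 1)"
      by (intro image_closure_subset continuous_on_Fin closed_closure closure_subset)
    then show "Fin ` cball 0 1 \<subseteq> closure (Fin ` ball 0 1)"
      by simp
  qed
  moreover have "interior (Fin ` ball 0 1) = Fin ` ball 0 1"
    by (intro interior_open open_Fin_image open_ball)
  ultimately show ?thesis
    by (auto simp: frontier_def image_iff)
qed

subsection \<open>Fatou set\<close>

definition normal_family_on :: "riemann_sphere set \<Rightarrow> (riemann_sphere \<Rightarrow> riemann_sphere) set \<Rightarrow> bool" where
  "normal_family_on U \<F> \<longleftrightarrow>
     (\<forall>h :: nat \<Rightarrow> riemann_sphere \<Rightarrow> riemann_sphere. range h \<subseteq> \<F> \<longrightarrow>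
        (\<exists>g r. strict_mono r \<and>
           (\<forall>K. compact K \<and> K \<subseteq> U \<longrightarrow> uniform_limit K (h \<circ> r) g sequentially)))"

definition fatou_set :: "(riemann_sphere \<Rightarrow> riemann_sphere) \<Rightarrow> riemann_sphere set" where
  "fatou_set R = \<Union> {U. open U \<and> normal_family_on U (range (\<lambda>n. R ^^ n))}"

subsection \<open>Analytic continuation and barriers of singularities\<close>

text \<open>At \<open>Infty\<close> analyticity is expressed in the local coordinate \<open>w = 1 / z\<close>.\<close>

primrec analytic_at_sphere :: "(riemann_sphere \<Rightarrow> complex) \<Rightarrow> riemann_sphere \<Rightarrow> bool" where
  "analytic_at_sphere f (Fin z) \<longleftrightarrow> (\<lambda>w. f (Fin w)) analytic_on {z}"
| "analytic_at_sphere f Infty \<longleftrightarrow> (\<lambda>w. f (if w = 0 then Infty else Fin (1 / w))) analytic_on {0}"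

text \<open>
  An analytic continuation of the germ of \<open>f\<close> at \<open>0\<close> along \<open>\<gamma>\<close> (endpoint included) is a family of
  analytic germs, \<open>\<phi> t\<close> being considered near \<open>\<gamma> t\<close> only, that starts with \<open>f\<close> and is locally
  coherent: for \<open>s\<close> close to \<open>t\<close>, the germ of \<open>\<phi> s\<close> at \<open>\<gamma> s\<close> is the one induced by \<open>\<phi> t\<close>.
\<close>

definition analytic_continuation_along ::
  "(complex \<Rightarrow> complex) \<Rightarrow> (real \<Rightarrow> riemann_sphere) \<Rightarrow> (real \<Rightarrow> riemann_sphere \<Rightarrow> complex) \<Rightarrow> bool" where
  "analytic_continuation_along f \<gamma> \<phi> \<longleftrightarrow>
     (\<forall>t\<in>{0..1}. analytic_at_sphere (\<phi> t) (\<gamma> t)) \<and>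
     (\<forall>\<^sub>F z in nhds 0. \<phi> 0 (Fin z) = f z) \<and>
     (\<forall>t\<in>{0..1}. \<forall>\<^sub>F s in at t within {0..1}. \<forall>\<^sub>F p in nhds (\<gamma> s). \<phi> s p = \<phi> t p)"

text \<open>
  The frontier is taken in the sphere, so paths ending at \<open>Infty\<close> are included when \<open>\<Omega>\<close> is
  unbounded.
\<close>

definition barrier_of_singularities :: "(complex \<Rightarrow> complex) \<Rightarrow> riemann_sphere set \<Rightarrow> bool" where
  "barrier_of_singularities f \<Omega> \<longleftrightarrow>
     (\<forall>\<gamma>. path \<gamma> \<and> pathstart \<gamma> = Fin 0 \<and> \<gamma> ` {0..<1} \<subseteq> \<Omega> \<and> pathfinish \<gamma> \<in> frontier \<Omega> \<longrightarrow>
        \<not> (\<exists>\<phi>. analytic_continuation_along f \<gamma> \<phi>))"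

definition only_isolated_singularities :: "(complex \<Rightarrow> complex) \<Rightarrow> bool" where
  "only_isolated_singularities f \<longleftrightarrow>
     (\<exists>S g. closed S \<and> discrete S \<and> 0 \<notin> S \<and> g holomorphic_on - S \<and> (\<forall>\<^sub>F z in nhds 0. g z = f z))"

subsection \<open>The map \<open>G\<close> and its functional equation\<close>

primrec G_map :: "complex \<Rightarrow> riemann_sphere \<Rightarrow> riemann_sphere" where
  "G_map a (Fin y) = (if y = 1 then Infty else Fin (y\<^sup>2 / (a * (y - 1))))"
| "G_map a Infty = Infty"

definition K_p :: "complex \<Rightarrow> riemann_sphere set" where
  "K_p a = connected_component_set (fatou_set (G_map a)) (Fin 0)"

definition solves_functional_equation :: "complex \<Rightarrow> (complex \<Rightarrow> complex) \<Rightarrow> bool" where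
  "solves_functional_equation a F \<longleftrightarrow>
     F analytic_on {0} \<and> (\<forall>\<^sub>F z in nhds 0. F (z\<^sup>2) = (F z)\<^sup>2 / (a * (F z - 1))) \<and>
     F 0 = 0 \<and> deriv F 0 = - a"

definition local_inverse_at_0 :: "(complex \<Rightarrow> complex) \<Rightarrow> (complex \<Rightarrow> complex) \<Rightarrow> bool" where
  "local_inverse_at_0 F Q \<longleftrightarrow>
     Q analytic_on {0} \<and> Q 0 = 0 \<and> (\<forall>\<^sub>F z in nhds 0. Q (F z) = z) \<and> (\<forall>\<^sub>F y in nhds 0. F (Q y) = y)"

text \<open>
  \<open>P\<close> is the set of poles of the rational function \<open>F\<close>.  The sequence \<open>y\<^sub>n = F (w ^ 2 ^ n)\<close> is
  required to satisfy the recurrence at every step at which \<open>y\<^sub>n\<close> and the right-hand side are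
  defined (\<open>y\<^sub>n\<^sub>+\<^sub>1\<close> is then defined too).  \<open>Y\<close> is a set of initial values that are attained by \<open>F\<close>.
\<close>

definition solves_recurrence ::
  "complex \<Rightarrow> (complex \<Rightarrow> complex) \<Rightarrow> complex set \<Rightarrow> complex set \<Rightarrow> bool" where
  "solves_recurrence a F P Y \<longleftrightarrow>
     (\<forall>w n. w ^ 2 ^ n \<notin> P \<and> F (w ^ 2 ^ n) \<noteq> 1 \<longrightarrow>
        w ^ 2 ^ Suc n \<notin> P \<and>
        F (w ^ 2 ^ Suc n) = (F (w ^ 2 ^ n))\<^sup>2 / (a * (F (w ^ 2 ^ n) - 1))) \<and>
     (\<forall>y0\<in>Y. \<exists>w. w \<notin> P \<and> F w = y0)"

end

theory Submission
  imports Defs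
begin

text \<open>
  Write \<open>p x = a x (1 - x)\<close> and \<open>x = 1 / y\<close>, so that \<open>G\<close> becomes the polynomial \<open>p\<close> and \<open>Q\<close> its Boettcher
  coordinate at infinity. Suppose that a germ of \<open>1 / F\<close> is analytic at a point \<open>\<zeta>\<close> of the unit circle, and
  put \<open>\<Psi> v = 1 / F (\<zeta> e\<^sup>v)\<close> for \<open>\<bar>v\<bar> < \<rho>\<close>. Blowing up by the dynamics, \<open>E\<^sub>j u = p\<^sup>j (\<Psi> (u / 2\<^sup>j))\<close> is analytic
  for \<open>\<bar>u\<bar> < 2\<^sup>j \<rho>\<close>, and far to the left it equals \<open>1 / F (c\<^sub>j e\<^sup>u)\<close> with \<open>\<bar>c\<^sub>j\<bar> = 1\<close>. After translation by
  \<open>log c\<^sub>j\<close> these functions glue to an entire function, so the principal branch of \<open>1 / F\<close> extends to the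
  punctured plane; the functional equation bounds its growth polynomially, hence \<open>z / F z\<close> is a
  polynomial, and comparing leading terms leaves only \<open>a \<in> {-2, 2, 4}\<close>.

  For \<open>Q\<close> the same argument is applied to a local inverse of the continued germ at a non-critical
  point of modulus 1 near the endpoint of the path.
\<close>

subsection \<open>Polynomial solutions of the squared functional equation\<close>

text \<open>The obstacle is that a continued germ need not be the original branch, and that
  \<open>Q\<close> may be truly multivalued in the basin. So no branch is tracked. What travels
  along a path is an equation in which \<open>F\<close> and \<open>Q\<close> occur only inside their
  original disks: \<open>p n (1 / f z) * F (z ^ 2 ^ n) = 1\<close> for a continuation f of
  \<open>F\<close>, and \<open>f q ^ 2 ^ n = level n q\<close> for a continuation f of
  \<open>Q\<close>. The power \<open>2 ^ n\<close> erases the choice of a root. Near the boundary n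
  is unbounded, whereas the blow-up needs n to be the prescribed j. This is the purpose of the
  constant \<open>m\<close>: an orbit that starts inside the disk of radius \<open>R\<close> leaves
  it with a Boettcher coordinate of modulus at least \<open>m\<close>, so a known modulus bounds the
  exit time. Both barriers then reduce to \<open>parameter_of_boundary_germ\<close>, whose
  hypothesis says that the Green function of p at \<open>\<Psi> v\<close> is \<open>- Re v\<close>
  when \<open>Re v < 0\<close>. The exceptional parameters come from w = a/2 - a x, which conjugates
  p to w^2 + c with c = a/2 - a^2/4: c = 0 is the power map (a = 2), c = -2 the Chebyshev map (a =
  -2 or a = 4).\<close>

definition logistic :: "complex \<Rightarrow> complex \<Rightarrow> complex" where
  "logistic a x = a * x * (1 - x)"

text \<open>With s(z) = S(z) / z the equation reads s(z^2) = s(z)^2 + c. Splitting off the leading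
  term of S leaves a cross term of higher degree than its companions, which only the term in c can
  cancel.\<close>

lemma squaring_equation_polynomial:
  fixes S :: "complex poly"
  assumes eq: "pcompose S [:0, 0, 1:] = S ^ 2 + [:0, 0, c:]" and S0: "coeff S 0 = 1"
  shows "c = 0 \<or> c = -2"
proof -
  define n where "n = degree S"
  have mon: "[:0, 0, 1:] = monom (1::complex) 2"
    by (simp add: monom_altdef power2_eq_square)
  have degX: "degree (pcompose T [:0, 0, 1:]) = 2 * degree T" for T :: "complex poly"
    by (simp add: degree_pcompose)
  have lead: "coeff (pcompose T [:0, 0, 1:]) (2 * degree T) = lead_coeff T" for T :: "complex poly"
  proof -
    have "lead_coeff (pcompose T [:0, 0, 1:]) = lead_coeff T * lead_coeff [:0, 0, 1::complex:] ^ degree T"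
      by (rule lead_coeff_comp) simp
    then show ?thesis
      unfolding degX by simp
  qed
  have c2: "coeff [:0, 0, c:] k = (if k = 2 then c else 0)" for k
    by (auto simp: coeff_pCons split: nat.splits)
  consider "n = 0" | "n = 1" | "n \<ge> 2" by linarith
  then show ?thesis
  proof cases
    case 1
    then obtain s where s: "S = [:s:]"
      unfolding n_def using degree_eq_zeroE by blast
    with S0 have "S = 1" by (simp add: one_pCons)
    have "[:0, 0, c:] = 0"
      using eq unfolding \<open>S = 1\<close> by (simp add: pcompose_1)
    then show ?thesis by simp
  next
    case 2
    define s where "s = coeff S 1"
    have "S = [:1, s:]"
    proof (rule poly_eqI)
      show "coeff S k = coeff [:1, s:] k" for k
        using 2 S0 by (cases "k \<le> 1") (auto simp: s_def n_def coeff_pCons coeff_eq_0 le_Suc_eq split: nat.splits)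
    qed
    with eq have "pcompose [:1, s:] [:0, 0, 1:] = [:1, s:] ^ 2 + [:0, 0, c:]"
      by metis
    then have *: "poly (pcompose [:1, s:] [:0, 0, 1:]) x = poly ([:1, s:] ^ 2 + [:0, 0, c:]) x" for x
      by metis
    \<comment> \<open>The left-hand side has the same value at 1 and -1; comparing the right-hand
      sides forces s = 0 and then c = 0.\<close>
    have "1 + s = (1 + s)\<^sup>2 + c"
      using *[of 1] by (simp add: poly_pcompose)
    moreover have "1 + s = (1 - s)\<^sup>2 + c"
      using *[of "-1"] by (simp add: poly_pcompose)
    ultimately have "c = 0"
      by algebra
    then show ?thesis ..
  next
    case n2: 3
    have "lead_coeff S = lead_coeff S ^ 2"
    proof -
      have "lead_coeff S = coeff (pcompose S [:0, 0, 1:]) (2 * degree S)"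
        by (rule lead[symmetric])
      also have "\<dots> = coeff (S ^ 2) (2 * degree S) + coeff [:0, 0, c:] (2 * degree S)"
        by (simp only: eq coeff_add)
      also have "coeff [:0, 0, c:] (2 * degree S) = 0"
        unfolding c2 using n2 by (auto simp: n_def)
      also have "coeff (S ^ 2) (2 * degree S) = lead_coeff S ^ 2"
        unfolding power2_eq_square mult_2 by (rule coeff_mult_degree_sum)
      finally show ?thesis unfolding add_0_right .
    qed
    moreover have "lead_coeff S \<noteq> 0"
      using n2 by (auto simp: n_def)
    ultimately have lc: "coeff S n = 1"
      unfolding n_def power2_eq_square by algebra
    \<comment> \<open>With k the degree of U, the cross term 2 z^n U has degree n + k, above the
      degree 2 k of both U(z^2) and U^2. So the coefficient at n + k isolates the leading
      coefficient of U.\<close>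
    define U where "U = S - monom 1 n"
    have SU: "S = monom 1 n + U" by (simp add: U_def)
    have U0: "coeff U 0 = 1" using S0 n2 by (simp add: U_def)
    have degU: "degree U < n"
    proof -
      have "coeff U i = 0" if "i \<ge> n" for i
        using that lc by (cases "i = n") (auto simp: U_def n_def coeff_eq_0)
      then show ?thesis
        using n2 by (intro degree_lessI) auto
    qed
    define k where "k = degree U"
    have "pcompose (monom 1 n) [:0, 0, 1::complex:] = monom 1 n ^ 2"
      unfolding poly_eq_poly_eq_iff[symmetric]
      by (simp add: fun_eq_iff poly_pcompose poly_monom mult.commute flip: power2_eq_square power_mult)
    moreover have "(monom 1 n + U) ^ 2 = monom 1 n ^ 2 + (monom 1 n * U + monom 1 n * U + U ^ 2)"
      unfolding power2_eq_square by (simp only: distrib_left distrib_right ac_simps)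
    ultimately have "pcompose U [:0, 0, 1:] = monom 1 n * U + monom 1 n * U + U ^ 2 + [:0, 0, c:]"
      using eq unfolding SU pcompose_add by (simp only: add.assoc add_left_cancel)
    then have 1: "coeff (pcompose U [:0, 0, 1:]) (n + k)
       = 2 * coeff (monom 1 n * U) (n + k) + coeff (U ^ 2) (n + k) + coeff [:0, 0, c:] (n + k)"
      by (simp only: coeff_add mult_2)
    have 2: "coeff (pcompose U [:0, 0, 1:]) (n + k) = 0"
      using degU by (intro coeff_eq_0) (simp add: degX k_def)
    have 3: "coeff (U ^ 2) (n + k) = 0"
    proof (rule coeff_eq_0)
      have "degree (U ^ 2) \<le> k * 2"
        unfolding k_def by (rule degree_power_le)
      also have "\<dots> < n + k"
        using degU unfolding k_def by linarith
      finally show "degree (U ^ 2) < n + k" .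
    qed
    have 4: "coeff (monom 1 n * U) (n + k) = lead_coeff U"
      unfolding coeff_monom_mult by (simp add: k_def)
    have "U \<noteq> 0"
      using U0 by auto
    then have U_nz: "lead_coeff U \<noteq> 0"
      by (rule leading_coeff_neq_0)
    have *: "2 * lead_coeff U + (if n + k = 2 then c else 0) = 0"
      using 1 unfolding 2 3 4 c2 by (simp only: add_0_right)
    \<comment> \<open>A nonzero leading coefficient must be cancelled by c, which sits at degree
      2.\<close>
    then have nk: "n + k = 2"
      using U_nz by (cases "n + k = 2") auto
    with n2 have "k = 0" by linarith
    have "lead_coeff U = 1"
      using U0 \<open>k = 0\<close> unfolding k_def by (simp only:)
    have "2 + c = 0"
      using * unfolding nk \<open>lead_coeff U = 1\<close> by (simp only: if_True mult_1_right simp_thms)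
    then have "c = -2"
      by algebra
    then show ?thesis ..
  qed
qed

subsection \<open>Germs on the boundary of the disk determine the parameter\<close>

lemma holomorphic_logistic_funpow:
  "f holomorphic_on S \<Longrightarrow> (\<lambda>z. (logistic a ^^ n) (f z)) holomorphic_on S"
  by (induction n) (auto simp: logistic_def intro!: holomorphic_intros)

lemma holomorphic_eq_on_connected:
  assumes "f holomorphic_on S" "g holomorphic_on S" "open S" "connected S" "open T" "S \<inter> T \<noteq> {}"
    and "\<And>z. \<lbrakk>z \<in> S; z \<in> T\<rbrakk> \<Longrightarrow> f z = g z" and "z \<in> S"
  shows "f z = g z"
  using assms by (intro analytic_continuation_open[of "S \<inter> T" S f g z]) auto

text \<open>All balls contain the first one, which meets \<open>U\<close>. There any two of the
  functions agree with \<open>g\<close>, so they agree on the whole smaller ball.\<close>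

lemma entire_extension_of_ball_functions:
  fixes b :: "nat \<Rightarrow> real"
  assumes hol: "\<And>i. f i holomorphic_on ball 0 (b i)"
    and mono: "mono b" and unbounded: "\<And>x. \<exists>i. x < b i"
    and U: "open U" "ball 0 (b 0) \<inter> U \<noteq> {}"
    and agree: "\<And>i z. z \<in> ball 0 (b i) \<inter> U \<Longrightarrow> f i z = g z"
  obtains E where "E holomorphic_on UNIV" "\<And>z. z \<in> U \<Longrightarrow> E z = g z"
proof -
  have same: "f i z = f k z" if "i \<le> k" "z \<in> ball 0 (b i)" for i k z
  proof (rule holomorphic_eq_on_connected[of "f i" "ball 0 (b i)" "f k" U])
    have sub: "ball 0 (b j) \<subseteq> ball (0::complex) (b l)" if "j \<le> l" for j l
      using monoD[OF mono that] by (rule subset_ball)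
    show "f k holomorphic_on ball 0 (b i)"
      using hol[of k] sub[OF that(1)] by (rule holomorphic_on_subset)
    show "ball 0 (b i) \<inter> U \<noteq> {}"
      using U(2) sub[of 0 i] by blast
    show "f i z = f k z" if "z \<in> ball 0 (b i)" "z \<in> U" for z
      using that agree[of z i] agree[of z k] sub[OF \<open>i \<le> k\<close>] by auto
  qed (use U(1) hol that in auto)
  define E where "E z = f (LEAST i. cmod z < b i) z" for z
  have E: "E z = f i z" if "z \<in> ball 0 (b i)" for i z
  proof -
    have "cmod z < b (LEAST i. cmod z < b i)" "(LEAST i. cmod z < b i) \<le> i"
      using that by (auto intro: LeastI Least_le)
    then show ?thesis
      unfolding E_def by (intro same) auto
  qed
  show ?thesis
  proof
    have "E field_differentiable at z" for z
    proof -
      obtain i where i: "cmod z < b i" using unbounded by blast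
      have "E holomorphic_on ball 0 (b i)"
        by (rule holomorphic_transform[OF hol[of i]]) (use E in auto)
      then show ?thesis
        using i by (auto intro: holomorphic_on_imp_differentiable_at)
    qed
    then show "E holomorphic_on UNIV"
      by (auto simp: holomorphic_on_def)
    show "E z = g z" if "z \<in> U" for z
    proof -
      obtain i where "cmod z < b i" using unbounded by blast
      then show ?thesis
        using E[of z i] agree[of z i] that by auto
    qed
  qed
qed

text \<open>\<open>Q (1 / x)\<close> is the Boettcher coordinate of p at infinity. Beyond modulus
  \<open>R\<close> it is defined and p at least doubles the modulus; on the disk of radius
  \<open>r\<close> the germ \<open>F\<close> is inverted by \<open>Q\<close>; \<open>m\<close>
  bounds from below the modulus of the coordinate at the first exit from the disk of radius
  \<open>R\<close>.\<close>

locale boettcher_coordinates =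
  fixes a :: complex and F Q :: "complex \<Rightarrow> complex" and R r m :: real
  assumes a_nz: "a \<noteq> 0" and R_pos: "0 < R" and r_pos: "0 < r" and r_le: "r \<le> 1"
    and m_pos: "0 < m" and m_le: "m \<le> r"
    and F_holo: "F holomorphic_on ball 0 r"
    and F_0: "F 0 = 0" and F_deriv: "(F has_field_derivative - a) (at 0)"
    and F_nz: "\<And>z. \<lbrakk>z \<noteq> 0; cmod z < r\<rbrakk> \<Longrightarrow> F z \<noteq> 0"
    and F_small: "\<And>z. cmod z < r \<Longrightarrow> cmod (F z) < 1 / R"
    and Q_F: "\<And>z. cmod z < r \<Longrightarrow> Q (F z) = z"
    and F_rec: "\<And>z. \<lbrakk>z \<noteq> 0; cmod z < r\<rbrakk> \<Longrightarrow> logistic a (1 / F z) = 1 / F (z\<^sup>2)"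
    and Q_holo: "Q holomorphic_on ball 0 (1 / R)"
    and Q_small: "\<And>y. cmod y < 1 / R \<Longrightarrow> cmod (Q y) < 1"
    and F_Q: "\<And>y. cmod y < 1 / R \<Longrightarrow> F (Q y) = y"
    and Q_rec: "\<And>x. R < cmod x \<Longrightarrow> Q (1 / logistic a x) = (Q (1 / x))\<^sup>2"
    and escape: "\<And>x. R \<le> cmod x \<Longrightarrow> 2 * cmod x \<le> cmod (logistic a x)"
    and Q_lower: "\<And>x. \<lbrakk>cmod x \<le> R; R < cmod (logistic a x)\<rbrakk> \<Longrightarrow> m \<le> cmod (Q (1 / logistic a x))"
begin

section \<open>Escape times and Boettcher coordinates of iterates\<close>

abbreviation p :: "nat \<Rightarrow> complex \<Rightarrow> complex" where "p n \<equiv> logistic a ^^ n"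

lemma p_add: "p (i + n) x = p i (p n x)"
  by (simp add: funpow_add)

lemma escape_p: "R < cmod x \<Longrightarrow> R < cmod (p n x)"
proof (induction n)
  case (Suc n)
  then show ?case using escape[of "p n x"] R_pos by auto
qed auto

lemma escape_mono:
  assumes "R < cmod (p n x)" "n \<le> k"
  shows "R < cmod (p k x)"
  using escape_p[OF assms(1), of "k - n"] assms(2) by (simp flip: p_add)

lemma inverse_small: "R < cmod x \<Longrightarrow> cmod (1 / x) < 1 / R"
  using R_pos by (simp add: norm_divide frac_less2)

lemma Q_p:
  assumes "R < cmod x"
  shows "Q (1 / p n x) = Q (1 / x) ^ 2 ^ n"
proof (induction n)
  case (Suc n)
  then show ?case using Q_rec[OF escape_p[OF assms, of n]]
    by (simp add: power_mult mult.commute flip: power_mult)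
qed auto

lemma Q_p_mono:
  assumes "R < cmod (p n x)" "n \<le> k"
  shows "Q (1 / p k x) = Q (1 / p n x) ^ 2 ^ (k - n)"
  using Q_p[OF assms(1), of "k - n"] assms(2) by (simp flip: p_add)

text \<open>
  If \<open>p k x\<close> is the first iterate outside the disk of radius \<open>R\<close> and \<open>k > 0\<close>, then \<open>Q_lower\<close> bounds the
  modulus \<open>s ^ 2 ^ k\<close> of its Boettcher coordinate from below, which bounds \<open>k\<close>.
\<close>
lemma escape_time_bound:
  assumes n: "R < cmod (p n x)" "cmod (Q (1 / p n x)) = s ^ 2 ^ n"
    and s: "0 \<le> s" "s \<le> 1" "s ^ 2 ^ j < m"
  shows "R < cmod (p j x) \<and> cmod (Q (1 / p j x)) = s ^ 2 ^ j"
proof -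
  define k where "k = (LEAST k. R < cmod (p k x))"
  have k: "R < cmod (p k x)" "k \<le> n"
    unfolding k_def using n(1) by (auto intro: LeastI Least_le)
  have pow: "s ^ 2 ^ i = (s ^ 2 ^ k) ^ 2 ^ (i - k)" if "k \<le> i" for i
    using that by (simp flip: power_mult power_add)
  have "cmod (Q (1 / p k x)) ^ 2 ^ (n - k) = (s ^ 2 ^ k) ^ 2 ^ (n - k)"
    using n(2) Q_p_mono[OF k] pow[OF k(2)] by (simp add: norm_power)
  then have Qk: "cmod (Q (1 / p k x)) = s ^ 2 ^ k"
    using s(1) by (subst (asm) power_eq_iff_eq_base) auto
  have kj: "k \<le> j"
  proof (rule ccontr)
    assume "\<not> k \<le> j"
    then obtain i where i: "k = Suc i" "j \<le> k"
      by (cases k) auto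
    then have "\<not> R < cmod (p i x)"
      unfolding k_def by (metis lessI not_less_Least)
    then have "m \<le> s ^ 2 ^ k"
      using Q_lower[of "p i x"] k(1) Qk i(1) by simp
    also have "\<dots> \<le> s ^ 2 ^ j"
      using s i(2) by (intro power_decreasing power_increasing) auto
    finally show False using s(3) by simp
  qed
  show ?thesis
    using escape_mono[OF k(1) kj] Q_p_mono[OF k(1) kj] Qk pow[OF kj] by (simp add: norm_power)
qed

text \<open>The hypothesis fixes the Boettcher coordinate of \<open>p j (\<Psi> (u / 2 ^ j))\<close>
  only up to a factor of modulus 1. The maximum modulus principle makes this factor constant, and an
  imaginary translation of bounded length removes it.\<close>

lemma entire_from_boundary_germ:
  assumes hol: "\<Psi> holomorphic_on ball 0 \<rho>" and "0 < \<rho>"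
    and green: "\<And>v. \<lbrakk>cmod v < \<rho>; Re v < 0\<rbrakk> \<Longrightarrow>
      \<exists>n. R < cmod (p n (\<Psi> v)) \<and> cmod (Q (1 / p n (\<Psi> v))) = exp (Re v) ^ 2 ^ n"
  obtains E where "E holomorphic_on UNIV" "\<And>u. cmod (exp u) < m \<Longrightarrow> E u = 1 / F (exp u)"
proof -
  define U where "U = {u. cmod (exp u) < m}"
  have U_eq: "U = {u. Re u < ln m}"
    unfolding U_def using m_pos by (auto simp: ln_less_cancel_iff simp flip: ln_less_cancel_iff[of "exp _"])
  have "open U" "convex U"
    unfolding U_eq by (auto intro: open_halfspace_Re_lt convex_halfspace_Re_lt)
  have m1: "m \<le> 1" using m_le r_le by simp
  \<comment> \<open>A base point in the half-plane \<open>U\<close>, shared by all the rescaled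
    balls from \<open>j0\<close> on.\<close>
  define \<xi> :: complex where "\<xi> = of_real (ln m - 1)"
  have \<xi>: "\<xi> \<in> U" by (simp add: U_eq \<xi>_def)
  have "filterlim (\<lambda>j. 2 ^ j * \<rho>) at_top sequentially"
    using \<open>0 < \<rho>\<close> by real_asymp
  \<comment> \<open>The margin 8 exceeds the loss of 7 caused below by a translation through an
    angle less than \<open>2 * pi\<close>.\<close>
  then have "eventually (\<lambda>j. cmod \<xi> + 8 < 2 ^ j * \<rho>) sequentially"
    by (rule filterlim_at_top_dense[THEN iffD1, rule_format])
  then obtain j0 where j0: "cmod \<xi> + 8 < 2 ^ j * \<rho>" if "j \<ge> j0" for j
    by (auto simp: eventually_sequentially)
  define \<Psi>' where "\<Psi>' j u = \<Psi> (u / 2 ^ j)" for j :: nat and u :: complex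
  have \<Psi>'_hol: "(\<lambda>u. p j (\<Psi>' j u)) holomorphic_on ball 0 (2 ^ j * \<rho>)" for j
  proof -
    have "(\<Psi> \<circ> (\<lambda>u. u / 2 ^ j)) holomorphic_on ball 0 (2 ^ j * \<rho>)"
      by (rule holomorphic_on_compose_gen[OF _ hol])
        (auto intro!: holomorphic_intros simp: norm_divide norm_power field_simps)
    then show ?thesis
      unfolding \<Psi>'_def o_def by (rule holomorphic_logistic_funpow)
  qed
  \<comment> \<open>On \<open>U\<close> the modulus of \<open>exp u\<close> is below
    \<open>m\<close>; this is what allows \<open>escape_time_bound\<close> to replace the unknown
    escape index by j itself.\<close>
  have esc: "R < cmod (p j (\<Psi>' j u)) \<and> cmod (Q (1 / p j (\<Psi>' j u))) = cmod (exp u)"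
    if "cmod u < 2 ^ j * \<rho>" "u \<in> U" for j u
  proof -
    have "Re u < 0" using that(2) m_pos m1 by (auto simp: U_eq intro: less_le_trans)
    have v: "cmod (u / 2 ^ j) < \<rho>" "Re (u / 2 ^ j) = Re u / 2 ^ j"
      using that(1) by (auto simp: norm_divide norm_power field_simps Re_divide_numeral)
    have pw: "exp (Re (u / 2 ^ j)) ^ 2 ^ j = cmod (exp u)"
      by (simp add: v(2) flip: exp_of_nat_mult)
    from v \<open>Re u < 0\<close> obtain n where
      "R < cmod (p n (\<Psi>' j u))" "cmod (Q (1 / p n (\<Psi>' j u))) = exp (Re (u / 2 ^ j)) ^ 2 ^ n"
      using green[of "u / 2 ^ j"] unfolding \<Psi>'_def by (auto simp: divide_neg_pos)
    from escape_time_bound[OF this, of j] show ?thesis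
      using that(2) \<open>Re u < 0\<close> unfolding pw U_def by (simp add: v(2) divide_neg_pos less_imp_le)
  qed
  have "\<exists>\<theta>. 0 \<le> \<theta> \<and> \<theta> < 7 \<and> (\<forall>u\<in>ball 0 (2 ^ j * \<rho>) \<inter> U. p j (\<Psi>' j u) = 1 / F (exp (u + \<i> * of_real \<theta>)))"
    if "j \<ge> j0" for j
  proof -
    define D where "D = ball 0 (2 ^ j * \<rho>) \<inter> U"
    have D: "open D" "connected D" "\<xi> \<in> D"
      unfolding D_def using \<open>open U\<close> \<open>convex U\<close> \<xi> j0[OF that]
      by (auto intro: convex_connected convex_Int convex_ball)
    \<comment> \<open>The Boettcher coordinate divided by \<open>exp u\<close>: holomorphic on the
      connected set \<open>D\<close> and of modulus 1 there, hence constant.\<close>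
    define H where "H u = Q (1 / p j (\<Psi>' j u)) * exp (- u)" for u
    have nz: "p j (\<Psi>' j u) \<noteq> 0" "1 / p j (\<Psi>' j u) \<in> ball 0 (1 / R)" if "u \<in> D" for u
      using esc[of u j] that R_pos inverse_small[of "p j (\<Psi>' j u)"] by (auto simp: D_def)
    have "(Q \<circ> (\<lambda>u. 1 / p j (\<Psi>' j u))) holomorphic_on D"
    proof (rule holomorphic_on_compose_gen[OF _ Q_holo])
      show "(\<lambda>u. 1 / p j (\<Psi>' j u)) holomorphic_on D"
        by (intro holomorphic_intros holomorphic_on_subset[OF \<Psi>'_hol]) (use nz in \<open>auto simp: D_def\<close>)
    qed (use nz in auto)
    then have "H holomorphic_on D"
      unfolding H_def o_def by (intro holomorphic_intros)
    moreover have normH: "cmod (H u) = 1" if "u \<in> D" for u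
      using esc[of u j] that by (simp add: D_def H_def norm_mult exp_minus norm_inverse)
    ultimately have "H constant_on D"
      using D by (intro maximum_modulus_principle[of H D D \<xi>]) auto
    then obtain c where c: "\<And>u. u \<in> D \<Longrightarrow> H u = c"
      by (auto simp: constant_on_def)
    then have "cmod c = 1" using normH[OF D(3)] D(3) by simp
    then have c_exp: "c = exp (\<i> * of_real (Arg2pi c))"
      using Arg2pi_eq[of c] by simp
    have "p j (\<Psi>' j u) = 1 / F (exp (u + \<i> * of_real (Arg2pi c)))" if "u \<in> D" for u
    proof -
      have "Q (1 / p j (\<Psi>' j u)) = exp (u + \<i> * of_real (Arg2pi c))"
        using c[OF that] c_exp by (simp add: H_def exp_add exp_minus field_simps)
      with F_Q[of "1 / p j (\<Psi>' j u)"] nz(2)[OF that]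
      have "F (exp (u + \<i> * of_real (Arg2pi c))) = 1 / p j (\<Psi>' j u)"
        by simp
      then show ?thesis by simp
    qed
    moreover have "0 \<le> Arg2pi c" "Arg2pi c < 7"
      using Arg2pi[of c] pi_less_4 pi_approx by auto
    ultimately show ?thesis
      unfolding D_def by blast
  qed
  then obtain \<theta> where \<theta>: "\<And>j. j \<ge> j0 \<Longrightarrow> 0 \<le> \<theta> j \<and> \<theta> j < 7"
    and \<theta>_eq: "\<And>j u. \<lbrakk>j \<ge> j0; u \<in> ball 0 (2 ^ j * \<rho>) \<inter> U\<rbrakk>
        \<Longrightarrow> p j (\<Psi>' j u) = 1 / F (exp (u + \<i> * of_real (\<theta> j)))"
    by metis
  \<comment> \<open>The angles need not converge, but they are bounded, so these radii still tend to
    infinity. The half-plane \<open>U\<close> is invariant under imaginary translations.\<close>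
  define b where "b i = 2 ^ (j0 + i) * \<rho> - 7" for i
  define f where "f i u = p (j0 + i) (\<Psi>' (j0 + i) (u - \<i> * of_real (\<theta> (j0 + i))))" for i u
  have shift: "u - \<i> * of_real (\<theta> (j0 + i)) \<in> ball 0 (2 ^ (j0 + i) * \<rho>)" if "u \<in> ball 0 (b i)" for u i
    using that \<theta>[of "j0 + i"] norm_triangle_ineq4[of u "\<i> * of_real (\<theta> (j0 + i))"]
    by (simp add: b_def norm_mult)
  show ?thesis
  proof (rule entire_extension_of_ball_functions[of f b U "\<lambda>u. 1 / F (exp u)"])
    show "f i holomorphic_on ball 0 (b i)" for i
    proof -
      have "((\<lambda>u. p (j0 + i) (\<Psi>' (j0 + i) u)) \<circ> (\<lambda>u. u - \<i> * of_real (\<theta> (j0 + i)))) holomorphic_on ball 0 (b i)"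
        by (rule holomorphic_on_compose_gen[OF _ \<Psi>'_hol]) (use shift in \<open>auto intro!: holomorphic_intros\<close>)
      then show ?thesis unfolding f_def o_def .
    qed
    show "mono b"
      unfolding b_def mono_def using \<open>0 < \<rho>\<close> by (auto intro!: mult_right_mono power_increasing)
    show "\<exists>i. x < b i" for x
    proof -
      have "filterlim b at_top sequentially"
        unfolding b_def using \<open>0 < \<rho>\<close> by real_asymp
      then have "eventually (\<lambda>i. x < b i) sequentially"
        by (rule filterlim_at_top_dense[THEN iffD1, rule_format])
      then show ?thesis by (auto simp: eventually_sequentially)
    qed
    show "open U" by fact
    have "\<xi> \<in> ball 0 (b 0) \<inter> U"
      using \<xi> j0[of j0] by (simp add: b_def)
    then show "ball 0 (b 0) \<inter> U \<noteq> {}"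
      by blast
    show "f i u = 1 / F (exp u)" if "u \<in> ball 0 (b i) \<inter> U" for i u
      using \<theta>_eq[of "j0 + i" "u - \<i> * of_real (\<theta> (j0 + i))"] shift[of u i] that
      by (simp add: f_def U_eq)
  qed (use that in \<open>auto simp: U_def\<close>)
qed

text \<open>\<open>E\<close> is invariant under the periods of \<open>exp\<close> and so descends to
  the punctured plane, where doubling u becomes squaring z. Squaring spreads a bound on the annulus
  \<open>2 \<le> cmod z \<le> 4\<close> to all larger moduli with the same exponent.\<close>

lemma parameter_of_entire:
  assumes E: "E holomorphic_on UNIV" and E_eq: "\<And>u. cmod (exp u) < m \<Longrightarrow> E u = 1 / F (exp u)"
  shows "a \<in> {-2, 2, 4}"
proof -
  define U where "U = {u. cmod (exp u) < m}"
  have "open U"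
    unfolding U_def by (intro open_Collect_less continuous_intros)
  have "of_real (ln m - 1) \<in> U"
    using m_pos by (simp add: U_def norm_exp_eq_Re exp_diff field_simps)
  then have "U \<noteq> {}" by blast
  have E_eq: "E u = 1 / F (exp u)" if "u \<in> U" for u
    using that E_eq by (simp add: U_def)
  have diff: "E field_differentiable at z" for z
    using E by (simp add: holomorphic_on_def)
  have hol: "(\<lambda>z. E (g z)) holomorphic_on S" if "g holomorphic_on S" for g S
    using holomorphic_on_compose_gen[OF that E] by (simp add: o_def)
  have per: "E u = E w" if "exp u = exp w" for u w
  proof -
    have "E w = E (w + (u - w))"
    proof (rule holomorphic_eq_on_connected[of E UNIV "\<lambda>z. E (z + (u - w))" U])
      show "E z = E (z + (u - w))" if "z \<in> U" for z
      proof -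
        have e: "exp (z + (u - w)) = exp z"
          using \<open>exp u = exp w\<close> by (simp add: exp_add exp_diff)
        have "z + (u - w) \<in> U"
          using that unfolding U_def mem_Collect_eq e .
        then show ?thesis
          using E_eq[OF that] E_eq[of "z + (u - w)"] unfolding e by simp
      qed
    qed (use \<open>open U\<close> \<open>U \<noteq> {}\<close> E in \<open>auto intro!: hol holomorphic_intros\<close>)
    then show ?thesis by simp
  qed
  have rec: "E (2 * u) = logistic a (E u)" for u
  proof (rule holomorphic_eq_on_connected[of "\<lambda>u. E (2 * u)" UNIV "\<lambda>u. logistic a (E u)" U])
    show "(\<lambda>u. logistic a (E u)) holomorphic_on UNIV"
      unfolding logistic_def by (intro holomorphic_intros E)
    show "E (2 * u) = logistic a (E u)" if "u \<in> U" for u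
    proof -
      have lt: "cmod (exp u) < m" "m \<le> 1" using that m_le r_le by (auto simp: U_def)
      have "cmod (exp (2 * u)) = cmod (exp u) * cmod (exp u)"
        by (simp add: exp_double power2_eq_square norm_mult)
      also have "\<dots> \<le> cmod (exp u) * 1"
        using lt by (intro mult_left_mono) (auto simp del: norm_exp_eq_Re)
      finally have "2 * u \<in> U" using lt by (simp add: U_def del: norm_exp_eq_Re)
      then show ?thesis
        using E_eq[OF that] E_eq[of "2 * u"] F_rec[of "exp u"] lt m_le by (simp add: exp_double)
    qed
  qed (use \<open>open U\<close> \<open>U \<noteq> {}\<close> in \<open>auto intro!: hol holomorphic_intros\<close>)

  define \<psi> where "\<psi> z = E (Ln z)" for z
  \<comment> \<open>\<open>h\<close> continues \<open>z / F z\<close>. The factor z removes the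
    simple pole of \<open>1 / F\<close> at 0, and \<open>- 1 / a\<close> is the limit because
    \<open>F\<close> has derivative \<open>- a\<close> there.\<close>
  define h where "h z = (if z = 0 then - 1 / a else z * \<psi> z)" for z
  have \<psi>_rec: "\<psi> (z\<^sup>2) = logistic a (\<psi> z)" if "z \<noteq> 0" for z
  proof -
    have "exp (Ln (z\<^sup>2)) = exp (2 * Ln z)"
      using that by (simp add: exp_double)
    then show ?thesis
      unfolding \<psi>_def by (metis per rec)
  qed
  have h_hol0: "h holomorphic_on UNIV - {0}"
  proof -
    define A where "A = - (\<real>\<^sub>\<le>\<^sub>0 :: complex set)"
    have oA: "open A"
      unfolding A_def by (simp add: closed_nonpos_Reals_complex open_Compl)
    have oB: "open (uminus ` A)"
      using oA by (rule open_negations)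
    have 1: "h holomorphic_on A"
    proof (rule holomorphic_transform)
      show "(\<lambda>z. z * E (Ln z)) holomorphic_on A"
        by (intro holomorphic_intros hol) (auto simp: A_def)
    qed (auto simp: h_def A_def \<psi>_def)
    have 2: "h holomorphic_on uminus ` A"
    proof (rule holomorphic_transform)
      \<comment> \<open>A second branch of the logarithm, cut along the positive axis, covers the
        negative axis; by \<open>per\<close> it defines the same function.\<close>
      show "(\<lambda>z. z * E (Ln (- z) + \<i> * of_real pi)) holomorphic_on uminus ` A"
        by (intro holomorphic_intros hol) (auto simp: A_def)
      show "z * E (Ln (- z) + \<i> * of_real pi) = h z" if "z \<in> uminus ` A" for z
      proof -
        have "z \<noteq> 0" using that by (auto simp: A_def)
        then have "exp (Ln (- z) + \<i> * of_real pi) = exp (Ln z)"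
          by (simp add: exp_add)
        then show ?thesis
          using \<open>z \<noteq> 0\<close> per by (auto simp: h_def \<psi>_def)
      qed
    qed
    have "UNIV - {0} \<subseteq> A \<union> uminus ` A"
    proof
      fix z :: complex assume "z \<in> UNIV - {0}"
      then have "z \<in> A \<or> - z \<in> A"
        by (auto simp: A_def complex_nonpos_Reals_iff complex_eq_iff)
      then show "z \<in> A \<union> uminus ` A"
        by (auto intro: image_eqI[of z uminus "- z"])
    qed
    then show ?thesis
      using holomorphic_on_Un[OF 1 2 oA oB] by (rule holomorphic_on_subset[rotated])
  qed
  have "isCont h z" for z
  proof (cases "z = 0")
    case False
    then show ?thesis
      using h_hol0 by (meson DiffI UNIV_I continuous_on_eq_continuous_at holomorphic_on_imp_continuous_on
          open_Diff open_UNIV closed_singleton singletonD)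
  next
    case True
    have "((\<lambda>z. F z / z) \<longlongrightarrow> - a) (at 0)"
      using F_deriv F_0 by (simp add: has_field_derivative_iff)
    then have "((\<lambda>z. inverse (F z / z)) \<longlongrightarrow> inverse (- a)) (at 0)"
      using a_nz by (intro tendsto_inverse) auto
    moreover have "\<forall>\<^sub>F z in at 0. inverse (F z / z) = h z"
    proof -
      have "\<forall>\<^sub>F z in at (0::complex). z \<in> ball 0 m - {0}"
        using m_pos by (intro eventually_at_in_open) auto
      then show ?thesis
      proof eventually_elim
        case (elim z)
        then show ?case
          using E_eq[of "Ln z"] by (simp add: h_def \<psi>_def U_def)
      qed
    qed
    ultimately have "(h \<longlongrightarrow> inverse (- a)) (at 0)"
      by (rule Lim_transform_eventually)
    then show ?thesis
      using True by (simp add: isCont_def h_def divide_inverse)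
  qed
  then have cont: "continuous_on S h" for S
    by (simp add: continuous_at_imp_continuous_on)
  then have h_hol: "h holomorphic_on UNIV"
    by (intro no_isolated_singularity[of UNIV h "{0}"] h_hol0) auto

  \<comment> \<open>The factor \<open>A\<close> makes
    \<open>b (z\<^sup>2) \<le> (b z)\<^sup>2\<close> hold with constant 1; any other constant would
    accumulate under repeated squaring.\<close>
  define A where "A = cmod a + 1"
  define b where "b z = A * (cmod (\<psi> z) + 1)" for z
  have A1: "A \<ge> 1" by (simp add: A_def)
  have b_rec: "b (z\<^sup>2) \<le> (b z)\<^sup>2" if "z \<noteq> 0" for z
  proof -
    define X where "X = cmod (\<psi> z)"
    have "X \<ge> 0" by (simp add: X_def)
    have "cmod (logistic a (\<psi> z)) \<le> cmod a * X * (1 + X)"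
      unfolding logistic_def norm_mult X_def
      using norm_triangle_ineq4[of 1 "\<psi> z"] by (intro mult_left_mono) auto
    then have "cmod (logistic a (\<psi> z)) + 1 \<le> cmod a * (X * (1 + X)) + 1"
      by (simp add: mult.assoc)
    also have "\<dots> \<le> cmod a * (X + 1)\<^sup>2 + (X + 1)\<^sup>2"
      using \<open>X \<ge> 0\<close> by (intro add_mono mult_left_mono) (auto simp: power2_eq_square algebra_simps)
    also have "\<dots> = A * (X + 1)\<^sup>2"
      by (simp add: A_def algebra_simps)
    finally have "A * (cmod (logistic a (\<psi> z)) + 1) \<le> A * (A * (X + 1)\<^sup>2)"
      using A1 by (intro mult_left_mono) auto
    then show ?thesis
      unfolding b_def \<psi>_rec[OF that] X_def by (simp add: power2_eq_square algebra_simps)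
  qed
  have "compact (h ` cball 0 4)"
    by (intro compact_continuous_image cont compact_cball)
  then have "bounded (h ` cball 0 4)"
    by (rule compact_imp_bounded)
  then obtain M where "\<forall>x\<in>h ` cball 0 4. cmod x \<le> M"
    unfolding bounded_iff ..
  then have M: "cmod (h z) \<le> M" if "cmod z \<le> 4" for z
    using that by simp
  obtain K where K: "A * (M + 1) < 2 ^ K"
    using real_arch_pow[of 2 "A * (M + 1)"] by auto
  have base: "b z \<le> cmod z ^ K" if "2 \<le> cmod z" "cmod z \<le> 4" for z
  proof -
    have "z \<noteq> 0" using that by auto
    have "1 * cmod (\<psi> z) \<le> cmod z * cmod (\<psi> z)"
      using that by (intro mult_right_mono) auto
    also have "\<dots> \<le> M"
      using M[OF that(2)] \<open>z \<noteq> 0\<close> by (simp add: h_def norm_mult)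
    finally have "b z \<le> A * (M + 1)"
      unfolding b_def using A1 by (intro mult_left_mono) auto
    also have "\<dots> \<le> 2 ^ K" using K by simp
    also have "\<dots> \<le> cmod z ^ K" using that by (intro power_mono) auto
    finally show ?thesis .
  qed
  \<comment> \<open>Induction on the number of square roots leading back to the annulus
    \<open>2 \<le> cmod z \<le> 4\<close>. A modulus above 4 has square roots of modulus at least 2,
    so the annulus is not jumped over.\<close>
  have growth: "b z \<le> cmod z ^ K" if "2 \<le> cmod z" "cmod z \<le> 2 ^ 2 ^ Suc n" for z n
    using that
  proof (induction n arbitrary: z)
    case 0
    then show ?case using base by simp
  next
    case (Suc n)
    show ?case
    proof (cases "cmod z \<le> 4")
      case True
      then show ?thesis using base Suc.prems by simp
    next
      case False
      define w where "w = csqrt z"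
      have w: "w\<^sup>2 = z" by (simp add: w_def)
      then have w2: "(cmod w)\<^sup>2 = cmod z" by (metis norm_power)
      have "2\<^sup>2 \<le> (cmod w)\<^sup>2" using False w2 by simp
      then have "2 \<le> cmod w" by (rule power2_le_imp_le) simp
      have "(cmod w)\<^sup>2 \<le> (2 ^ 2 ^ Suc n)\<^sup>2"
        using Suc.prems(2) w2 by (simp flip: power_mult)
      then have "cmod w \<le> 2 ^ 2 ^ Suc n" by (rule power2_le_imp_le) simp
      have "w \<noteq> 0" using \<open>2 \<le> cmod w\<close> by auto
      have "b z \<le> (b w)\<^sup>2"
        using b_rec[OF \<open>w \<noteq> 0\<close>] w by simp
      also have "\<dots> \<le> (cmod w ^ K)\<^sup>2"
        using Suc.IH[OF \<open>2 \<le> cmod w\<close> \<open>cmod w \<le> 2 ^ 2 ^ Suc n\<close>] A1 by (intro power_mono) (auto simp: b_def)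
      also have "\<dots> = cmod z ^ K"
        by (simp add: mult.commute flip: w2 power_mult)
      finally show ?thesis .
    qed
  qed
  have bound: "cmod (h z) \<le> 1 * cmod z ^ Suc K" if "2 \<le> cmod z" for z
  proof -
    obtain n where "cmod z < 2 ^ n" using real_arch_pow[of 2 "cmod z"] by auto
    also have "(2::real) ^ n \<le> 2 ^ 2 ^ Suc n"
    proof (rule power_increasing)
      show "n \<le> 2 ^ Suc n"
        unfolding power_Suc using less_exp[of n] by linarith
    qed simp
    finally have "b z \<le> cmod z ^ K" using growth[OF that, of n] by simp
    moreover have "cmod (\<psi> z) \<le> b z"
      using mult_right_mono[OF A1, of "cmod (\<psi> z)"] A1 by (simp add: b_def algebra_simps)
    moreover have "z \<noteq> 0" using that by auto
    ultimately show ?thesis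
      by (auto simp: h_def norm_mult intro!: mult_left_mono)
  qed
  define P where "P = (\<Sum>k\<le>Suc K. monom ((deriv ^^ k) h 0 / fact k) k)"
  have P: "poly P z = h z" for z
    using Liouville_polynomial[where \<xi> = z, OF h_hol bound] by (simp add: P_def poly_sum poly_monom del: sum.atMost_Suc)
  \<comment> \<open>Completing the square: this affine change turns the recursion for
    \<open>h\<close> into the equation of \<open>squaring_equation_polynomial\<close>.\<close>
  define S where "S = smult (- a) (P - [:0, 1 / 2:])"
  define c where "c = a / 2 - a\<^sup>2 / 4"
  have S: "poly S z = - a * (h z - z / 2)" for z
    by (simp add: S_def P algebra_simps)
  have S0: "poly S 0 = 1"
    using a_nz by (simp add: S h_def)
  have "poly S (z\<^sup>2) = (poly S z)\<^sup>2 + c * z\<^sup>2" for z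
  proof (cases "z = 0")
    case False
    then have "h (z\<^sup>2) = z\<^sup>2 * \<psi> (z\<^sup>2)"
      by (simp add: h_def)
    also have "\<dots> = a * (h z * (z - h z))"
      unfolding \<psi>_rec[OF False] logistic_def
      using False by (simp add: h_def power2_eq_square algebra_simps)
    finally have h2: "h (z\<^sup>2) = a * (h z * (z - h z))" .
    show ?thesis
      unfolding S c_def h2 by (simp add: field_simps power2_eq_square)
  qed (simp add: S0)
  then have "pcompose S [:0, 0, 1:] = S ^ 2 + [:0, 0, c:]"
    unfolding poly_eq_poly_eq_iff[symmetric] fun_eq_iff
    by (simp add: poly_pcompose power2_eq_square algebra_simps)
  then have "c = 0 \<or> c = -2"
    using S0 by (intro squaring_equation_polynomial) (auto simp: poly_0_coeff_0)
  \<comment> \<open>For nonzero a, c = 0 means a = 2, and c = -2 is the equation a^2 - 2 a - 8 =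
    0.\<close>
  then have "a * (2 - a) = 0 \<or> (a - 4) * (a + 2) = 0"
    unfolding c_def by (auto simp: field_simps power2_eq_square)
  then show ?thesis
    using a_nz by (auto simp: add_eq_0_iff2)
qed

theorem parameter_of_boundary_germ:
  assumes "\<Psi> holomorphic_on ball 0 \<rho>" "0 < \<rho>"
    and "\<And>v. \<lbrakk>cmod v < \<rho>; Re v < 0\<rbrakk> \<Longrightarrow>
      \<exists>n. R < cmod (p n (\<Psi> v)) \<and> cmod (Q (1 / p n (\<Psi> v))) = exp (Re v) ^ 2 ^ n"
  shows "a \<in> {-2, 2, 4}"
  using entire_from_boundary_germ[OF assms] parameter_of_entire by metis

end

subsection \<open>Existence and uniqueness of the solution\<close>

text \<open>Multiply by the sum of the two roots; a positive lower bound on its real part bounds its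
  modulus from below.\<close>

lemma csqrt_diff_bound:
  assumes "e \<le> Re (csqrt x) + Re (csqrt y)" "0 < e"
  shows "cmod (csqrt x - csqrt y) \<le> cmod (x - y) / e"
proof -
  have "e \<le> cmod (csqrt x + csqrt y)"
    using assms complex_Re_le_cmod[of "csqrt x + csqrt y"] by (simp del: csqrt.simps)
  then have "cmod (csqrt x - csqrt y) * e \<le> cmod (csqrt x - csqrt y) * cmod (csqrt x + csqrt y)"
    by (intro mult_left_mono) auto
  also have "\<dots> = cmod ((csqrt x)\<^sup>2 - (csqrt y)\<^sup>2)"
    by (simp only: norm_mult[symmetric] power2_eq_square) (simp add: algebra_simps)
  finally show ?thesis
    using assms(2) by (simp add: field_simps)
qed

text \<open>Solving for S gives the fixed-point equation S(z) = sqrt (S(z^2) - c z^2), iterated here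
  from the constant 1. Squaring maps the small disk into itself, and near 1 the square root
  contracts.\<close>

lemma squaring_equation_solution_exists:
  obtains S \<rho> where "0 < \<rho>" "\<rho> \<le> 1" "S holomorphic_on ball 0 \<rho>" "S 0 = 1"
    "\<And>z. cmod z < \<rho> \<Longrightarrow> S (z\<^sup>2) = (S z)\<^sup>2 + c * z\<^sup>2"
proof -
  \<comment> \<open>Keeps \<open>(1 + cmod c) * cmod z\<close> below 1, so that every iterate stays
    within \<open>cmod z\<close> of 1; as \<open>\<rho> \<le> 1 / 4\<close>, real parts are at least
    3/4.\<close>
  define \<rho> where "\<rho> = 1 / (4 * (1 + cmod c))"
  have \<rho>: "0 < \<rho>" "\<rho> \<le> 1 / 4"
    unfolding \<rho>_def by (auto simp: field_simps add_pos_nonneg)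
  define T where "T = rec_nat (\<lambda>z. 1) (\<lambda>n T z. csqrt (T (z\<^sup>2) - c * z\<^sup>2))"
  have T0: "T 0 z = 1" and TS: "T (Suc n) z = csqrt (T n (z\<^sup>2) - c * z\<^sup>2)" for n z
    by (simp_all add: T_def)
  have sq: "cmod (z\<^sup>2) < \<rho>" if "cmod z < \<rho>" for z
  proof -
    have "cmod z * cmod z \<le> cmod z * 1"
      using that \<rho> by (intro mult_left_mono) auto
    with that show ?thesis by (simp add: power2_eq_square norm_mult)
  qed
  have T_near1: "cmod (T n z - 1) \<le> cmod z" if "cmod z < \<rho>" for n z
    using that
  proof (induction n arbitrary: z)
    case (Suc n)
    have "cmod (T (Suc n) z - 1) \<le> cmod (T n (z\<^sup>2) - c * z\<^sup>2 - 1) / 1"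
      unfolding TS using csqrt_diff_bound[of 1 "T n (z\<^sup>2) - c * z\<^sup>2" 1] Re_csqrt[of "T n (z\<^sup>2) - c * z\<^sup>2"]
      by (simp del: csqrt.simps)
    also have "\<dots> \<le> cmod (T n (z\<^sup>2) - 1) + cmod (c * z\<^sup>2)"
      using norm_triangle_ineq4[of "T n (z\<^sup>2) - 1" "c * z\<^sup>2"] by (simp add: algebra_simps)
    also have "\<dots> \<le> cmod (z\<^sup>2) + cmod (c * z\<^sup>2)"
      using Suc.IH[OF sq[OF Suc.prems]] by simp
    also have "\<dots> = (1 + cmod c) * cmod z * cmod z"
      by (simp add: norm_mult norm_power power2_eq_square algebra_simps)
    also have "\<dots> \<le> 1 * cmod z"
    proof (rule mult_right_mono)
      have "(1 + cmod c) * cmod z \<le> (1 + cmod c) * \<rho>"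
        using Suc.prems by (intro mult_left_mono) auto
      also have "\<dots> = 1 / 4"
        unfolding \<rho>_def using norm_ge_zero[of c] by (simp add: field_simps add_nonneg_eq_0_iff)
      finally show "(1 + cmod c) * cmod z \<le> 1" by simp
    qed auto
    finally show ?case by simp
  qed (simp add: T0)
  have T_Re: "Re (T n z) \<ge> 3 / 4" if "cmod z < \<rho>" for n z
    using T_near1[OF that, of n] abs_Re_le_cmod[of "T n z - 1"] that \<rho> by simp
  \<comment> \<open>On the branch cut the principal root would be purely imaginary, against the
    bound on the real part of the next iterate.\<close>
  have arg_Re: "T n (z\<^sup>2) - c * z\<^sup>2 \<notin> \<real>\<^sub>\<le>\<^sub>0" if "cmod z < \<rho>" for n z
  proof
    assume "T n (z\<^sup>2) - c * z\<^sup>2 \<in> \<real>\<^sub>\<le>\<^sub>0"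
    then have "T (Suc n) z = \<i> * sqrt \<bar>Re (T n (z\<^sup>2) - c * z\<^sup>2)\<bar>"
      unfolding TS by (intro csqrt_of_real_nonpos) (auto simp: complex_nonpos_Reals_iff)
    then have "Re (T (Suc n) z) = 0" by simp
    with T_Re[OF that, of "Suc n"] show False by simp
  qed
  have T_hol: "T n holomorphic_on ball 0 \<rho>" for n
  proof (induction n)
    case (Suc n)
    have "(T n \<circ> (\<lambda>z. z\<^sup>2)) holomorphic_on ball 0 \<rho>"
      by (rule holomorphic_on_compose_gen[OF _ Suc]) (use sq in \<open>auto intro!: holomorphic_intros\<close>)
    then have "(\<lambda>z. csqrt (T n (z\<^sup>2) - c * z\<^sup>2)) holomorphic_on ball 0 \<rho>"
      using arg_Re by (intro holomorphic_on_csqrt' holomorphic_intros) (auto simp: o_def)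
    then show ?case by (simp add: TS[abs_def])
  qed (simp add: T0[abs_def])
  have contract: "cmod (T (Suc n) z - T n z) \<le> (2 / 3) ^ n" if "cmod z < \<rho>" for n z
    using that
  proof (induction n arbitrary: z)
    case 0
    then show ?case using T_near1[of z 1] \<rho> by (simp add: T0)
  next
    case (Suc n)
    \<comment> \<open>Two real parts of at least 3/4 add up to 3/2, whence the ratio 2/3.\<close>
    have "cmod (T (Suc (Suc n)) z - T (Suc n) z) \<le> cmod (T (Suc n) (z\<^sup>2) - c * z\<^sup>2 - (T n (z\<^sup>2) - c * z\<^sup>2)) / (3 / 2)"
      unfolding TS[of "Suc n"] TS[of n z]
      by (rule csqrt_diff_bound) (use T_Re[OF Suc.prems, of "Suc (Suc n)"] T_Re[OF Suc.prems, of "Suc n"] in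
          \<open>simp_all add: TS[of "Suc n"] TS[of n z] del: csqrt.simps\<close>)
    also have "\<dots> \<le> (2 / 3) ^ n / (3 / 2)"
      using Suc.IH[OF sq[OF Suc.prems]] by (intro divide_right_mono) auto
    finally show ?case by simp
  qed
  define S where "S z = (\<Sum>n. T (Suc n) z - T n z) + 1" for z
  have "uniform_limit (ball 0 \<rho>) (\<lambda>N z. \<Sum>n<N. T (Suc n) z - T n z) (\<lambda>z. \<Sum>n. T (Suc n) z - T n z) sequentially"
    by (rule Weierstrass_m_test[where M = "\<lambda>n. (2 / 3) ^ n"]) (use contract in auto)
  then have "uniform_limit (ball 0 \<rho>) (\<lambda>N z. (\<Sum>n<N. T (Suc n) z - T n z) + 1) S sequentially"
    unfolding S_def by (intro uniform_limit_add uniform_limit_const)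
  moreover have "(\<lambda>N z. (\<Sum>n<N. T (Suc n) z - T n z) + 1) = T"
    using sum_lessThan_telescope[of "\<lambda>n. T n _"] by (intro ext) (simp add: T0)
  ultimately have lim: "uniform_limit (ball 0 \<rho>) T S sequentially" by simp
  then have ptlim: "(\<lambda>n. T n z) \<longlonglongrightarrow> S z" if "cmod z < \<rho>" for z
    using that by (intro tendsto_uniform_limitI[OF lim]) auto
  have S_hol: "S holomorphic_on ball 0 \<rho>"
  proof (rule holomorphic_uniform_sequence[OF open_ball T_hol])
    fix z :: complex assume "z \<in> ball 0 \<rho>"
    then obtain d where "d > 0" "cball z d \<subseteq> ball 0 \<rho>"
      by (meson open_ball open_contains_cball)
    then show "\<exists>d>0. cball z d \<subseteq> ball 0 \<rho> \<and> uniform_limit (cball z d) T S sequentially"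
      using uniform_limit_on_subset[OF lim] by blast
  qed
  show ?thesis
  proof
    show "S (z\<^sup>2) = (S z)\<^sup>2 + c * z\<^sup>2" if "cmod z < \<rho>" for z
    proof -
      have "(\<lambda>n. (T (Suc n) z)\<^sup>2 + c * z\<^sup>2) \<longlonglongrightarrow> (S z)\<^sup>2 + c * z\<^sup>2"
        by (intro tendsto_intros LIMSEQ_Suc ptlim that)
      moreover have "(T (Suc n) z)\<^sup>2 + c * z\<^sup>2 = T n (z\<^sup>2)" for n
        unfolding TS power2_csqrt by simp
      ultimately have "(\<lambda>n. T n (z\<^sup>2)) \<longlonglongrightarrow> (S z)\<^sup>2 + c * z\<^sup>2"
        by simp
      with ptlim[OF sq[OF that]] show ?thesis
        by (rule LIMSEQ_unique)
    qed
    have "T n 0 = 1" for n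
      using T_near1[of 0 n] \<rho> by simp
    with ptlim[of 0] \<rho> show "S 0 = 1"
      by (simp add: LIMSEQ_const_iff)
  qed (use \<rho> S_hol in auto)
qed

lemma solution_exists:
  assumes "a \<noteq> 0"
  shows "\<exists>F. solves_functional_equation a F"
proof -
  define c where "c = a / 2 - a\<^sup>2 / 4"
  obtain S \<rho> where \<rho>: "0 < \<rho>" "\<rho> \<le> 1" and S_hol: "S holomorphic_on ball 0 \<rho>" and S0: "S 0 = 1"
    and S: "\<And>z. cmod z < \<rho> \<Longrightarrow> S (z\<^sup>2) = (S z)\<^sup>2 + c * z\<^sup>2"
    by (rule squaring_equation_solution_exists[of c]) blast
  \<comment> \<open>\<open>P\<close> plays the role of \<open>z / F z\<close>; the formula inverts
    the completion of the square S = - a (P - z / 2). Its value \<open>- 1 / a\<close> at 0 gives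
    \<open>z / P z\<close> the derivative \<open>- a\<close>.\<close>
  define P where "P z = z / 2 - S z / a" for z
  have P_hol: "P holomorphic_on ball 0 \<rho>"
    unfolding P_def using assms by (intro holomorphic_intros S_hol) auto
  have P0: "P 0 = - 1 / a" by (simp add: P_def S0)
  have P_nz: "\<forall>\<^sub>F z in nhds 0. P z \<noteq> 0"
  proof -
    have "isCont P 0"
      using P_hol \<rho> by (metis centre_in_ball continuous_on_eq_continuous_at holomorphic_on_imp_continuous_on open_ball)
    then have "(P \<longlongrightarrow> P 0) (nhds 0)"
      by (simp add: isCont_def tendsto_at_iff_tendsto_nhds)
    then show ?thesis
      by (rule tendsto_imp_eventually_ne) (use assms P0 in auto)
  qed
  have P_an: "P analytic_on {0}"
    using P_hol \<rho>(1) by (meson analytic_at centre_in_ball open_ball)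
  have nz0: "P 0 \<noteq> 0" using P0 assms by simp
  have "solves_functional_equation a (\<lambda>z. z / P z)"
    unfolding solves_functional_equation_def
  proof (intro conjI)
    show "(\<lambda>z. z / P z) analytic_on {0}"
      using nz0 by (intro analytic_intros P_an) auto
    have "\<forall>\<^sub>F z in nhds 0. z \<in> ball 0 \<rho>"
      using \<rho> by (intro eventually_nhds_in_open) auto
    with P_nz show "\<forall>\<^sub>F z in nhds 0. z\<^sup>2 / P (z\<^sup>2) = (z / P z)\<^sup>2 / (a * (z / P z - 1))"
    proof eventually_elim
      case (elim z)
      have "P (z\<^sup>2) = z\<^sup>2 / 2 - ((S z)\<^sup>2 + c * z\<^sup>2) / a"
        using elim(2) by (simp add: P_def S)
      also have "\<dots> = a * (P z * (z - P z))"
        unfolding P_def c_def using assms by (simp add: field_simps power2_eq_square)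
      finally have "P (z\<^sup>2) = a * (P z * (z - P z))" .
      moreover have "a * (z / P z - 1) = a * (z - P z) / P z"
        using elim(1) by (simp add: field_simps)
      ultimately show ?case
        using elim(1) by (simp add: power_divide power2_eq_square)
    qed
    have "P field_differentiable at 0"
      using P_an analytic_on_imp_differentiable_at by blast
    then have "(P has_field_derivative deriv P 0) (at 0)"
      by (simp add: DERIV_deriv_iff_field_differentiable)
    then have "((\<lambda>z. z / P z) has_field_derivative - a) (at 0)"
      by (auto intro!: derivative_eq_intros simp: nz0 P0 assms)
    then show "deriv (\<lambda>z. z / P z) 0 = - a"
      by (rule DERIV_imp_deriv)
  qed simp
  then show ?thesis by blast
qed

lemma solves_logistic:
  assumes "solves_functional_equation a F"
  shows "\<forall>\<^sub>F z in nhds 0. logistic a (1 / F z) = 1 / F (z\<^sup>2)"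
proof -
  have "\<forall>\<^sub>F z in nhds 0. F (z\<^sup>2) = (F z)\<^sup>2 / (a * (F z - 1))"
    using assms by (simp add: solves_functional_equation_def)
  then show ?thesis
  proof eventually_elim
    case (elim z)
    \<comment> \<open>Where \<open>F z = 0\<close>, in particular at 0, the convention
      \<open>1 / 0 = 0\<close> makes both sides 0.\<close>
    show ?case
    proof (cases "F z = 0")
      case True
      then show ?thesis by (simp add: elim logistic_def)
    next
      case False
      have "1 / F (z\<^sup>2) = a * (F z - 1) / (F z)\<^sup>2"
        by (simp add: elim)
      with False show ?thesis
        by (simp add: logistic_def field_simps power2_eq_square)
    qed
  qed
qed

lemma solves_deriv:
  assumes "solves_functional_equation a F"
  shows "(F has_field_derivative - a) (at 0)"
proof -
  have "F field_differentiable at 0" "deriv F 0 = - a"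
    using assms analytic_on_imp_differentiable_at by (auto simp: solves_functional_equation_def)
  then show ?thesis by (metis DERIV_deriv_iff_field_differentiable)
qed

lemma solves_pole:
  assumes "solves_functional_equation a F" "a \<noteq> 0"
  shows "((\<lambda>z. z / F z) \<longlongrightarrow> - 1 / a) (at 0)"
proof -
  have "((\<lambda>z. F z / z) \<longlongrightarrow> - a) (at 0)"
    using solves_deriv[OF assms(1)] assms(1)
    by (simp add: has_field_derivative_iff solves_functional_equation_def)
  then have "((\<lambda>z. inverse (F z / z)) \<longlongrightarrow> inverse (- a)) (at 0)"
    using assms(2) by (intro tendsto_inverse) auto
  then show ?thesis by (simp add: divide_inverse mult.commute)
qed

text \<open>Let e be the difference of \<open>z / F z\<close> and \<open>z / F' z\<close>. The
  functional equation gives e(z^2) = e(z) k(z) with k tending to 2 at 0. So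
  \<open>cmod (e z)\<close> cannot drop when z is squared, while e tends to 0 along the iterated
  squares.\<close>

lemma solution_unique:
  assumes F: "solves_functional_equation a F" and F': "solves_functional_equation a F'" and a: "a \<noteq> 0"
  shows "\<forall>\<^sub>F z in nhds 0. F z = F' z"
proof -
  define e where "e z = z / F z - z / F' z" for z
  define k where "k z = a * (z - z / F z - z / F' z)" for z
  have e_lim: "(e \<longlongrightarrow> - 1 / a - - 1 / a) (at 0)"
    unfolding e_def by (intro tendsto_diff solves_pole F F' a)
  have "(k \<longlongrightarrow> a * (0 - - 1 / a - - 1 / a)) (at 0)"
    unfolding k_def by (intro tendsto_intros solves_pole F F' a)
  then have "(k \<longlongrightarrow> 2) (at 0)"
    using a by (simp add: field_simps)
  then have "\<forall>\<^sub>F z in at 0. dist (k z) 2 < 1"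
    by (rule tendstoD) simp
  moreover have "\<forall>\<^sub>F z in at 0. logistic a (1 / F z) = 1 / F (z\<^sup>2) \<and> logistic a (1 / F' z) = 1 / F' (z\<^sup>2)"
    using solves_logistic[OF F] solves_logistic[OF F'] by (auto simp: eventually_at_filter elim: eventually_elim2)
  moreover have "\<forall>\<^sub>F z in at (0::complex). z \<in> ball 0 1"
    by (rule eventually_at_in_open') auto
  ultimately have "\<forall>\<^sub>F z in at 0. cmod z < 1 \<and> cmod (e z) \<le> cmod (e (z\<^sup>2))"
  proof eventually_elim
    case (elim z)
    have "e (z\<^sup>2) = z\<^sup>2 * (1 / F (z\<^sup>2)) - z\<^sup>2 * (1 / F' (z\<^sup>2))"
      by (simp add: e_def)
    also have "\<dots> = z\<^sup>2 * logistic a (1 / F z) - z\<^sup>2 * logistic a (1 / F' z)"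
      using elim(2) by simp
    also have "\<dots> = e z * k z"
      unfolding e_def k_def logistic_def divide_inverse by algebra
    finally have "cmod (e (z\<^sup>2)) = cmod (e z) * cmod (k z)"
      by (simp add: norm_mult)
    moreover have "1 \<le> cmod (k z)"
      using elim(1) norm_triangle_ineq2[of 2 "2 - k z"] by (simp add: dist_norm norm_minus_commute)
    then have "cmod (e z) * 1 \<le> cmod (e z) * cmod (k z)"
      by (intro mult_left_mono) auto
    ultimately show ?case using elim(3) by simp
  qed
  then obtain d where d: "d > 0"
    and d_le: "\<And>z. \<lbrakk>z \<noteq> 0; cmod z < d\<rbrakk> \<Longrightarrow> cmod z < 1 \<and> cmod (e z) \<le> cmod (e (z\<^sup>2))"
    by (auto simp: eventually_at)
  have "e z = 0" if z: "z \<noteq> 0" "cmod z < d" for z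
  proof -
    have z1: "cmod z < 1" using d_le[OF z] by simp
    have small: "cmod (z ^ 2 ^ n) < d" for n
    proof -
      have "cmod z ^ 2 ^ n \<le> cmod z ^ 1"
        using z1 by (intro power_decreasing) auto
      with z show ?thesis by (simp add: norm_power)
    qed
    have "cmod (e z) \<le> cmod (e (z ^ 2 ^ n))" for n
    proof (induction n)
      case (Suc n)
      have "cmod (e (z ^ 2 ^ n)) \<le> cmod (e ((z ^ 2 ^ n)\<^sup>2))"
        using d_le[of "z ^ 2 ^ n"] small[of n] z by simp
      also have "(z ^ 2 ^ n)\<^sup>2 = z ^ 2 ^ Suc n"
        by (simp add: mult.commute flip: power_mult)
      finally show ?case using Suc by simp
    qed simp
    moreover have "(\<lambda>n. cmod (e (z ^ 2 ^ n))) \<longlonglongrightarrow> 0"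
    proof -
      have "(\<lambda>n. z ^ 2 ^ n) \<longlonglongrightarrow> 0"
      proof -
        have "strict_mono (\<lambda>n::nat. 2 ^ n :: nat)"
          by (auto simp: strict_mono_def)
        then show ?thesis
          using LIMSEQ_subseq_LIMSEQ[OF LIMSEQ_power_zero[OF z1]] by (simp add: o_def)
      qed
      then have "filterlim (\<lambda>n. z ^ 2 ^ n) (at 0) sequentially"
        using z by (auto simp: filterlim_at)
      moreover have "(e \<longlongrightarrow> 0) (at 0)" using e_lim by simp
      ultimately show ?thesis
        using filterlim_compose tendsto_norm_zero by blast
    qed
    ultimately have "cmod (e z) \<le> 0"
      by (intro LIMSEQ_le_const) auto
    then show ?thesis by simp
  qed
  then have eq: "F z = F' z" if "cmod z < d" for z
    using that F F' by (cases "z = 0") (auto simp: e_def solves_functional_equation_def)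
  have "\<forall>\<^sub>F z in nhds 0. z \<in> ball (0::complex) d"
    using d by (intro eventually_nhds_in_open) auto
  then show ?thesis
    by eventually_elim (use eq in auto)
qed

lemma local_inverse_exists:
  assumes "solves_functional_equation a F" "a \<noteq> 0"
  shows "\<exists>Q. local_inverse_at_0 F Q"
proof -
  obtain S where S: "open S" "0 \<in> S" "F holomorphic_on S"
    using assms(1) by (auto simp: solves_functional_equation_def analytic_at)
  have "deriv F 0 \<noteq> 0" and F0: "F 0 = 0"
    using assms by (auto simp: solves_functional_equation_def)
  then obtain r where r: "r > 0" "ball 0 r \<subseteq> S" "open (F ` ball 0 r)" "inj_on F (ball 0 r)"
    using has_complex_derivative_locally_invertible[OF S(3,2,1)] by blast
  have hol: "F holomorphic_on ball 0 r"
    using S(3) r(2) by (rule holomorphic_on_subset)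
  have "\<exists>Q. Q holomorphic_on F ` ball 0 r \<and> (\<forall>z\<in>ball 0 r. Q (F z) = z)"
    by (rule holomorphic_has_inverse[OF hol open_ball r(4)]) auto
  then obtain Q where Q: "Q holomorphic_on F ` ball 0 r" "\<And>z. z \<in> ball 0 r \<Longrightarrow> Q (F z) = z"
    by auto
  have mem: "0 \<in> F ` ball 0 r"
    using F0 r(1) by (auto intro!: image_eqI[of _ _ 0])
  have "local_inverse_at_0 F Q"
    unfolding local_inverse_at_0_def
  proof (intro conjI)
    show "Q analytic_on {0}"
      using Q(1) r(3) mem by (meson analytic_at)
    show "Q 0 = 0" using Q(2)[of 0] F0 r(1) by simp
    have "\<forall>\<^sub>F z in nhds 0. z \<in> ball 0 r"
      using r(1) by (intro eventually_nhds_in_open) auto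
    then show "\<forall>\<^sub>F z in nhds 0. Q (F z) = z"
      by eventually_elim (rule Q(2))
    have "\<forall>\<^sub>F y in nhds 0. y \<in> F ` ball 0 r"
      using r(3) mem by (intro eventually_nhds_in_open)
    then show "\<forall>\<^sub>F y in nhds 0. F (Q y) = y"
      by eventually_elim (use Q(2) in auto)
  qed
  then show ?thesis by blast
qed

lemma boettcher_coordinates_exist:
  assumes a: "a \<noteq> 0" and F: "solves_functional_equation a F" and Q: "local_inverse_at_0 F Q"
  obtains R r m where "boettcher_coordinates a F Q R r m"
proof -
  have F0: "F 0 = 0" and F_an: "F analytic_on {0}"
    using F by (auto simp: solves_functional_equation_def)
  have Q0: "Q 0 = 0" and Q_an: "Q analytic_on {0}"
    and QF: "\<forall>\<^sub>F z in nhds 0. Q (F z) = z" and FQ: "\<forall>\<^sub>F y in nhds 0. F (Q y) = y"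
    using Q by (auto simp: local_inverse_at_0_def)
  have F_lim: "(F \<longlongrightarrow> 0) (nhds 0)"
    using analytic_at_imp_isCont[OF F_an] by (metis F0 isCont_def tendsto_at_iff_tendsto_nhds)
  have Q_lim: "(Q \<longlongrightarrow> 0) (nhds 0)"
    using analytic_at_imp_isCont[OF Q_an] by (metis Q0 isCont_def tendsto_at_iff_tendsto_nhds)
  have Q2_lim: "((\<lambda>y. (Q y)\<^sup>2) \<longlongrightarrow> 0) (nhds 0)"
    using tendsto_power[OF Q_lim, of 2] by simp
  \<comment> \<open>The equation of \<open>solves_logistic\<close> at \<open>Q y\<close>, followed
    by \<open>Q\<close> on the reciprocals: in the coordinate \<open>Q\<close> the map becomes
    squaring.\<close>
  have QG: "\<forall>\<^sub>F y in nhds 0. Q (1 / logistic a (1 / y)) = (Q y)\<^sup>2"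
    using FQ eventually_compose_filterlim[OF solves_logistic[OF F] Q_lim]
      eventually_compose_filterlim[OF QF Q2_lim]
    by eventually_elim simp
  have ball_of: "\<exists>d>0. \<forall>z. cmod z < d \<longrightarrow> P z" if "\<forall>\<^sub>F z in nhds 0. P z" for P :: "complex \<Rightarrow> bool"
    using that by (auto simp: eventually_nhds_metric)
  have small: "\<forall>\<^sub>F z in nhds 0. cmod (f z) < e" if "(f \<longlongrightarrow> 0) (nhds 0)" "e > 0" for f :: "complex \<Rightarrow> complex" and e
    using tendstoD[OF that] by simp
  obtain SQ where SQ: "open SQ" "0 \<in> SQ" "Q holomorphic_on SQ"
    using Q_an by (auto simp: analytic_at)
  obtain SF where SF: "open SF" "0 \<in> SF" "F holomorphic_on SF"
    using F_an by (auto simp: analytic_at)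
  have "\<forall>\<^sub>F y in nhds 0. y \<in> SQ \<and> cmod (Q y) < 1 \<and> F (Q y) = y \<and> Q (1 / logistic a (1 / y)) = (Q y)\<^sup>2"
    using eventually_nhds_in_open[OF SQ(1,2)] small[OF Q_lim, of 1] FQ QG by (auto simp: eventually_conj_iff)
  from ball_of[OF this] obtain d where d: "d > 0" and
    dQ: "\<And>y. cmod y < d \<Longrightarrow> y \<in> SQ \<and> cmod (Q y) < 1 \<and> F (Q y) = y \<and> Q (1 / logistic a (1 / y)) = (Q y)\<^sup>2"
    by blast
  \<comment> \<open>\<open>1 / d\<close> keeps \<open>1 / x\<close> where \<open>Q\<close> is
    controlled; \<open>1 + 2 / cmod a\<close> makes \<open>cmod a * cmod (1 - x)\<close> at least 2,
    so that p doubles the modulus.\<close>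
  define R where "R = max (1 / d) (1 + 2 / cmod a)"
  have "1 / d \<le> R" "R \<ge> 1 + 2 / cmod a"
    unfolding R_def by auto
  moreover from this have "R > 0"
    using d by (auto intro: less_le_trans[of 0 "1 / d"])
  ultimately have R: "R > 0" "1 / R \<le> d" "R \<ge> 1 + 2 / cmod a"
    using d by (simp_all add: field_simps)
  have "\<forall>\<^sub>F z in nhds 0. z \<in> SF \<and> cmod (F z) < 1 / R \<and> Q (F z) = z \<and> logistic a (1 / F z) = 1 / F (z\<^sup>2)"
    using eventually_nhds_in_open[OF SF(1,2)] small[OF F_lim, of "1 / R"] QF solves_logistic[OF F] R(1)
    by (auto simp: eventually_conj_iff)
  from ball_of[OF this] obtain r0 where r0: "r0 > 0" and
    rF: "\<And>z. cmod z < r0 \<Longrightarrow> z \<in> SF \<and> cmod (F z) < 1 / R \<and> Q (F z) = z \<and> logistic a (1 / F z) = 1 / F (z\<^sup>2)"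
    by blast
  define r where "r = min r0 1"
  \<comment> \<open>Larger than \<open>cmod (logistic a x)\<close> whenever
    \<open>cmod x \<le> R\<close>. A coordinate of modulus below \<open>m0\<close> belongs to a
    point beyond \<open>R2\<close>, which is therefore not an image of the disk of radius
    \<open>R\<close>.\<close>
  define R2 where "R2 = cmod a * R * (1 + R) + 1"
  have R2: "R2 > 0" using R by (auto simp: R2_def intro!: add_nonneg_pos)
  obtain m0 where m0: "m0 > 0" "\<And>z. cmod z < m0 \<Longrightarrow> cmod (F z) < 1 / R2"
    using ball_of[OF small[OF F_lim, of "1 / R2"]] R2 by auto
  define m where "m = min m0 r"
  have inv: "cmod (1 / x) < 1 / R" if "R < cmod x" for x
    using that R by (simp add: norm_divide frac_less2)
  have "boettcher_coordinates a F Q R r m"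
  proof
    show "F holomorphic_on ball 0 r" "Q holomorphic_on ball 0 (1 / R)"
      using SF(3) SQ(3) rF dQ R by (auto simp: r_def elim!: holomorphic_on_subset)
    show "F z \<noteq> 0" if "z \<noteq> 0" "cmod z < r" for z
      using rF[of z] that Q0 by (auto simp: r_def)
    show "Q (1 / logistic a x) = (Q (1 / x))\<^sup>2" if "R < cmod x" for x
      using dQ[of "1 / x"] inv[OF that] R(2) by simp
    show "2 * cmod x \<le> cmod (logistic a x)" if "R \<le> cmod x" for x
    proof -
      have "2 / cmod a \<le> cmod (1 - x)"
        using R(3) that norm_triangle_ineq2[of x 1] by (simp add: norm_minus_commute)
      then have "2 \<le> cmod a * cmod (1 - x)"
        using a by (simp add: field_simps)
      then have "2 * cmod x \<le> (cmod a * cmod (1 - x)) * cmod x"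
        by (intro mult_right_mono) auto
      then show ?thesis by (simp add: logistic_def norm_mult mult_ac)
    qed
    show "m \<le> cmod (Q (1 / logistic a x))" if "cmod x \<le> R" "R < cmod (logistic a x)" for x
    proof (rule ccontr)
      assume "\<not> m \<le> cmod (Q (1 / logistic a x))"
      then have "cmod (F (Q (1 / logistic a x))) < 1 / R2"
        using m0(2) by (simp add: m_def)
      moreover have "F (Q (1 / logistic a x)) = 1 / logistic a x"
        using dQ[of "1 / logistic a x"] inv[OF that(2)] R(2) by simp
      ultimately have "R2 < cmod (logistic a x)"
        using R2 less_trans[OF R(1) that(2)] by (simp add: norm_divide divide_less_eq less_divide_eq)
      moreover have "cmod (logistic a x) \<le> cmod a * R * (1 + R)"
        unfolding logistic_def norm_mult using that(1) norm_triangle_ineq4[of 1 x] R(1)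
        by (intro mult_mono) auto
      ultimately show False by (simp add: R2_def)
    qed
  qed (use a R r0 m0 F0 rF dQ solves_deriv[OF F] in \<open>auto simp: r_def m_def\<close>)
  then show ?thesis by (rule that)
qed

subsection \<open>The unit circle as a barrier\<close>

text \<open>Serves to leave the endpoint of a path, where the continued germ of \<open>F\<close> may
  vanish and its reciprocal may have a pole.\<close>

lemma unit_circle_neighbour:
  assumes "cmod \<zeta> = 1" "e > 0"
  obtains \<zeta>' where "cmod \<zeta>' = 1" "\<zeta>' \<noteq> \<zeta>" "dist \<zeta> \<zeta>' < e"
proof -
  have "((\<lambda>\<theta>. \<zeta> * cis \<theta>) \<longlongrightarrow> \<zeta> * cis 0) (at_right 0)"
    by (intro tendsto_intros)
  then have "\<forall>\<^sub>F \<theta> in at_right 0. dist (\<zeta> * cis \<theta>) \<zeta> < e"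
    using assms(2) by (auto dest: tendstoD)
  moreover have "\<forall>\<^sub>F \<theta>::real in at_right 0. \<theta> \<in> {0<..<1}"
    by (rule eventually_at_right_real) simp
  ultimately have "\<forall>\<^sub>F \<theta> in at_right 0. dist (\<zeta> * cis \<theta>) \<zeta> < e \<and> \<theta> \<in> {0<..<1}"
    by eventually_elim simp
  then obtain \<theta> where \<theta>: "dist (\<zeta> * cis \<theta>) \<zeta> < e" "0 < \<theta>" "\<theta> < 1"
    using eventually_happens'[OF trivial_limit_at_right_real] by fastforce
  have "sin \<theta> \<noteq> 0"
    using \<theta> sin_gt_zero[of \<theta>] pi_gt3 by auto
  then have "cis \<theta> \<noteq> 1"
    by (auto simp: complex_eq_iff)
  moreover have "\<zeta> \<noteq> 0" using assms(1) by auto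
  ultimately show ?thesis
    using that[of "\<zeta> * cis \<theta>"] \<theta> assms(1) by (auto simp: norm_mult dist_commute)
qed

section \<open>Transport of properties along paths\<close>

lemma eventually_at_Icc_ball:
  assumes "\<forall>\<^sub>F s in at t within {0..1::real}. P s"
  shows "\<exists>d>0. \<forall>s\<in>{0..1}. s \<noteq> t \<and> dist s t < d \<longrightarrow> P s"
  using assms by (auto simp: eventually_at)

lemma path_eventually_in:
  assumes "path \<gamma>" "t \<in> {0..1}" "open U" "\<gamma> t \<in> U"
  shows "\<forall>\<^sub>F s in at t within {0..1}. \<gamma> s \<in> U"
  using assms unfolding path_def continuous_on_def by (blast dest: topological_tendstoD)

lemma eventually_nhds_continuous:
  fixes c :: "'a::t2_space \<Rightarrow> 'b::topological_space"
  assumes "continuous_on UNIV c" "\<forall>\<^sub>F p in nhds (c z). P p"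
  shows "\<forall>\<^sub>F w in nhds z. P (c w)"
proof -
  have "isCont c z"
    using assms(1) by (simp add: continuous_on_eq_continuous_at)
  then have "(c \<longlongrightarrow> c z) (nhds z)"
    by (simp add: isCont_def tendsto_at_iff_tendsto_nhds)
  with assms(2) show ?thesis by (rule eventually_compose_filterlim)
qed

text \<open>Connectedness of \<open>{0..<1}\<close>, in the form in which a property of germs is
  carried along a path: near each parameter it passes from any point to any other.\<close>

lemma real_interval_induct:
  fixes P :: "real \<Rightarrow> bool"
  assumes P0: "P 0"
    and local: "\<And>t. \<lbrakk>0 \<le> t; t < 1\<rbrakk> \<Longrightarrow>
       \<exists>d>0. \<forall>x y. x \<in> {0..<1} \<and> y \<in> {0..<1} \<and> dist x t < d \<and> dist y t < d \<and> P x \<longrightarrow> P y"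
    and t: "0 \<le> t" "t < 1"
  shows "P t"
proof (rule connected_induction_simple[where S = "{0..<1}" and P = P and a = 0 and b = t])
  fix s :: real assume "s \<in> {0..<1}"
  then obtain d where "d > 0"
    and d: "\<forall>x y. x \<in> {0..<1} \<and> y \<in> {0..<1} \<and> dist x s < d \<and> dist y s < d \<and> P x \<longrightarrow> P y"
    using local[of s] by auto
  show "\<exists>T. openin (top_of_set {0..<1}) T \<and> s \<in> T \<and> (\<forall>x\<in>T. \<forall>y\<in>T. P x \<longrightarrow> P y)"
  proof (intro exI conjI ballI impI)
    show "openin (top_of_set {0..<1}) ({0..<1} \<inter> ball s d)"
      by (intro openin_open_Int open_ball)
  qed (use \<open>s \<in> _\<close> \<open>d > 0\<close> d in \<open>auto simp: dist_commute\<close>)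
qed (use P0 t in auto)

section \<open>The orbit equation of a continued germ of F\<close>

context boettcher_coordinates
begin

lemma F_p:
  assumes "z \<noteq> 0" "cmod z < r"
  shows "p n (1 / F z) = 1 / F (z ^ 2 ^ n)"
proof (induction n)
  case (Suc n)
  have "cmod z ^ 2 ^ n \<le> cmod z ^ 1"
    using assms r_le by (intro power_decreasing) auto
  then show ?case
    using F_rec[of "z ^ 2 ^ n"] assms Suc by (simp add: norm_power mult.commute flip: power_mult)
qed simp

text \<open>The iterated functional equation for a continuation f of \<open>F\<close>, with
  \<open>F\<close> itself evaluated only inside its original disk. As a product equal to 1 it forces
  \<open>F (z ^ 2 ^ n)\<close>, and hence z, to be nonzero.\<close>

definition satisfies_orbit_equation :: "(complex \<Rightarrow> complex) \<Rightarrow> nat \<Rightarrow> complex \<Rightarrow> bool" where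
  "satisfies_orbit_equation f n z \<longleftrightarrow> f z \<noteq> 0 \<and> cmod z ^ 2 ^ n < r \<and> p n (1 / f z) * F (z ^ 2 ^ n) = 1"

lemma satisfies_orbit_equation_mono:
  assumes n: "satisfies_orbit_equation f n z" and "n \<le> k"
  shows "satisfies_orbit_equation f k z"
proof -
  define w where "w = z ^ 2 ^ n"
  have pow: "x ^ 2 ^ k = (x ^ 2 ^ n) ^ 2 ^ (k - n)" for x :: "'a::monoid_mult"
    using assms(2) by (simp flip: power_mult power_add)
  have w: "F w \<noteq> 0" "cmod w < r"
    using n by (auto simp: satisfies_orbit_equation_def w_def norm_power)
  then have "w \<noteq> 0" using F_0 by auto
  have "cmod w ^ 2 ^ (k - n) \<le> cmod w ^ 1"
    using w r_le by (intro power_decreasing) auto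
  then have small: "cmod (w ^ 2 ^ (k - n)) < r"
    using w by (simp add: norm_power)
  have "p n (1 / f z) = 1 / F w"
    using n w by (simp add: satisfies_orbit_equation_def w_def field_simps)
  moreover have "p k (1 / f z) = p (k - n) (p n (1 / f z))"
    using assms(2) by (simp flip: p_add)
  ultimately have "p k (1 / f z) = 1 / F (w ^ 2 ^ (k - n))"
    using F_p[OF \<open>w \<noteq> 0\<close> w(2)] by simp
  then show ?thesis
    using n F_nz[OF _ small] \<open>w \<noteq> 0\<close> small
    unfolding satisfies_orbit_equation_def pow by (simp add: w_def norm_power)
qed

text \<open>The numerator \<open>A\<close> is holomorphic also across the zeros of f, where
  \<open>1 / f\<close> has poles. This lets an equation for the iterates of \<open>1 / f\<close>
  pass such points.\<close>

lemma cleared_denominator: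
  assumes "f holomorphic_on S"
  obtains A where "A holomorphic_on S" "\<And>z. f z \<noteq> 0 \<Longrightarrow> p n (1 / f z) = A z / f z ^ 2 ^ n"
proof -
  have "\<exists>A. A holomorphic_on S \<and> (\<forall>z. f z \<noteq> 0 \<longrightarrow> p n (1 / f z) = A z / f z ^ 2 ^ n)"
  proof (induction n)
    case 0
    show ?case by (intro exI[of _ "\<lambda>_. 1"]) auto
  next
    case (Suc n)
    then obtain A where A: "A holomorphic_on S" "\<And>z. f z \<noteq> 0 \<Longrightarrow> p n (1 / f z) = A z / f z ^ 2 ^ n"
      by blast
    show ?case
    proof (intro exI conjI allI impI)
      show "(\<lambda>z. a * A z * (f z ^ 2 ^ n - A z)) holomorphic_on S"
        by (intro holomorphic_intros A assms)
      show "p (Suc n) (1 / f z) = a * A z * (f z ^ 2 ^ n - A z) / f z ^ 2 ^ Suc n" if "f z \<noteq> 0" for z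
      proof -
        have "f z ^ 2 ^ Suc n = f z ^ 2 ^ n * f z ^ 2 ^ n"
          by (simp add: mult_2 power_add)
        then show ?thesis
          using that A(2)[OF that] by (simp add: logistic_def field_simps)
      qed
    qed
  qed
  then show ?thesis using that by blast
qed

text \<open>With denominators cleared, the orbit equation is an identity of holomorphic functions
  and spreads by the identity theorem. The exponent k depends on \<open>z0\<close>, since
  \<open>cmod z ^ 2 ^ k < r\<close> needs larger k nearer the circle; the punctured neighbourhood
  allows for a zero of f at \<open>z0\<close>.\<close>

lemma orbit_equation_propagates:
  assumes f: "f holomorphic_on D" and D: "open D" "convex D" "D \<subseteq> ball 0 1"
    and T: "open T" "T \<inter> D \<noteq> {}" "\<And>z. z \<in> T \<Longrightarrow> satisfies_orbit_equation f n z"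
    and z0: "z0 \<in> D"
  shows "\<exists>k. (f z0 \<noteq> 0 \<longrightarrow> satisfies_orbit_equation f k z0) \<and>
    (\<forall>\<^sub>F z in at z0. satisfies_orbit_equation f k z)"
proof -
  obtain z1 where z1: "z1 \<in> T" "z1 \<in> D" using T(2) by blast
  have "max (cmod z0) (cmod z1) < 1"
    using z0 z1 D(3) by auto
  \<comment> \<open>A disk of radius below 1 containing both points admits one exponent k for all of
    \<open>D'\<close>.\<close>
  then obtain \<rho> where \<rho>: "max (cmod z0) (cmod z1) < \<rho>" "\<rho> < 1"
    using dense by blast
  then have "0 \<le> \<rho>" by (auto intro: order_trans[of 0 "cmod z0"])
  define D' where "D' = D \<inter> ball 0 \<rho>"
  have D': "open D'" "connected D'" "z0 \<in> D'" "z1 \<in> D'" and f': "f holomorphic_on D'"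
    unfolding D'_def using D \<rho> z0 z1 f
    by (auto intro: convex_connected convex_Int holomorphic_on_subset)
  obtain N where N: "\<rho> ^ N < r"
    using real_arch_pow_inv[OF r_pos \<rho>(2)] by blast
  define k where "k = max n N"
  have small: "cmod z ^ 2 ^ k < r" if "z \<in> D'" for z
  proof -
    have "N \<le> 2 ^ k"
      using less_exp[of k] unfolding k_def by linarith
    have "cmod z ^ 2 ^ k \<le> \<rho> ^ 2 ^ k"
      using that by (intro power_mono) (auto simp: D'_def)
    also have "\<dots> \<le> \<rho> ^ N"
      using \<open>0 \<le> \<rho>\<close> \<rho>(2) \<open>N \<le> 2 ^ k\<close> by (intro power_decreasing) auto
    finally show ?thesis using N by simp
  qed
  obtain A where A: "A holomorphic_on D'" "\<And>z. f z \<noteq> 0 \<Longrightarrow> p k (1 / f z) = A z / f z ^ 2 ^ k"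
    using cleared_denominator[OF f'] by blast
  have "(F \<circ> (\<lambda>z. z ^ 2 ^ k)) holomorphic_on D'"
    by (rule holomorphic_on_compose_gen[OF _ F_holo]) (use small in \<open>auto intro!: holomorphic_intros simp: norm_power\<close>)
  then have FA: "(\<lambda>z. A z * F (z ^ 2 ^ k)) holomorphic_on D'"
    by (intro holomorphic_on_mult A) (simp add: o_def)
  have eq: "A z * F (z ^ 2 ^ k) = f z ^ 2 ^ k" if "z \<in> D'" for z
  proof (rule holomorphic_eq_on_connected[OF FA _ D'(1,2) T(1)])
    show "(\<lambda>z. f z ^ 2 ^ k) holomorphic_on D'"
      by (intro holomorphic_intros f')
    show "A z * F (z ^ 2 ^ k) = f z ^ 2 ^ k" if "z \<in> D'" "z \<in> T" for z
    proof -
      have "satisfies_orbit_equation f k z"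
        using satisfies_orbit_equation_mono[OF T(3)[OF that(2)]] by (simp add: k_def)
      then have "f z \<noteq> 0" "A z / f z ^ 2 ^ k * F (z ^ 2 ^ k) = 1"
        using A(2)[of z] by (auto simp: satisfies_orbit_equation_def)
      then show ?thesis
        by (simp add: divide_eq_eq mult.commute)
    qed
  qed (use that D' z1 in auto)
  have sat: "satisfies_orbit_equation f k z" if "z \<in> D'" "f z \<noteq> 0" for z
    using eq[OF that(1)] A(2)[OF that(2)] small[OF that(1)] that(2)
    by (auto simp: satisfies_orbit_equation_def)
  have "f z1 \<noteq> 0"
    using T(3)[OF z1(1)] by (simp add: satisfies_orbit_equation_def)
  then have "\<forall>\<^sub>F z in at z0. f z \<noteq> 0 \<and> z \<in> D'"
    using non_zero_neighbour_alt[OF f' D'] by blast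
  then have "\<forall>\<^sub>F z in at z0. satisfies_orbit_equation f k z"
    by eventually_elim (use sat in auto)
  with sat[OF D'(3)] show ?thesis by blast
qed

lemma orbit_equation_open_set:
  assumes "\<forall>\<^sub>F w in at z. satisfies_orbit_equation f n w" "open D" "z \<in> D"
  obtains T where "open T" "T \<inter> D \<noteq> {}" "\<And>w. w \<in> T \<Longrightarrow> satisfies_orbit_equation f n w"
proof -
  obtain e where e: "e > 0" "\<And>w. \<lbrakk>w \<noteq> z; dist w z < e\<rbrakk> \<Longrightarrow> satisfies_orbit_equation f n w"
    using assms(1) by (auto simp: eventually_at)
  have "\<forall>\<^sub>F w in at z. w \<in> D \<inter> ball z e - {z}"
    using assms(2,3) e(1) by (intro eventually_at_in_open) auto
  then obtain w where "w \<in> D \<inter> ball z e - {z}"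
    using eventually_happens'[OF trivial_limit_at] by blast
  then have "(ball z e - {z}) \<inter> D \<noteq> {}" by blast
  then show ?thesis
    using e(2) by (intro that[of "ball z e - {z}"]) (auto simp: dist_commute open_delete)
qed

lemma barrier_F:
  assumes "a \<notin> {-2, 2, 4}"
  shows "barrier_of_singularities F (Fin ` ball 0 1)"
  unfolding barrier_of_singularities_def frontier_unit_disk
proof (intro allI impI notI)
  fix \<gamma> assume \<gamma>: "path \<gamma> \<and> pathstart \<gamma> = Fin 0 \<and> \<gamma> ` {0..<1} \<subseteq> Fin ` ball 0 1 \<and> pathfinish \<gamma> \<in> Fin ` sphere 0 1"
  assume "\<exists>\<phi>. analytic_continuation_along F \<gamma> \<phi>"
  then obtain \<phi> where \<phi>: "analytic_continuation_along F \<gamma> \<phi>" by blast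
  then have \<phi>_an: "\<And>t. t \<in> {0..1} \<Longrightarrow> analytic_at_sphere (\<phi> t) (\<gamma> t)"
    and \<phi>_0: "\<forall>\<^sub>F z in nhds 0. \<phi> 0 (Fin z) = F z"
    and \<phi>_coh: "\<And>t. t \<in> {0..1} \<Longrightarrow> \<forall>\<^sub>F s in at t within {0..1}. \<forall>\<^sub>F q in nhds (\<gamma> s). \<phi> s q = \<phi> t q"
    unfolding analytic_continuation_along_def by blast+
  define f where "f t z = \<phi> t (Fin z)" for t z
  obtain c where c: "\<And>t. t \<in> {0..1} \<Longrightarrow> \<gamma> t = Fin (c t)"
  proof -
    have "\<exists>z. \<gamma> t = Fin z" if "t \<in> {0..1}" for t
    proof (cases "t = 1")
      case False
      then have "\<gamma> t \<in> \<gamma> ` {0..<1}" using that by auto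
      then show ?thesis using \<gamma> by blast
    qed (use \<gamma> in \<open>auto simp: pathfinish_def\<close>)
    then show thesis using that by metis
  qed
  have c_ball: "c t \<in> ball 0 1" if "0 \<le> t" "t < 1" for t
    using \<gamma> c[of t] that by (auto dest!: subsetD[of "\<gamma> ` _"] intro: rev_image_eqI)
  have c_end: "cmod (c 1) = 1" and c_0: "c 0 = 0"
    using \<gamma> c[of 1] c[of 0] by (auto simp: pathfinish_def pathstart_def)

  have chart: "\<exists>e>0. \<exists>d>0. f t holomorphic_on ball (c t) e \<and> (\<forall>s\<in>{0..1}. dist s t < d \<longrightarrow>
       c s \<in> ball (c t) e \<and> (\<forall>\<^sub>F z in nhds (c s). f s z = f t z))" if t: "t \<in> {0..1}" for t
  proof -
    have "f t analytic_on {c t}"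
      using \<phi>_an[OF t] unfolding c[OF t] by (simp add: f_def[abs_def])
    then obtain e where e: "e > 0" "f t holomorphic_on ball (c t) e"
      by (auto simp: analytic_on_def)
    have "\<forall>\<^sub>F s in at t within {0..1}. \<gamma> s \<in> Fin ` ball (c t) e"
      using \<gamma> t e(1) c[OF t] by (intro path_eventually_in open_Fin_image) auto
    with \<phi>_coh[OF t]
    have "\<forall>\<^sub>F s in at t within {0..1}. \<gamma> s \<in> Fin ` ball (c t) e \<and> (\<forall>\<^sub>F q in nhds (\<gamma> s). \<phi> s q = \<phi> t q)"
      by eventually_elim simp
    from eventually_at_Icc_ball[OF this] obtain d where d: "d > 0" "\<And>s. \<lbrakk>s \<in> {0..1}; s \<noteq> t; dist s t < d\<rbrakk> \<Longrightarrow>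
        \<gamma> s \<in> Fin ` ball (c t) e \<and> (\<forall>\<^sub>F q in nhds (\<gamma> s). \<phi> s q = \<phi> t q)"
      by blast
    have "c s \<in> ball (c t) e \<and> (\<forall>\<^sub>F z in nhds (c s). f s z = f t z)" if s: "s \<in> {0..1}" "dist s t < d" for s
    proof (cases "s = t")
      case False
      have "c s \<in> ball (c t) e"
        using d(2)[OF s(1) False s(2)] c[OF s(1)] by auto
      moreover have "\<forall>\<^sub>F z in nhds (c s). f s z = f t z"
        using d(2)[OF s(1) False s(2)] unfolding c[OF s(1)] f_def by (auto intro: eventually_nhds_continuous continuous_on_Fin)
      ultimately show ?thesis by blast
    qed (use e in auto)
    then show ?thesis using e d(1) by blast
  qed

  \<comment> \<open>Punctured neighbourhoods, because the orbit equation fails at zeros of the germ,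
    beginning with \<open>c 0 = 0\<close>.\<close>
  define P where "P t \<longleftrightarrow> (\<exists>n. \<forall>\<^sub>F z in at (c t). satisfies_orbit_equation (f t) n z)" for t
  have P_transfer: "\<exists>n. \<forall>\<^sub>F z in at (c s). satisfies_orbit_equation g n z"
    if h: "\<exists>n. \<forall>\<^sub>F z in at (c s). satisfies_orbit_equation h n z" and eq: "\<forall>\<^sub>F z in nhds (c s). h z = g z" for s g h
  proof -
    obtain n where "\<forall>\<^sub>F z in at (c s). satisfies_orbit_equation h n z" using h by blast
    moreover have "\<forall>\<^sub>F z in at (c s). h z = g z"
      using eq by (simp add: eventually_at_filter eventually_mono)
    ultimately have "\<forall>\<^sub>F z in at (c s). satisfies_orbit_equation g n z"
      by eventually_elim (simp add: satisfies_orbit_equation_def)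
    then show ?thesis by blast
  qed
  have P0: "P 0"
    unfolding P_def
  proof (intro exI)
    have "\<forall>\<^sub>F z in at 0. z \<in> ball 0 r - {0::complex}"
      using r_pos by (intro eventually_at_in_open) auto
    moreover have "\<forall>\<^sub>F z in at 0. f 0 z = F z"
      using \<phi>_0 by (simp add: f_def eventually_at_filter eventually_mono)
    ultimately show "\<forall>\<^sub>F z in at (c 0). satisfies_orbit_equation (f 0) 0 z"
      unfolding c_0 by eventually_elim (use F_nz in \<open>auto simp: satisfies_orbit_equation_def\<close>)
  qed
  have P: "P t" if "0 \<le> t" "t < 1" for t
  proof (rule real_interval_induct[where P = P, OF P0 _ that])
    fix t :: real assume t: "0 \<le> t" "t < 1"
    obtain e d where e: "e > 0" "d > 0" "f t holomorphic_on ball (c t) e"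
      and d: "\<And>s. \<lbrakk>s \<in> {0..1}; dist s t < d\<rbrakk> \<Longrightarrow> c s \<in> ball (c t) e \<and> (\<forall>\<^sub>F z in nhds (c s). f s z = f t z)"
      using chart[of t] t by auto
    define D where "D = ball (c t) e \<inter> ball 0 1"
    have D: "open D" "convex D" "D \<subseteq> ball 0 1" and hol: "f t holomorphic_on D"
      using e(3) by (auto simp: D_def intro: convex_Int holomorphic_on_subset)
    have "P y" if xy: "x \<in> {0..<1}" "y \<in> {0..<1}" "dist x t < d" "dist y t < d" "P x" for x y
    proof -
      have xD: "c x \<in> D" and yD: "c y \<in> D"
        using d[of x] d[of y] c_ball[of x] c_ball[of y] that by (auto simp: D_def)
      obtain n where "\<forall>\<^sub>F z in at (c x). satisfies_orbit_equation (f t) n z"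
        using P_transfer[where s = x and h = "f x" and g = "f t"] d[of x] xy by (auto simp: P_def)
      from orbit_equation_open_set[OF this D(1) xD]
      obtain T where "open T" "T \<inter> D \<noteq> {}" "\<And>w. w \<in> T \<Longrightarrow> satisfies_orbit_equation (f t) n w"
        by blast
      from orbit_equation_propagates[OF hol D this yD]
      have "\<exists>n. \<forall>\<^sub>F z in at (c y). satisfies_orbit_equation (f t) n z"
        by blast
      moreover have "\<forall>\<^sub>F z in nhds (c y). f y z = f t z"
        using d[of y] xy by simp
      then have "\<forall>\<^sub>F z in nhds (c y). f t z = f y z"
        by (rule eventually_mono) (rule sym)
      ultimately show "P y"
        unfolding P_def by (rule P_transfer)
    qed
    with e(2) show "\<exists>d>0. \<forall>x y. x \<in> {0..<1} \<and> y \<in> {0..<1} \<and> dist x t < d \<and> dist y t < d \<and> P x \<longrightarrow> P y"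
      by blast
  qed

  define \<zeta> where "\<zeta> = c 1"
  obtain e d where e: "e > 0" "d > 0" "f 1 holomorphic_on ball \<zeta> e"
    and d: "\<And>s. \<lbrakk>s \<in> {0..1}; dist s 1 < d\<rbrakk> \<Longrightarrow> c s \<in> ball \<zeta> e \<and> (\<forall>\<^sub>F z in nhds (c s). f s z = f 1 z)"
    using chart[of 1] by (auto simp: \<zeta>_def)
  define D where "D = ball \<zeta> e \<inter> ball 0 1"
  have D: "open D" "convex D" "D \<subseteq> ball 0 1" and hol: "f 1 holomorphic_on D"
    using e(3) by (auto simp: D_def intro: convex_Int holomorphic_on_subset)
  define s where "s = max 0 (1 - d / 2)"
  have s: "0 \<le> s" "s < 1" "dist s 1 < d"
    using e(2) by (auto simp: s_def dist_real_def max_def)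
  then have sD: "c s \<in> D"
    using d[of s] c_ball[of s] by (auto simp: D_def)
  obtain n where "\<forall>\<^sub>F z in at (c s). satisfies_orbit_equation (f 1) n z"
    using P_transfer[where s = s and h = "f s" and g = "f 1"] d[of s] P[of s] s by (auto simp: P_def)
  from orbit_equation_open_set[OF this D(1) sD]
  obtain T where T: "open T" "T \<inter> D \<noteq> {}" "\<And>w. w \<in> T \<Longrightarrow> satisfies_orbit_equation (f 1) n w"
    by blast
  have orbit: "\<exists>k. satisfies_orbit_equation (f 1) k z" if "z \<in> D" "f 1 z \<noteq> 0" for z
    using orbit_equation_propagates[OF hol D T that(1)] that(2) by blast
  obtain z1 where "z1 \<in> T" "z1 \<in> D"
    using T(2) by blast
  then have z1: "z1 \<in> ball \<zeta> e" "f 1 z1 \<noteq> 0"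
    using T(3)[of z1] by (auto simp: D_def satisfies_orbit_equation_def)
  have "\<forall>\<^sub>F z in at \<zeta>. f 1 z \<noteq> 0 \<and> z \<in> ball \<zeta> e"
    by (rule non_zero_neighbour_alt[OF e(3) open_ball connected_ball _ z1]) (use e in auto)
  then obtain e' where e': "e' > 0" "\<And>z. \<lbrakk>z \<noteq> \<zeta>; dist z \<zeta> < e'\<rbrakk> \<Longrightarrow> f 1 z \<noteq> 0 \<and> z \<in> ball \<zeta> e"
    by (auto simp: eventually_at)
  \<comment> \<open>\<open>\<zeta>\<close> may be an isolated zero of \<open>f 1\<close>, hence a
    pole of the reciprocal; a nearby point of the circle avoids it.\<close>
  obtain \<zeta>' where \<zeta>': "cmod \<zeta>' = 1" "\<zeta>' \<noteq> \<zeta>" "dist \<zeta> \<zeta>' < e'"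
    using unit_circle_neighbour[of \<zeta> e'] c_end e'(1) by (auto simp: \<zeta>_def)
  define V where "V = ball \<zeta> e' - {\<zeta>}"
  have V: "open V" "\<zeta>' \<in> V" and V_nz: "\<And>z. z \<in> V \<Longrightarrow> f 1 z \<noteq> 0 \<and> z \<in> ball \<zeta> e"
    using \<zeta>' e'(2) by (auto simp: V_def open_delete dist_commute)
  have "open ((\<lambda>v. \<zeta>' * exp v) -` V)"
    by (intro open_vimage V continuous_intros)
  then obtain \<rho> where \<rho>: "\<rho> > 0" "ball 0 \<rho> \<subseteq> (\<lambda>v. \<zeta>' * exp v) -` V"
    using V(2) by (force simp: open_contains_ball)
  have "(\<lambda>v. f 1 (\<zeta>' * exp v)) holomorphic_on ball 0 \<rho>"
  proof -
    have "(f 1 \<circ> (\<lambda>v. \<zeta>' * exp v)) holomorphic_on ball 0 \<rho>"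
      by (rule holomorphic_on_compose_gen[OF _ e(3)]) (use \<rho>(2) V_nz in \<open>auto intro!: holomorphic_intros\<close>)
    then show ?thesis by (simp add: o_def)
  qed
  then have "(\<lambda>v. 1 / f 1 (\<zeta>' * exp v)) holomorphic_on ball 0 \<rho>"
    by (intro holomorphic_intros) (use \<rho>(2) V_nz in auto)
  then have "a \<in> {-2, 2, 4}"
  proof (rule parameter_of_boundary_germ[OF _ \<rho>(1)])
    fix v assume v: "cmod v < \<rho>" "Re v < 0"
    define z where "z = \<zeta>' * exp v"
    have nz: "cmod z = exp (Re v)" by (simp add: z_def norm_mult \<zeta>')
    have "z \<in> V" using v \<rho>(2) by (auto simp: z_def)
    moreover have "cmod z < 1" using v nz by simp
    ultimately obtain k where k: "satisfies_orbit_equation (f 1) k z"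
      using orbit[of z] V_nz[of z] by (auto simp: D_def)
    \<comment> \<open>As \<open>Q (F w) = w\<close>, the Boettcher coordinate of the k-th iterate is
      \<open>z ^ 2 ^ k\<close>, of modulus \<open>exp (Re v) ^ 2 ^ k\<close>.\<close>
    define w where "w = z ^ 2 ^ k"
    have w: "cmod w < r" "p k (1 / f 1 z) * F w = 1"
      using k by (auto simp: satisfies_orbit_equation_def w_def norm_power)
    then have "F w \<noteq> 0" by auto
    with w(2) have y: "p k (1 / f 1 z) = 1 / F w"
      by (simp add: eq_divide_eq)
    have "R * cmod (F w) < 1"
      using F_small[OF w(1)] R_pos by (simp add: field_simps)
    then have "R < cmod (p k (1 / f 1 z))"
      using \<open>F w \<noteq> 0\<close> by (simp add: y norm_divide less_divide_eq)
    moreover have "cmod (Q (1 / p k (1 / f 1 z))) = exp (Re v) ^ 2 ^ k"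
      unfolding y using Q_F[OF w(1)] by (simp add: w_def norm_power nz)
    ultimately show "\<exists>n. R < cmod (p n (1 / f 1 (\<zeta>' * exp v))) \<and>
        cmod (Q (1 / p n (1 / f 1 (\<zeta>' * exp v)))) = exp (Re v) ^ 2 ^ n"
      unfolding z_def by blast
  qed
  with assms show False by blast
qed

end

subsection \<open>The Fatou component of the superattracting fixed point\<close>

lemma mem_closure_iff_open:
  "x \<in> closure A \<longleftrightarrow> (\<forall>S. open S \<longrightarrow> x \<in> S \<longrightarrow> (\<exists>y. y \<in> A \<and> y \<in> S))"
proof
  assume "x \<in> closure A"
  then show "\<forall>S. open S \<longrightarrow> x \<in> S \<longrightarrow> (\<exists>y. y \<in> A \<and> y \<in> S)"
    using open_Int_closure_eq_empty by blast
next
  assume *: "\<forall>S. open S \<longrightarrow> x \<in> S \<longrightarrow> (\<exists>y. y \<in> A \<and> y \<in> S)"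
  show "x \<in> closure A"
  proof (rule ccontr)
    assume "x \<notin> closure A"
    then obtain y where "y \<in> A" "y \<in> - closure A"
      using *[rule_format, of "- closure A"] by auto
    then show False using closure_subset[of A] by auto
  qed
qed

lemma closure_meets_open: "\<lbrakk>x \<in> closure A; open S; x \<in> S\<rbrakk> \<Longrightarrow> \<exists>y. y \<in> A \<and> y \<in> S"
  by (simp add: mem_closure_iff_open)

primrec sphere_inversion :: "riemann_sphere \<Rightarrow> riemann_sphere" where
  "sphere_inversion (Fin z) = (if z = 0 then Infty else Fin (1 / z))"
| "sphere_inversion Infty = Fin 0"

text \<open>Parametrizes the sphere without \<open>Fin 0\<close> by x = 1 / y, with
  \<open>Infty\<close> at x = 0. In this coordinate \<open>G_map a\<close> becomes the polynomial
  \<open>logistic a\<close>, and the pole of \<open>G_map a\<close> at y = 1 needs no separate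
  treatment.\<close>

definition inv_chart :: "complex \<Rightarrow> riemann_sphere" where
  "inv_chart x = sphere_inversion (Fin x)"

lemma inv_chart_nz: "x \<noteq> 0 \<Longrightarrow> inv_chart x = Fin (1 / x)"
  by (simp add: inv_chart_def)

lemma sphere_inversion_involution [simp]: "sphere_inversion (sphere_inversion q) = q"
  by (cases q) auto

text \<open>On the unit sphere the map from z to 1 / z is the half turn about the real axis; hence
  it is a chordal isometry.\<close>

lemma stereo_sphere_inversion:
  "stereo (sphere_inversion q) = (cnj (fst (stereo q)), - snd (stereo q))"
proof (cases q)
  case (Fin z)
  show ?thesis
  proof (cases "z = 0")
    case False
    define A where "A = (cmod z)\<^sup>2"
    have A: "A > 0" "1 + A > 0" "A + 1 > 0"
      using False by (auto simp: A_def add_pos_pos)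
    have "of_real A = z * cnj z"
      by (simp add: A_def complex_mult_cnj cmod_power2)
    then have z: "1 / z = cnj z / of_real A"
      using False by (simp add: field_simps)
    have "(cmod (1 / z))\<^sup>2 = 1 / A"
      by (simp add: A_def norm_divide power_divide)
    then have "stereo (Fin (1 / z)) = (2 * (1 / z) / of_real (1 + 1 / A), (1 / A - 1) / (1 / A + 1))"
      by simp
    also have "(1 / A - 1) / (1 / A + 1) = ((1 - A) / A) / ((1 + A) / A)"
      using A(1) by (simp add: diff_divide_distrib add_divide_distrib)
    also have "\<dots> = (1 - A) / (A + 1)"
      using A(1) by (simp add: add.commute)
    also have "\<dots> = - ((A - 1) / (A + 1))"
      by (simp only: minus_divide_left minus_diff_eq)
    also have "2 * (1 / z) / of_real (1 + 1 / A) = 2 * cnj z / (of_real A * of_real (1 + 1 / A))"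
      unfolding z by simp
    also have "of_real A * of_real (1 + 1 / A) = (of_real (1 + A) :: complex)"
      using A by (simp add: field_simps flip: of_real_mult)
    finally show ?thesis
      using Fin False by (simp add: A_def)
  qed (use Fin in simp)
qed simp

lemma dist_sphere_inversion: "dist (sphere_inversion p) (sphere_inversion q) = dist p q"
proof -
  have "dist (cnj x) (cnj y) = dist x y" for x y
    by (simp add: dist_norm flip: complex_cnj_diff)
  then show ?thesis
    unfolding dist_riemann_sphere_def stereo_sphere_inversion
    by (cases "stereo p"; cases "stereo q") (simp add: dist_Pair_Pair dist_minus)
qed

lemma continuous_on_sphere_inversion: "continuous_on S sphere_inversion"
  unfolding continuous_on_iff by (auto simp: dist_sphere_inversion)

lemma continuous_on_inv_chart: "continuous_on S inv_chart"
proof -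
  have "continuous_on S (sphere_inversion \<circ> Fin)"
    by (intro continuous_on_compose continuous_on_Fin continuous_on_sphere_inversion)
  then show ?thesis by (simp add: inv_chart_def o_def)
qed

lemma open_inv_chart_image:
  assumes "open U"
  shows "open (inv_chart ` U)"
proof -
  have "inv_chart ` U = sphere_inversion -` (Fin ` U)"
  proof (intro set_eqI iffI)
    show "q \<in> inv_chart ` U" if q: "q \<in> sphere_inversion -` (Fin ` U)" for q
    proof -
      obtain u where "u \<in> U" "sphere_inversion q = Fin u" using q by auto
      then have "q = inv_chart u"
        unfolding inv_chart_def by (metis sphere_inversion_involution)
      with \<open>u \<in> U\<close> show ?thesis by blast
    qed
  qed (auto simp: inv_chart_def simp del: sphere_inversion.simps)
  moreover have "open (sphere_inversion -` (Fin ` U))"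
    by (intro open_vimage open_Fin_image assms continuous_on_sphere_inversion)
  ultimately show ?thesis by simp
qed

lemma inj_inv_chart: "inj inv_chart"
  by (rule injI) (metis inv_chart_def riemann_sphere.inject sphere_inversion_involution)

lemma inv_chart_eq_iff [simp]: "inv_chart x = inv_chart y \<longleftrightarrow> x = y"
  using inj_inv_chart by (auto dest: injD)

lemma inv_chart_neq_0 [simp]: "inv_chart x \<noteq> Fin 0" "Fin 0 \<noteq> inv_chart x"
  by (auto simp: inv_chart_def)

lemma inv_chart_cases:
  obtains "q = Fin 0" | x where "q = inv_chart x"
proof (cases q)
  case (Fin y)
  then show ?thesis
    using that(1) that(2)[of "1 / y"] by (cases "y = 0") (auto simp: inv_chart_def)
next
  case Infty
  then show ?thesis using that(2)[of 0] by (simp add: inv_chart_def)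
qed

lemma dist_inv_chart_0: "dist (inv_chart x) (Fin 0) = 2 / sqrt (1 + (cmod x)\<^sup>2)"
  using dist_sphere_inversion[of "Fin x" Infty] unfolding inv_chart_def[symmetric]
  by (simp add: dist_Fin_Infty)

lemma G_map_inv_chart:
  assumes "a \<noteq> 0"
  shows "G_map a (inv_chart x) = inv_chart (logistic a x)"
  using assms by (auto simp: inv_chart_def logistic_def field_simps power2_eq_square)

lemma G_map_pow_inv_chart:
  assumes "a \<noteq> 0"
  shows "(G_map a ^^ n) (inv_chart x) = inv_chart ((logistic a ^^ n) x)"
  by (induction n) (simp_all add: G_map_inv_chart[OF assms])

lemma G_map_pow_0: "(G_map a ^^ n) (Fin 0) = Fin 0"
  by (induction n) auto

lemma analytic_inv_chart:
  assumes "analytic_at_sphere f (inv_chart x)"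
  shows "(\<lambda>w. f (inv_chart w)) analytic_on {x}"
proof (cases "x = 0")
  case True
  then show ?thesis
    using assms by (simp add: inv_chart_def if_distrib cong: if_cong)
next
  case False
  then have "(\<lambda>w. f (Fin w)) analytic_on {1 / x}"
    using assms by (simp add: inv_chart_nz)
  moreover have "(\<lambda>w. 1 / w) analytic_on {x}"
    using False by (intro analytic_intros) auto
  ultimately have comp: "((\<lambda>w. f (Fin w)) \<circ> (\<lambda>w. 1 / w)) analytic_on {x}"
    by (intro analytic_on_compose) auto
  have "\<forall>\<^sub>F w in nhds x. w \<in> - {0}"
    using False by (intro eventually_nhds_in_open) auto
  then have ev: "\<forall>\<^sub>F w in nhds x. ((\<lambda>w. f (Fin w)) \<circ> (\<lambda>w. 1 / w)) w = f (inv_chart w)"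
    by eventually_elim (simp add: inv_chart_nz)
  show ?thesis
    by (rule iffD1[OF analytic_at_cong[OF ev refl] comp])
qed

section \<open>The basin of the origin inside the Fatou set\<close>

context boettcher_coordinates
begin

abbreviation G :: "nat \<Rightarrow> riemann_sphere \<Rightarrow> riemann_sphere" where "G n \<equiv> G_map a ^^ n"

definition escaping :: "complex set" where
  "escaping = {x. \<exists>n. R < cmod (p n x)}"

text \<open>\<open>Fin 0\<close> corresponds to x at infinity and is added by hand. The basin is cut
  into levels because the iterates tend to \<open>Fin 0\<close> uniformly on each of them.\<close>

definition basin_level :: "nat \<Rightarrow> riemann_sphere set" where
  "basin_level n = insert (Fin 0) (inv_chart ` {x. R < cmod (p n x)})"

definition basin :: "riemann_sphere set" where
  "basin = insert (Fin 0) (inv_chart ` escaping)"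

lemma isCont_p: "isCont (p n) x"
proof -
  have "(\<lambda>z. p n z) holomorphic_on UNIV"
    by (intro holomorphic_logistic_funpow holomorphic_intros)
  then show ?thesis
    by (metis UNIV_I continuous_on_eq_continuous_at holomorphic_on_imp_continuous_on open_UNIV)
qed

lemma continuous_on_p: "continuous_on S (p n)"
  using isCont_p by (simp add: continuous_at_imp_continuous_on)

lemma open_escape_level: "open {x. R < cmod (p n x)}"
  by (intro open_Collect_less continuous_intros continuous_on_p)

lemma basin_level_subset: "basin_level n \<subseteq> basin"
  by (auto simp: basin_level_def basin_def escaping_def)

lemma basin_eq: "basin = (\<Union>n. basin_level n)"
  by (auto simp: basin_level_def basin_def escaping_def)

lemma ball_subset_basin_level: "Fin ` ball 0 (1 / R) \<subseteq> basin_level n"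
proof clarify
  fix y :: complex assume y: "y \<in> ball 0 (1 / R)"
  show "Fin y \<in> basin_level n"
  proof (cases "y = 0")
    case False
    then have "R < cmod (1 / y)" "Fin y = inv_chart (1 / y)"
      using y R_pos by (auto simp: norm_divide field_simps inv_chart_nz)
    then show ?thesis
      using escape_p[of "1 / y" n] by (auto simp: basin_level_def)
  qed (simp add: basin_level_def)
qed

lemma open_basin_level: "open (basin_level n)"
proof -
  have "basin_level n = Fin ` ball 0 (1 / R) \<union> inv_chart ` {x. R < cmod (p n x)}"
    using ball_subset_basin_level[of n] R_pos by (auto simp: basin_level_def)
  then show ?thesis
    by (simp add: open_Un open_Fin_image open_inv_chart_image open_escape_level)
qed

lemma open_basin: "open basin"
  unfolding basin_eq by (intro open_UN ballI open_basin_level)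

lemma escape_rate: "R < cmod x \<Longrightarrow> 2 ^ k * R < cmod (p k x)"
proof (induction k)
  case (Suc k)
  then show ?case
    using escape[of "p k x"] escape_p[of x k] by simp
qed simp

lemma dist_G_basin_level:
  assumes "q \<in> basin_level n"
  shows "dist (G (k + n) q) (Fin 0) \<le> 2 / (2 ^ k * R)"
  using assms unfolding basin_level_def
proof
  assume "q = Fin 0"
  then show ?thesis using R_pos by (simp add: G_map_pow_0)
next
  assume "q \<in> inv_chart ` {x. R < cmod (p n x)}"
  then obtain x where x: "q = inv_chart x" "R < cmod (p n x)" by blast
  define y where "y = p (k + n) x"
  have y: "2 ^ k * R < cmod y"
    using escape_rate[OF x(2), of k] by (simp add: y_def p_add)
  have pos: "0 < 2 ^ k * R" using R_pos by simp
  have "cmod y \<le> sqrt (1 + (cmod y)\<^sup>2)"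
    by (rule real_le_rsqrt) simp
  then have "2 / sqrt (1 + (cmod y)\<^sup>2) \<le> 2 / (2 ^ k * R)"
    using y pos by (intro divide_left_mono) (auto intro!: mult_pos_pos add_pos_nonneg)
  then show ?thesis
    by (simp add: x(1) G_map_pow_inv_chart[OF a_nz] dist_inv_chart_0 flip: y_def)
qed

lemma uniform_limit_G: "uniform_limit (basin_level n) G (\<lambda>_. Fin 0) sequentially"
proof (rule uniform_limitI)
  fix e :: real assume "e > 0"
  have "(\<lambda>k. 2 / (2 ^ k * R)) \<longlonglongrightarrow> 0"
    using R_pos by real_asymp
  then have "\<forall>\<^sub>F k in sequentially. 2 / (2 ^ k * R) < e"
    using \<open>e > 0\<close> by (rule order_tendstoD)
  then obtain k0 where k0: "\<And>k. k \<ge> k0 \<Longrightarrow> 2 / (2 ^ k * R) < e"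
    by (auto simp: eventually_sequentially)
  have "dist (G j q) (Fin 0) < e" if "j \<ge> k0 + n" "q \<in> basin_level n" for j q
  proof -
    have "k0 \<le> j - n" using that(1) by linarith
    from k0[OF this] show ?thesis
      using dist_G_basin_level[OF that(2), of "j - n"] that(1) by simp
  qed
  then show "\<forall>\<^sub>F j in sequentially. \<forall>q\<in>basin_level n. dist (G j q) (Fin 0) < e"
    by (auto simp: eventually_sequentially)
qed

text \<open>A sequence of iterates either repeats one iterate infinitely often, or its exponents
  tend to infinity and it converges uniformly to \<open>Fin 0\<close>.\<close>

lemma normal_basin_level: "normal_family_on (basin_level n) (range G)"
  unfolding normal_family_on_def
proof (intro allI impI)
  fix h :: "nat \<Rightarrow> riemann_sphere \<Rightarrow> riemann_sphere" assume "range h \<subseteq> range G"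
  then have "\<forall>k. \<exists>j. h k = G j" by blast
  then obtain m where m: "\<And>k. h k = G (m k)" by metis
  show "\<exists>g r. strict_mono r \<and> (\<forall>K. compact K \<and> K \<subseteq> basin_level n \<longrightarrow> uniform_limit K (h \<circ> r) g sequentially)"
  proof (cases "\<exists>j. infinite {k. m k = j}")
    case True
    then obtain j where j: "infinite {k. m k = j}" by blast
    define r where "r = enumerate {k. m k = j}"
    have "m (r i) = j" for i
      using enumerate_in_set[OF j] by (simp add: r_def)
    then have "h \<circ> r = (\<lambda>_. G j)"
      by (auto simp: m)
    then have "uniform_limit K (h \<circ> r) (G j) sequentially" for K
      by (simp add: uniform_limit_const)
    then show ?thesis
      using strict_mono_enumerate[OF j] unfolding r_def by blast
  next
    case False
    have "filterlim m at_top sequentially"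
      unfolding filterlim_at_top
    proof
      fix Z
      have "{k. \<not> Z \<le> m k} = (\<Union>j<Z. {k. m k = j})" by auto
      then have "finite {k. \<not> Z \<le> m k}" using False by simp
      then show "\<forall>\<^sub>F k in sequentially. Z \<le> m k"
        unfolding cofinite_eq_sequentially[symmetric] eventually_cofinite .
    qed
    then have "uniform_limit (basin_level n) (\<lambda>k. G (m k)) (\<lambda>_. Fin 0) sequentially"
      by (rule filterlim_compose[OF uniform_limit_G])
    moreover have "h \<circ> id = (\<lambda>k. G (m k))"
      by (auto simp: m)
    ultimately have "\<forall>K. compact K \<and> K \<subseteq> basin_level n \<longrightarrow> uniform_limit K (h \<circ> id) (\<lambda>_. Fin 0) sequentially"
      using uniform_limit_on_subset by metis
    then show ?thesis
      using strict_mono_id by blast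
  qed
qed

lemma basin_subset_fatou: "basin \<subseteq> fatou_set (G_map a)"
  unfolding basin_eq fatou_set_def using open_basin_level normal_basin_level by blast

text \<open>At a non-escaping limit of escaping points normality fails: limits of iterates are
  \<open>Fin 0\<close> at the escaping points, while a non-escaping orbit keeps a fixed chordal
  distance from \<open>Fin 0\<close>.\<close>

lemma fatou_point_interior:
  assumes "inv_chart x \<in> fatou_set (G_map a)" "x \<notin> escaping"
  shows "x \<notin> closure escaping"
proof
  assume x: "x \<in> closure escaping"
  obtain U where U: "open U" "inv_chart x \<in> U" "normal_family_on U (range G)"
    using assms(1) by (auto simp: fatou_set_def)
  have "open (inv_chart -` U)"
    by (intro open_vimage U continuous_on_inv_chart)
  then have "\<exists>\<epsilon>>0. cball x \<epsilon> \<subseteq> inv_chart -` U"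
    unfolding open_contains_cball by (rule bspec) (simp add: U(2))
  then obtain \<epsilon> where \<epsilon>: "\<epsilon> > 0" "cball x \<epsilon> \<subseteq> inv_chart -` U"
    by auto
  define K where "K = inv_chart ` cball x \<epsilon>"
  have K: "compact K" "K \<subseteq> U"
    using \<epsilon>(2) by (auto simp: K_def intro: compact_continuous_image continuous_on_inv_chart)
  note U(3)[unfolded normal_family_on_def, THEN spec, THEN mp, of G]
  then obtain g r where "strict_mono r"
    and unif: "\<forall>K. compact K \<and> K \<subseteq> U \<longrightarrow> uniform_limit K (G \<circ> r) g sequentially"
    by auto
  with K have r: "strict_mono r" "uniform_limit K (G \<circ> r) g sequentially"
    by simp_all
  have g: "g (inv_chart y) = Fin 0" if y: "y \<in> escaping" "y \<in> cball x \<epsilon>" for y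
  proof -
    obtain n where "inv_chart y \<in> basin_level n"
      using y(1) by (auto simp: escaping_def basin_level_def)
    then have "(\<lambda>k. G k (inv_chart y)) \<longlonglongrightarrow> Fin 0"
      by (rule tendsto_uniform_limitI[OF uniform_limit_G])
    then have "(\<lambda>k. G (r k) (inv_chart y)) \<longlonglongrightarrow> Fin 0"
      using LIMSEQ_subseq_LIMSEQ[OF _ r(1)] by (simp add: o_def)
    moreover have "(\<lambda>k. (G \<circ> r) k (inv_chart y)) \<longlonglongrightarrow> g (inv_chart y)"
      using y(2) by (intro tendsto_uniform_limitI[OF r(2)]) (auto simp: K_def)
    ultimately show ?thesis
      by (auto intro: LIMSEQ_unique)
  qed
  \<comment> \<open>Half the chordal distance from \<open>Fin 0\<close> to the points with
    \<open>cmod x = R\<close>.\<close>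
  define e where "e = 1 / sqrt (1 + R\<^sup>2)"
  have "e > 0" by (auto simp: e_def intro: add_pos_nonneg)
  have "\<forall>\<^sub>F k in sequentially. \<forall>q\<in>K. dist ((G \<circ> r) k q) (g q) < e"
    using r(2) \<open>e > 0\<close> by (rule uniform_limitD)
  then obtain k where k: "\<And>q. q \<in> K \<Longrightarrow> dist (G (r k) q) (g q) < e"
    by (auto simp: eventually_sequentially)
  have near: "dist (inv_chart (p (r k) y)) (Fin 0) < e" if "y \<in> escaping" "y \<in> cball x \<epsilon>" for y
    using k[of "inv_chart y"] g[OF that] that(2) by (auto simp: K_def G_map_pow_inv_chart[OF a_nz])
  \<comment> \<open>For the fixed index k the iterate is continuous, so a distance above
    \<open>e\<close> at x persists at nearby escaping points, contrary to
    \<open>near\<close>.\<close>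
  define V where "V = {y. e < dist (inv_chart (p (r k) y)) (Fin 0)} \<inter> ball x \<epsilon>"
  have V: "open V"
    unfolding V_def
    by (intro open_Int open_ball open_Collect_less continuous_intros continuous_on_p
        continuous_on_compose2[OF continuous_on_inv_chart[of UNIV]]) auto
  have xV: "x \<in> V"
  proof -
    have "cmod (p (r k) x) \<le> R"
      using assms(2) by (auto simp: escaping_def not_less)
    then have "(cmod (p (r k) x))\<^sup>2 \<le> R\<^sup>2"
      by (intro power_mono) auto
    then have "sqrt (1 + (cmod (p (r k) x))\<^sup>2) \<le> sqrt (1 + R\<^sup>2)"
      by simp
    then have "2 / sqrt (1 + R\<^sup>2) \<le> 2 / sqrt (1 + (cmod (p (r k) x))\<^sup>2)"
      by (intro divide_left_mono) (auto intro!: mult_pos_pos add_pos_nonneg)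
    moreover have "e < 2 / sqrt (1 + R\<^sup>2)"
      unfolding e_def by (intro divide_strict_right_mono) (auto intro: add_pos_nonneg)
    ultimately show ?thesis
      using \<epsilon>(1) by (simp add: V_def dist_inv_chart_0)
  qed
  obtain y where "y \<in> escaping" "y \<in> V"
    using closure_meets_open[OF x V xV] by blast
  with near[of y] show False by (auto simp: V_def)
qed

text \<open>By \<open>fatou_point_interior\<close> the Fatou set is covered by two disjoint open
  sets, the basin and the interior of the non-escaping set. The connected set \<open>K_p a\<close>
  contains \<open>Fin 0\<close> and so stays in the first.\<close>

lemma K_p_subset_basin: "K_p a \<subseteq> basin"
proof -
  define W where "W = inv_chart ` interior (- escaping)"
  have W: "open W" unfolding W_def by (intro open_inv_chart_image open_interior)
  have fatou: "K_p a \<subseteq> fatou_set (G_map a)"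
    unfolding K_p_def by (rule connected_component_subset)
  have cover: "K_p a \<subseteq> basin \<union> W"
  proof
    fix q assume q: "q \<in> K_p a"
    show "q \<in> basin \<union> W"
    proof (cases q rule: inv_chart_cases)
      case (2 x)
      then have "x \<in> escaping \<or> x \<in> interior (- escaping)"
        using fatou_point_interior[of x] q fatou by (auto simp: interior_closure)
      then show ?thesis using 2 by (auto simp: basin_def W_def)
    qed (simp add: basin_def)
  qed
  have disj: "basin \<inter> W = {}"
    using interior_subset[of "- escaping"] by (auto simp: basin_def W_def)
  have "Fin 0 \<in> K_p a"
    using basin_subset_fatou by (auto simp: K_p_def basin_def)
  moreover have "connected (K_p a)"
    unfolding K_p_def by (rule connected_connected_component)
  ultimately have "W \<inter> K_p a = {}"
    using connectedD[OF _ open_basin W, of "K_p a"] cover disj by (auto simp: basin_def)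
  with cover show ?thesis by blast
qed

text \<open>A point of the basin has a connected neighbourhood inside the basin, hence inside the
  Fatou set. Once it meets the component \<open>K_p a\<close>, it is contained in it.\<close>

lemma frontier_K_p_disjoint_basin: "frontier (K_p a) \<inter> basin = {}"
proof (rule ccontr)
  assume "frontier (K_p a) \<inter> basin \<noteq> {}"
  then obtain q where q: "q \<in> frontier (K_p a)" "q \<in> basin" by blast
  obtain N where N: "open N" "connected N" "q \<in> N" "N \<subseteq> basin"
  proof (cases q rule: inv_chart_cases)
    case 1
    show thesis
    proof
      show "open (Fin ` ball 0 (1 / R))" by (intro open_Fin_image open_ball)
      show "connected (Fin ` ball 0 (1 / R))"
        by (intro connected_continuous_image continuous_on_Fin connected_ball)
      show "q \<in> Fin ` ball 0 (1 / R)" using 1 R_pos by auto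
      show "Fin ` ball 0 (1 / R) \<subseteq> basin"
        using ball_subset_basin_level basin_level_subset by blast
    qed
  next
    case (2 x)
    then obtain n where "R < cmod (p n x)"
      using q(2) by (auto simp: basin_def escaping_def)
    then obtain e where e: "e > 0" "ball x e \<subseteq> {x. R < cmod (p n x)}"
      using open_escape_level[of n] unfolding open_contains_ball by auto
    show thesis
    proof
      show "open (inv_chart ` ball x e)" by (intro open_inv_chart_image open_ball)
      show "connected (inv_chart ` ball x e)"
        by (intro connected_continuous_image continuous_on_inv_chart connected_ball)
      show "q \<in> inv_chart ` ball x e" using 2 e(1) by auto
      show "inv_chart ` ball x e \<subseteq> basin"
        using e(2) by (auto simp: basin_def escaping_def)
    qed
  qed
  have "q \<in> closure (K_p a)" using q(1) by (simp add: frontier_def)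
  from closure_meets_open[OF this N(1,3)] obtain q' where q': "q' \<in> K_p a" "q' \<in> N"
    by blast
  have "N \<subseteq> connected_component_set (fatou_set (G_map a)) q'"
    using N basin_subset_fatou q'(2) by (intro connected_component_maximal) auto
  also have "\<dots> = K_p a"
    using q'(1) unfolding K_p_def by (rule connected_component_eq)
  finally have "N \<subseteq> K_p a" .
  with N(1,3) have "q \<in> interior (K_p a)"
    by (rule interiorI)
  with q(1) show False by (simp add: frontier_def)
qed

end

subsection \<open>The boundary of the Fatou component as a barrier\<close>

lemma deriv_nonzero_point:
  assumes "f holomorphic_on ball z e" "z1 \<in> ball z e" "z2 \<in> ball z e" "f z1 \<noteq> f z2"
  obtains \<beta> where "\<beta> \<in> ball z e" "deriv f \<beta> \<noteq> 0"
proof -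
  have "\<exists>\<beta>\<in>ball z e. deriv f \<beta> \<noteq> 0"
  proof (rule ccontr)
    assume "\<not> ?thesis"
    then have "(f has_field_derivative 0) (at w within ball z e)" if "w \<in> ball z e" for w
      using holomorphic_derivI[OF assms(1) open_ball that] that by auto
    then obtain c where "\<And>w. w \<in> ball z e \<Longrightarrow> f w = c"
      using has_field_derivative_zero_constant[of "ball z e" f] by auto
    with assms show False by auto
  qed
  then show thesis using that by blast
qed

text \<open>Provides a boundary point other than x, where the derivative might vanish. If the
  component filled the punctured ball, the modulus of \<open>q\<close> would have its maximum 1 at
  the centre x; otherwise connectedness of the punctured ball yields a frontier point, at which the
  modulus can be neither above nor below 1.\<close>

lemma unit_modulus_boundary_point:
  assumes q: "q holomorphic_on ball x e" and qx: "cmod (q x) = 1"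
    and y: "y \<in> ball x e" "cmod (q y) < 1"
  defines "U \<equiv> connected_component_set {z \<in> ball x e. cmod (q z) < 1} y"
  obtains w where "w \<in> ball x e" "w \<noteq> x" "w \<in> closure U" "cmod (q w) = 1"
proof -
  define V where "V = {z \<in> ball x e. cmod (q z) < 1}"
  have "0 < e" using y(1) by (auto intro: le_less_trans[OF zero_le_dist])
  have cont: "continuous_on (ball x e) q"
    using q by (rule holomorphic_on_imp_continuous_on)
  have "V = ball x e \<inter> (\<lambda>z. cmod (q z)) -` {..<1}" by (auto simp: V_def)
  moreover have "open (ball x e \<inter> (\<lambda>z. cmod (q z)) -` {..<1})"
    by (intro continuous_open_preimage continuous_on_norm cont) auto
  ultimately have V: "open V" by simp
  have U: "open U" "U \<subseteq> V" "y \<in> U"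
    using y unfolding U_def V_def[symmetric]
    by (auto simp: V open_connected_component connected_component_subset) (simp add: V_def)
  have conn: "connected (ball x e - {x})"
    by (rule connected_punctured_ball) simp
  have "x \<notin> U" using U(2) qx by (auto simp: V_def)
  then have ne: "(ball x e - {x}) \<inter> U \<noteq> {}"
    using U(3) y(1) by blast
  have "(ball x e - {x}) - U \<noteq> {}"
  proof
    assume "(ball x e - {x}) - U = {}"
    then have sub: "ball x e - {x} \<subseteq> U" by blast
    have "cmod (q z) \<le> cmod (q x)" if "z \<in> ball x e" for z
    proof (cases "z = x")
      case False
      then have "z \<in> V" using sub U(2) that by blast
      then show ?thesis by (simp add: V_def qx)
    qed simp
    then have "q constant_on ball x e"
      using \<open>0 < e\<close> by (intro maximum_modulus_principle[OF q, of "ball x e" x]) auto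
    then have "q y = q x"
      using y(1) \<open>0 < e\<close> by (auto simp: constant_on_def)
    with y(2) qx show False by simp
  qed
  from connected_Int_frontier[OF conn ne this]
  obtain w where "w \<in> ball x e - {x}" "w \<in> frontier U" by blast
  then have w: "w \<in> ball x e" "w \<noteq> x" "w \<in> closure U" "w \<notin> U"
    using U(1) by (simp_all add: frontier_def interior_open)
  have nb: "\<exists>z. z \<in> U \<and> z \<in> S" if "open S" "w \<in> S" for S
    using w(3) that by (rule closure_meets_open)
  have "cmod (q w) \<le> 1"
  proof (rule ccontr)
    assume "\<not> ?thesis"
    moreover have "open (ball x e \<inter> (\<lambda>z. cmod (q z)) -` {1<..})"
      by (intro continuous_open_preimage continuous_on_norm cont) auto
    ultimately obtain z where "z \<in> U" "cmod (q z) > 1"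
      using nb[of "ball x e \<inter> (\<lambda>z. cmod (q z)) -` {1<..}"] w(1) by auto
    then show False using U(2) by (auto simp: V_def)
  qed
  moreover have "\<not> cmod (q w) < 1"
  proof
    assume "cmod (q w) < 1"
    then have "w \<in> V" using w(1) by (simp add: V_def)
    with V obtain d where d: "d > 0" "ball w d \<subseteq> V"
      by (rule openE)
    obtain z where z: "z \<in> U" "z \<in> ball w d"
      using nb[of "ball w d"] d(1) by auto
    have "ball w d \<subseteq> connected_component_set V z"
      using z(2) d(2) by (intro connected_component_maximal connected_ball)
    also have "\<dots> = U"
      using z(1) unfolding U_def V_def[symmetric] by (rule connected_component_eq)
    finally show False using w(4) d(1) centre_in_ball[of w d] by blast
  qed
  ultimately show thesis using that w by auto
qed

section \<open>Continuation of Q inside the basin\<close>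

context boettcher_coordinates
begin

lemma Q_0: "Q 0 = 0"
  using Q_F[of 0] F_0 r_pos by simp

text \<open>The Boettcher coordinate of the n-th iterate; the case \<open>Infty\<close> of the
  inverted point is \<open>Fin 0\<close>, where \<open>Q\<close> is 0.\<close>

definition level :: "nat \<Rightarrow> riemann_sphere \<Rightarrow> complex" where
  "level n q = (case sphere_inversion q of Infty \<Rightarrow> 0 | Fin x \<Rightarrow> Q (1 / p n x))"

lemma level_inv_chart: "level n (inv_chart x) = Q (1 / p n x)"
  by (simp add: level_def inv_chart_def)

lemma level_0: "level n (Fin 0) = 0"
  by (simp add: level_def)

lemma level_small: "cmod y < 1 / R \<Longrightarrow> level 0 (Fin y) = Q y"
  by (cases "y = 0") (simp_all add: level_def Q_0)

lemma basin_level_mono: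
  assumes "q \<in> basin_level n" "n \<le> k"
  shows "q \<in> basin_level k" "level k q = level n q ^ 2 ^ (k - n)"
  using assms(1) escape_mono[OF _ assms(2)] Q_p_mono[OF _ assms(2)]
  by (auto simp: basin_level_def level_inv_chart level_0)

text \<open>A continuation of \<open>Q\<close> is a branch of a \<open>2 ^ n\<close>-th root of
  \<open>level n\<close>. The power states this without choosing the branch.\<close>

definition continues_Q :: "(riemann_sphere \<Rightarrow> complex) \<Rightarrow> nat \<Rightarrow> riemann_sphere \<Rightarrow> bool" where
  "continues_Q f n q \<longleftrightarrow> q \<in> basin_level n \<and> f q ^ 2 ^ n = level n q"

lemma continues_Q_mono:
  assumes "continues_Q f n q" "n \<le> k"
  shows "continues_Q f k q"
proof -
  have "f q ^ 2 ^ k = (f q ^ 2 ^ n) ^ 2 ^ (k - n)"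
    using assms(2) by (simp flip: power_mult power_add)
  then show ?thesis
    using assms basin_level_mono[of q n k] by (simp add: continues_Q_def)
qed

text \<open>Unifies the coordinate y at \<open>Fin 0\<close> with x = 1 / y elsewhere, so that the
  identity theorem can be applied in a plane ball around any point of the basin.\<close>

lemma basin_chart:
  assumes "q \<in> basin" "analytic_at_sphere f q"
  obtains c z e n where "continuous_on UNIV c" "\<forall>U. open U \<longrightarrow> open (c ` U)" "c z = q" "0 < e"
    "c ` ball z e \<subseteq> basin_level n" "(\<lambda>w. level n (c w)) holomorphic_on ball z e"
    "(\<lambda>w. f (c w)) holomorphic_on ball z e"
proof (cases q rule: inv_chart_cases)
  case 1
  then have "(\<lambda>w. f (Fin w)) analytic_on {0}" using assms(2) by simp
  then obtain e where e: "e > 0" "(\<lambda>w. f (Fin w)) holomorphic_on ball 0 e"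
    by (auto simp: analytic_on_def)
  show thesis
  proof (rule that[of Fin 0 "min e (1 / R)" 0])
    show "(\<lambda>w. level 0 (Fin w)) holomorphic_on ball 0 (min e (1 / R))"
    proof (rule holomorphic_transform)
      show "Q holomorphic_on ball 0 (min e (1 / R))"
        using Q_holo by (rule holomorphic_on_subset) auto
    qed (simp add: level_small)
    show "(\<lambda>w. f (Fin w)) holomorphic_on ball 0 (min e (1 / R))"
      using e(2) by (rule holomorphic_on_subset) auto
    show "Fin ` ball 0 (min e (1 / R)) \<subseteq> basin_level 0"
      using ball_subset_basin_level[of 0] by auto
  qed (use e(1) R_pos 1 in \<open>auto intro: continuous_on_Fin open_Fin_image\<close>)
next
  case (2 x)
  then have "(\<lambda>w. f (inv_chart w)) analytic_on {x}"
    using assms(2) by (auto intro: analytic_inv_chart)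
  then obtain e where e: "e > 0" "(\<lambda>w. f (inv_chart w)) holomorphic_on ball x e"
    by (auto simp: analytic_on_def)
  obtain n where "R < cmod (p n x)"
    using 2 assms(1) by (auto simp: basin_def escaping_def)
  then obtain e' where e': "e' > 0" "ball x e' \<subseteq> {x. R < cmod (p n x)}"
    using open_escape_level[of n] unfolding open_contains_ball by auto
  show thesis
  proof (rule that[of inv_chart x "min e e'" n])
    have "(\<lambda>w. Q (1 / p n w)) holomorphic_on {x. R < cmod (p n x)}"
    proof -
      have "(\<lambda>w. 1 / p n w) holomorphic_on {x. R < cmod (p n x)}"
        using R_pos by (intro holomorphic_intros holomorphic_logistic_funpow) auto
      then have "(Q \<circ> (\<lambda>w. 1 / p n w)) holomorphic_on {x. R < cmod (p n x)}"
        by (rule holomorphic_on_compose_gen[OF _ Q_holo]) (use inverse_small in auto)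
      then show ?thesis by (simp add: o_def)
    qed
    then show "(\<lambda>w. level n (inv_chart w)) holomorphic_on ball x (min e e')"
      unfolding level_inv_chart by (rule holomorphic_on_subset) (use e'(2) in auto)
    show "(\<lambda>w. f (inv_chart w)) holomorphic_on ball x (min e e')"
      using e(2) by (rule holomorphic_on_subset) auto
    show "inv_chart ` ball x (min e e') \<subseteq> basin_level n"
      using e'(2) by (auto simp: basin_level_def)
  qed (use e(1) e'(1) 2 in \<open>auto intro: continuous_on_inv_chart open_inv_chart_image\<close>)
qed

text \<open>In each chart the identity theorem compares a power of \<open>\<phi> t\<close> with a
  power of a level function. No reciprocal of the germ occurs, so the condition holds on full
  neighbourhoods.\<close>

lemma continues_Q_along:
  assumes \<gamma>: "path \<gamma>" "\<gamma> 0 = Fin 0" "\<And>t. \<lbrakk>0 \<le> t; t < 1\<rbrakk> \<Longrightarrow> \<gamma> t \<in> basin"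
    and \<phi>: "analytic_continuation_along Q \<gamma> \<phi>"
    and t: "0 \<le> t" "t < 1"
  shows "\<exists>n. \<forall>\<^sub>F q in nhds (\<gamma> t). continues_Q (\<phi> t) n q"
proof -
  have \<phi>_an: "\<And>t. t \<in> {0..1} \<Longrightarrow> analytic_at_sphere (\<phi> t) (\<gamma> t)"
    and \<phi>_0: "\<forall>\<^sub>F z in nhds 0. \<phi> 0 (Fin z) = Q z"
    and \<phi>_coh: "\<And>t. t \<in> {0..1} \<Longrightarrow> \<forall>\<^sub>F s in at t within {0..1}. \<forall>\<^sub>F q in nhds (\<gamma> s). \<phi> s q = \<phi> t q"
    using \<phi> unfolding analytic_continuation_along_def by blast+
  define P where "P t \<longleftrightarrow> (\<exists>n. \<forall>\<^sub>F q in nhds (\<gamma> t). continues_Q (\<phi> t) n q)" for t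
  have P_transfer: "\<exists>n. \<forall>\<^sub>F q in nhds (\<gamma> s). continues_Q g n q"
    if h: "\<exists>n. \<forall>\<^sub>F q in nhds (\<gamma> s). continues_Q h n q" and eq: "\<forall>\<^sub>F q in nhds (\<gamma> s). h q = g q" for s g h
  proof -
    obtain n where "\<forall>\<^sub>F q in nhds (\<gamma> s). continues_Q h n q" using h by blast
    with eq have "\<forall>\<^sub>F q in nhds (\<gamma> s). continues_Q g n q"
      by eventually_elim (simp add: continues_Q_def)
    then show ?thesis by blast
  qed
  have "P 0"
    unfolding P_def
  proof (intro exI)
    have "\<forall>\<^sub>F z in nhds 0. z \<in> ball (0::complex) (1 / R)"
      using R_pos by (intro eventually_nhds_in_open) auto
    with \<phi>_0 have "\<forall>\<^sub>F z in nhds 0. continues_Q (\<phi> 0) 0 (Fin z)"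
    proof eventually_elim
      case (elim z)
      then show ?case
        using ball_subset_basin_level[of 0] by (auto simp: continues_Q_def level_small)
    qed
    then obtain S where S: "open S" "0 \<in> S" "\<And>z. z \<in> S \<Longrightarrow> continues_Q (\<phi> 0) 0 (Fin z)"
      by (auto simp: eventually_nhds)
    then show "\<forall>\<^sub>F q in nhds (\<gamma> 0). continues_Q (\<phi> 0) 0 q"
      unfolding \<gamma>(2) eventually_nhds by (intro exI[of _ "Fin ` S"]) (auto intro: open_Fin_image)
  qed
  moreover have "\<exists>d>0. \<forall>x y. x \<in> {0..<1} \<and> y \<in> {0..<1} \<and> dist x t < d \<and> dist y t < d \<and> P x \<longrightarrow> P y"
    if t: "0 \<le> t" "t < 1" for t
  proof -
    have t': "t \<in> {0..1}" using t by simp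
    obtain c z e N where c: "continuous_on UNIV c" "\<forall>U. open U \<longrightarrow> open (c ` U)" "c z = \<gamma> t"
      and e: "0 < e" "c ` ball z e \<subseteq> basin_level N"
      and hol: "(\<lambda>w. level N (c w)) holomorphic_on ball z e" "(\<lambda>w. \<phi> t (c w)) holomorphic_on ball z e"
      by (rule basin_chart[OF \<gamma>(3)[OF t] \<phi>_an[OF t']])
    define D where "D = ball z e"
    have tD: "\<gamma> t \<in> c ` D"
      using e(1) by (intro image_eqI[of _ c z]) (simp_all add: D_def c(3))
    have "open (c ` D)" using c(2) by (simp add: D_def)
    then have "\<forall>\<^sub>F s in at t within {0..1}. \<gamma> s \<in> c ` D"
      by (intro path_eventually_in \<gamma>(1) t' tD)
    with \<phi>_coh[OF t']
    have "\<forall>\<^sub>F s in at t within {0..1}. \<gamma> s \<in> c ` D \<and> (\<forall>\<^sub>F q in nhds (\<gamma> s). \<phi> s q = \<phi> t q)"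
      by eventually_elim simp
    from eventually_at_Icc_ball[OF this] obtain d where d: "d > 0" "\<And>s. \<lbrakk>s \<in> {0..1}; s \<noteq> t; dist s t < d\<rbrakk> \<Longrightarrow>
        \<gamma> s \<in> c ` D \<and> (\<forall>\<^sub>F q in nhds (\<gamma> s). \<phi> s q = \<phi> t q)"
      by blast
    have near: "\<gamma> s \<in> c ` D \<and> (\<forall>\<^sub>F q in nhds (\<gamma> s). \<phi> s q = \<phi> t q)" if "s \<in> {0..<1}" "dist s t < d" for s
    proof (cases "s = t")
      case False
      then show ?thesis using d(2)[of s] that by simp
    qed (use tD in simp)
    have "P y" if xy: "x \<in> {0..<1}" "y \<in> {0..<1}" "dist x t < d" "dist y t < d" "P x" for x y
    proof -
      obtain zx where zx: "zx \<in> D" "\<gamma> x = c zx" using near[of x] xy by blast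
      obtain n where n: "\<forall>\<^sub>F q in nhds (\<gamma> x). continues_Q (\<phi> t) n q"
        using P_transfer[where s = x and h = "\<phi> x" and g = "\<phi> t"] near[of x] xy by (auto simp: P_def)
      then obtain T where T: "open T" "zx \<in> T" "\<And>w. w \<in> T \<Longrightarrow> continues_Q (\<phi> t) n (c w)"
        using eventually_nhds_continuous[OF c(1) n[unfolded zx(2)]] by (auto simp: eventually_nhds)
      \<comment> \<open>A common exponent for the known equation (n) and for the chart (N);
        enlarging an exponent only raises both sides to a power.\<close>
      define k where "k = max n N"
      have lev: "level k (c w) = level N (c w) ^ 2 ^ (k - N)" "c w \<in> basin_level k" if "w \<in> D" for w
      proof -
        have "c w \<in> basin_level N"
          using e(2) that unfolding D_def by blast
        from basin_level_mono[OF this, of k]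
        show "level k (c w) = level N (c w) ^ 2 ^ (k - N)" "c w \<in> basin_level k"
          by (simp_all add: k_def)
      qed
      have eq: "\<phi> t (c w) ^ 2 ^ k = level N (c w) ^ 2 ^ (k - N)" if "w \<in> D" for w
      proof (rule holomorphic_eq_on_connected[of "\<lambda>w. \<phi> t (c w) ^ 2 ^ k" D "\<lambda>w. level N (c w) ^ 2 ^ (k - N)" T])
        show "\<phi> t (c w) ^ 2 ^ k = level N (c w) ^ 2 ^ (k - N)" if "w \<in> D" "w \<in> T" for w
          using continues_Q_mono[OF T(3)[OF that(2)], of k] lev[OF that(1)] by (simp add: k_def continues_Q_def)
        show "D \<inter> T \<noteq> {}" using zx(1) T(2) by blast
      qed (use hol T that in \<open>auto simp: D_def intro!: holomorphic_intros\<close>)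
      have "continues_Q (\<phi> t) k q" if "q \<in> c ` D" for q
        using that eq lev by (auto simp: continues_Q_def)
      moreover have "\<forall>\<^sub>F q in nhds (\<gamma> y). q \<in> c ` D"
        using near[of y] xy \<open>open (c ` D)\<close> by (intro eventually_nhds_in_open) auto
      ultimately have "\<forall>\<^sub>F q in nhds (\<gamma> y). continues_Q (\<phi> t) k q"
        by (simp add: eventually_mono)
      then have "\<exists>k. \<forall>\<^sub>F q in nhds (\<gamma> y). continues_Q (\<phi> t) k q" by blast
      moreover have "\<forall>\<^sub>F q in nhds (\<gamma> y). \<phi> t q = \<phi> y q"
      proof (rule eventually_mono)
        show "\<forall>\<^sub>F q in nhds (\<gamma> y). \<phi> y q = \<phi> t q"
          using near[of y] xy by blast
      qed (rule sym)
      ultimately show "P y"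
        unfolding P_def by (rule P_transfer)
    qed
    with d(1) show ?thesis by blast
  qed
  ultimately have "P t"
    using real_interval_induct[where P = P] t by blast
  then show ?thesis by (simp add: P_def)
qed

text \<open>The condition of \<open>continues_Q\<close> in the coordinate x, required on a
  neighbourhood so that the identity theorem can spread it.\<close>

definition locally_boettcher :: "(complex \<Rightarrow> complex) \<Rightarrow> complex \<Rightarrow> bool" where
  "locally_boettcher q x \<longleftrightarrow> (\<exists>n. \<forall>\<^sub>F y in nhds x. R < cmod (p n y) \<and> Q (1 / p n y) = q y ^ 2 ^ n)"

lemma locally_boettcherD:
  assumes "locally_boettcher q x"
  obtains n where "R < cmod (p n x)" "Q (1 / p n x) = q x ^ 2 ^ n"
  using assms unfolding locally_boettcher_def by (auto dest: eventually_nhds_x_imp_x)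

lemma locally_boettcher_lt_1:
  assumes "locally_boettcher q x"
  shows "cmod (q x) < 1"
proof -
  obtain n where n: "R < cmod (p n x)" "Q (1 / p n x) = q x ^ 2 ^ n"
    using assms by (rule locally_boettcherD)
  have "cmod (q x) ^ 2 ^ n < 1"
    using Q_small[OF inverse_small[OF n(1)]] n(2) by (simp add: norm_power)
  then show ?thesis
    by (metis norm_ge_zero not_less one_le_power)
qed

text \<open>A bound s < 1 on \<open>cmod (q y)\<close> near x gives, by
  \<open>escape_time_bound\<close>, one escape time j for all nearby points of the set. The
  non-strict inequality at time j survives in the limit, and one more step of p makes it
  strict.\<close>

lemma escaping_limit:
  assumes V: "open V" "x \<in> V" "continuous_on V q" and x: "cmod (q x) < 1"
    and lim: "x \<in> closure {y \<in> V. locally_boettcher q y}"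
  shows "x \<in> escaping"
proof -
  obtain s where s: "cmod (q x) < s" "s < 1" using x dense by blast
  then have "0 \<le> s" by (auto intro: order_trans[of 0 "cmod (q x)"])
  obtain j where "s ^ j < m" using real_arch_pow_inv[OF m_pos s(2)] by blast
  moreover have "s ^ 2 ^ j \<le> s ^ j"
    using \<open>0 \<le> s\<close> s(2) by (intro power_decreasing) (auto intro: less_imp_le less_exp)
  ultimately have j: "s ^ 2 ^ j < m" by simp
  have esc: "R < cmod (p j y)" if y: "locally_boettcher q y" "cmod (q y) < s" for y
  proof -
    obtain n where n: "R < cmod (p n y)" "Q (1 / p n y) = q y ^ 2 ^ n"
      using y(1) by (rule locally_boettcherD)
    have "cmod (q y) ^ 2 ^ j \<le> s ^ 2 ^ j"
      using y(2) by (intro power_mono) auto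
    then show ?thesis
      using escape_time_bound[of n y "cmod (q y)" j] n j y(2) s(2) by (simp add: norm_power)
  qed
  define W where "W = V \<inter> (\<lambda>y. cmod (q y)) -` {..<s}"
  have W: "open W" "x \<in> W"
    using V s by (auto simp: W_def intro!: continuous_open_preimage continuous_on_norm)
  have "R \<le> cmod (p j x)"
  proof (rule ccontr)
    assume "\<not> R \<le> cmod (p j x)"
    moreover have "open (W \<inter> {y. cmod (p j y) < R})"
      by (intro open_Int W open_Collect_less continuous_intros continuous_on_p)
    ultimately obtain y where "y \<in> {y \<in> V. locally_boettcher q y}" "y \<in> W \<inter> {y. cmod (p j y) < R}"
      using closure_meets_open[OF lim, of "W \<inter> {y. cmod (p j y) < R}"] W(2) by auto
    then show False using esc[of y] by (auto simp: W_def)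
  qed
  then have "R < cmod (p (Suc j) x)"
    using escape[of "p j x"] R_pos by simp
  then show ?thesis unfolding escaping_def by blast
qed

text \<open>A point of V that is a limit of good points escapes by \<open>escaping_limit\<close>.
  Around it \<open>Q (1 / p k w)\<close> is therefore holomorphic for large k, and the identity
  theorem applies.\<close>

lemma locally_boettcher_propagates:
  assumes V: "open V" "connected V" "q holomorphic_on V" "\<And>x. x \<in> V \<Longrightarrow> cmod (q x) < 1"
    and x: "x \<in> V" "locally_boettcher q x" and y: "y \<in> V"
  shows "locally_boettcher q y"
proof (rule connected_induction_simple[where S = V and P = "locally_boettcher q" and a = x and b = y])
  fix b assume b: "b \<in> V"
  show "\<exists>T. openin (top_of_set V) T \<and> b \<in> T \<and> (\<forall>x\<in>T. \<forall>y\<in>T. locally_boettcher q x \<longrightarrow> locally_boettcher q y)"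
  proof (cases "b \<in> closure {y \<in> V. locally_boettcher q y}")
    case False
    then have "openin (top_of_set V) (V \<inter> - closure {y \<in> V. locally_boettcher q y})"
      by (intro openin_open_Int) auto
    moreover have "b \<in> V \<inter> - closure {y \<in> V. locally_boettcher q y}" using False b by simp
    moreover have "\<forall>x\<in>V \<inter> - closure {y \<in> V. locally_boettcher q y}. \<not> locally_boettcher q x"
      using closure_subset[of "{y \<in> V. locally_boettcher q y}"] by blast
    ultimately show ?thesis by blast
  next
    case True
    have "continuous_on V q" using V(3) by (rule holomorphic_on_imp_continuous_on)
    then have "b \<in> escaping"
      using escaping_limit[OF V(1) b _ V(4)[OF b] True] by blast
    then obtain N where "R < cmod (p N b)" by (auto simp: escaping_def)
    then have "open (V \<inter> {x. R < cmod (p N x)})" "b \<in> V \<inter> {x. R < cmod (p N x)}"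
      using b V(1) open_escape_level by auto
    then obtain e where e: "e > 0" "ball b e \<subseteq> V \<inter> {x. R < cmod (p N x)}"
      by (rule openE)
    have "ball b e \<subseteq> V" using e(2) by simp
    with V(3) have q_hol: "q holomorphic_on ball b e"
      by (rule holomorphic_on_subset)
    have spread: "locally_boettcher q y" if xy: "x \<in> ball b e" "y \<in> ball b e" "locally_boettcher q x" for x y
    proof -
      obtain n where "\<forall>\<^sub>F y in nhds x. R < cmod (p n y) \<and> Q (1 / p n y) = q y ^ 2 ^ n"
        using xy(3) unfolding locally_boettcher_def by blast
      then obtain T where T: "open T" "x \<in> T" "\<And>y. y \<in> T \<Longrightarrow> R < cmod (p n y) \<and> Q (1 / p n y) = q y ^ 2 ^ n"
        by (auto simp: eventually_nhds)
      define k where "k = max n N"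
      have esc: "R < cmod (p k w)" if "w \<in> ball b e" for w
        using escape_mono[of N w k] e(2) that by (auto simp: k_def)
      have "(\<lambda>w. 1 / p k w) holomorphic_on ball b e"
        using esc R_pos by (intro holomorphic_intros holomorphic_logistic_funpow) force
      then have "(Q \<circ> (\<lambda>w. 1 / p k w)) holomorphic_on ball b e"
        by (rule holomorphic_on_compose_gen[OF _ Q_holo]) (use inverse_small esc in auto)
      then have hol: "(\<lambda>w. Q (1 / p k w)) holomorphic_on ball b e"
        by (simp add: o_def)
      have eq: "Q (1 / p k w) = q w ^ 2 ^ k" if "w \<in> ball b e" for w
      proof (rule holomorphic_eq_on_connected[of "\<lambda>w. Q (1 / p k w)" "ball b e" "\<lambda>w. q w ^ 2 ^ k" T])
        show "(\<lambda>w. q w ^ 2 ^ k) holomorphic_on ball b e"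
          by (intro holomorphic_intros q_hol)
        show "ball b e \<inter> T \<noteq> {}"
          using IntI[OF xy(1) T(2)] by (auto simp del: mem_ball)
        show "Q (1 / p k w) = q w ^ 2 ^ k" if "w \<in> T" for w
        proof -
          have "n \<le> k" by (simp add: k_def)
          then show ?thesis
            using Q_p_mono[of n w k] T(3)[OF that] by (simp flip: power_mult power_add)
        qed
      qed (use that hol T(1) in auto)
      have "\<forall>\<^sub>F w in nhds y. w \<in> ball b e"
        using xy(2) by (intro eventually_nhds_in_open) auto
      then have "\<forall>\<^sub>F w in nhds y. R < cmod (p k w) \<and> Q (1 / p k w) = q w ^ 2 ^ k"
        by eventually_elim (use esc eq in auto)
      then show ?thesis unfolding locally_boettcher_def by blast
    qed
    show ?thesis
    proof (intro exI[of _ "V \<inter> ball b e"] conjI ballI impI)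
      show "openin (top_of_set V) (V \<inter> ball b e)"
        by (intro openin_open_Int open_ball)
      show "b \<in> V \<inter> ball b e" using b e(1) by simp
      show "locally_boettcher q y"
        if "x \<in> V \<inter> ball b e" "y \<in> V \<inter> ball b e" "locally_boettcher q x" for x y
        by (rule spread[OF IntD2[OF that(1)] IntD2[OF that(2)] that(3)])
    qed
  qed
qed (use V x y in auto)

text \<open>The set where \<open>cmod (q x) < 1\<close> may have several components near
  \<open>x0\<close>, and \<open>q\<close> is known to be a Boettcher coordinate only on those
  containing a good point. The inverse must take values in such a component, so it is taken at a
  point of its boundary.\<close>

lemma parameter_of_inverse_germ:
  assumes q: "q holomorphic_on ball x0 e0" "0 < e0" and x0: "x0 \<notin> escaping"
    and lim: "x0 \<in> closure {x. locally_boettcher q x}"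
  shows "a \<in> {-2, 2, 4}"
proof -
  have cont: "continuous_on (ball x0 e0) q"
    using q(1) by (rule holomorphic_on_imp_continuous_on)
  have lim': "x0 \<in> closure {x \<in> S. locally_boettcher q x}" if "open S" "x0 \<in> S" for S
    unfolding mem_closure_iff_open
  proof (intro allI impI)
    fix T assume "open T" "x0 \<in> T"
    with that show "\<exists>y. y \<in> {x \<in> S. locally_boettcher q x} \<and> y \<in> T"
      using closure_meets_open[OF lim, of "S \<inter> T"] by auto
  qed
  \<comment> \<open>A smaller modulus would make \<open>x0\<close> escape by
    \<open>escaping_limit\<close>; a larger one would persist at nearby good points.\<close>
  have q1: "cmod (q x0) = 1"
  proof (rule antisym)
    show "1 \<le> cmod (q x0)"
      using escaping_limit[OF open_ball _ cont _ lim'[OF open_ball]] q(2) x0 by force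
    show "cmod (q x0) \<le> 1"
    proof (rule ccontr)
      assume "\<not> ?thesis"
      moreover have "open (ball x0 e0 \<inter> (\<lambda>z. cmod (q z)) -` {1<..})"
        by (intro continuous_open_preimage continuous_on_norm cont) auto
      ultimately obtain y where "locally_boettcher q y" "cmod (q y) > 1"
        using closure_meets_open[OF lim, of "ball x0 e0 \<inter> (\<lambda>z. cmod (q z)) -` {1<..}"] q(2) by auto
      then show False using locally_boettcher_lt_1[of q y] by simp
    qed
  qed
  have near: "\<exists>x. locally_boettcher q x \<and> x \<in> ball x0 d" if "d > 0" for d
    using closure_meets_open[OF lim, of "ball x0 d"] that by auto
  obtain x1 where x1: "locally_boettcher q x1" "x1 \<in> ball x0 e0"
    using near[OF q(2)] by blast
  have "q x1 \<noteq> q x0" using locally_boettcher_lt_1[OF x1(1)] q1 by auto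
  then obtain \<beta> where \<beta>: "\<beta> \<in> ball x0 e0" "deriv q \<beta> \<noteq> 0"
    using deriv_nonzero_point[OF q(1) x1(2), of x0] q(2) by auto
  \<comment> \<open>Critical points are isolated; in the ball of radius \<open>e\<close> only
    \<open>x0\<close> can be one.\<close>
  have "deriv q holomorphic_on ball x0 e0"
    using q(1) by (intro holomorphic_deriv) auto
  then have "\<forall>\<^sub>F w in at x0. deriv q w \<noteq> 0 \<and> w \<in> ball x0 e0"
    by (rule non_zero_neighbour_alt) (use \<beta> q(2) in auto)
  then obtain e where e: "e > 0" "\<And>w. \<lbrakk>w \<noteq> x0; dist w x0 < e\<rbrakk> \<Longrightarrow> deriv q w \<noteq> 0 \<and> w \<in> ball x0 e0"
    by (auto simp: eventually_at)
  have "ball x0 e \<subseteq> ball x0 e0"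
  proof
    show "w \<in> ball x0 e0" if "w \<in> ball x0 e" for w
      using e(2)[of w] that q(2) by (cases "w = x0") (auto simp: dist_commute)
  qed
  then have hol: "q holomorphic_on ball x0 e"
    using q(1) by (rule holomorphic_on_subset[rotated])
  obtain y where y: "locally_boettcher q y" "y \<in> ball x0 e"
    using near[OF e(1)] by blast
  note y_lt = locally_boettcher_lt_1[OF y(1)]
  define V where "V = {z \<in> ball x0 e. cmod (q z) < 1}"
  define U where "U = connected_component_set V y"
  have "V = ball x0 e \<inter> (\<lambda>z. cmod (q z)) -` {..<1}" by (auto simp: V_def)
  moreover have "open (ball x0 e \<inter> (\<lambda>z. cmod (q z)) -` {..<1})"
    by (intro continuous_open_preimage continuous_on_norm holomorphic_on_imp_continuous_on hol) auto
  ultimately have V: "open V" by simp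
  have "y \<in> V" using y(2) y_lt by (simp add: V_def)
  then have U: "open U" "connected U" "U \<subseteq> V" "y \<in> U"
    using V by (auto simp: U_def open_connected_component connected_component_subset)
  have boett: "locally_boettcher q x" if "x \<in> U" for x
  proof (rule locally_boettcher_propagates[OF U(1,2)])
    show "q holomorphic_on U"
      using U(3) by (intro holomorphic_on_subset[OF hol]) (auto simp: V_def)
    show "cmod (q x) < 1" if "x \<in> U" for x
      using that U(3) by (auto simp: V_def)
  qed (use U y that in auto)
  obtain w where w: "w \<in> ball x0 e" "w \<noteq> x0" "w \<in> closure U" "cmod (q w) = 1"
    using unit_modulus_boundary_point[OF hol q1 y(2) y_lt] unfolding U_def V_def by blast
  have "deriv q w \<noteq> 0" using e(2)[of w] w by (simp add: dist_commute)
  then obtain r' where r': "r' > 0" "ball w r' \<subseteq> ball x0 e" "open (q ` ball w r')" "inj_on q (ball w r')"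
    by (rule has_complex_derivative_locally_invertible[OF hol w(1) open_ball])
  have "\<exists>g. g holomorphic_on q ` ball w r' \<and> (\<forall>z\<in>ball w r'. g (q z) = z)"
    by (rule holomorphic_has_inverse[OF holomorphic_on_subset[OF hol r'(2)] open_ball r'(4)]) auto
  then obtain g where g: "g holomorphic_on q ` ball w r'" "\<And>z. z \<in> ball w r' \<Longrightarrow> g (q z) = z"
    by auto
  define \<zeta> where "\<zeta> = q w"
  have "\<zeta> \<in> q ` ball w r'" using r'(1) by (auto simp: \<zeta>_def)
  with r'(3) obtain \<epsilon> where \<epsilon>: "\<epsilon> > 0" "ball \<zeta> \<epsilon> \<subseteq> q ` ball w r'"
    by (rule openE)
  \<comment> \<open>The part of the unit disk near \<open>\<zeta>\<close> is convex, so its image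
    \<open>N\<close> is a connected subset of \<open>V\<close>. It meets \<open>U\<close> because w
    lies in the closure of \<open>U\<close>, and is therefore contained in the component
    \<open>U\<close>.\<close>
  define N where "N = g ` (ball \<zeta> \<epsilon> \<inter> ball 0 1)"
  have qg: "q (g z) = z" "g z \<in> ball w r'" if z: "z \<in> ball \<zeta> \<epsilon>" for z
  proof -
    obtain u where "u \<in> ball w r'" "z = q u" using \<epsilon>(2) z by blast
    then show "q (g z) = z" "g z \<in> ball w r'" using g(2)[of u] by simp_all
  qed
  have "N \<subseteq> V"
  proof
    fix u assume "u \<in> N"
    then obtain z where z: "z \<in> ball \<zeta> \<epsilon>" "cmod z < 1" "u = g z"
      by (auto simp: N_def)
    then show "u \<in> V"
      using qg[OF z(1)] r'(2) by (auto simp: V_def)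
  qed
  have "connected N"
    unfolding N_def
  proof (rule connected_continuous_image)
    show "continuous_on (ball \<zeta> \<epsilon> \<inter> ball 0 1) g"
      using \<epsilon>(2) by (intro holomorphic_on_imp_continuous_on holomorphic_on_subset[OF g(1)]) auto
    show "connected (ball \<zeta> \<epsilon> \<inter> ball 0 1)"
      by (intro convex_connected convex_Int convex_ball)
  qed
  have "\<exists>u. u \<in> U \<and> u \<in> N"
  proof -
    have "continuous_on (ball w r') q"
      using r'(2) by (intro holomorphic_on_imp_continuous_on holomorphic_on_subset[OF hol])
    then have "open (ball w r' \<inter> q -` ball \<zeta> \<epsilon>)"
      by (intro continuous_open_preimage) auto
    moreover have "w \<in> ball w r' \<inter> q -` ball \<zeta> \<epsilon>"
      using r'(1) \<epsilon>(1) by (simp add: \<zeta>_def)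
    ultimately have "\<exists>u. u \<in> U \<and> u \<in> ball w r' \<inter> q -` ball \<zeta> \<epsilon>"
      by (rule closure_meets_open[OF w(3)])
    then obtain u where u: "u \<in> U" "u \<in> ball w r'" "q u \<in> ball \<zeta> \<epsilon>"
      by auto
    then have "cmod (q u) < 1" using U(3) by (auto simp: V_def)
    then have "u \<in> N"
      using u g(2)[OF u(2)] unfolding N_def by (intro image_eqI[of _ _ "q u"]) auto
    with u(1) show ?thesis by blast
  qed
  then obtain u where u: "u \<in> U" "u \<in> N" by blast
  have "N \<subseteq> connected_component_set V u"
    using u(2) \<open>connected N\<close> \<open>N \<subseteq> V\<close> by (intro connected_component_maximal)
  also have "\<dots> = U"
    using u(1) unfolding U_def by (rule connected_component_eq)
  finally have "N \<subseteq> U" .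
  have "open ((\<lambda>v. \<zeta> * exp v) -` ball \<zeta> \<epsilon>)"
    by (intro open_vimage continuous_intros open_ball)
  moreover have "0 \<in> (\<lambda>v. \<zeta> * exp v) -` ball \<zeta> \<epsilon>" using \<epsilon>(1) by simp
  ultimately obtain \<rho> where \<rho>: "\<rho> > 0" "ball 0 \<rho> \<subseteq> (\<lambda>v. \<zeta> * exp v) -` ball \<zeta> \<epsilon>"
    by (rule openE)
  have "(g \<circ> (\<lambda>v. \<zeta> * exp v)) holomorphic_on ball 0 \<rho>"
    by (rule holomorphic_on_compose_gen[OF _ g(1)]) (use \<rho>(2) \<epsilon>(2) in \<open>auto intro!: holomorphic_intros\<close>)
  then have "(\<lambda>v. g (\<zeta> * exp v)) holomorphic_on ball 0 \<rho>"
    by (simp add: o_def)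
  then show ?thesis
  proof (rule parameter_of_boundary_germ[OF _ \<rho>(1)])
    fix v assume v: "cmod v < \<rho>" "Re v < 0"
    define z where "z = \<zeta> * exp v"
    have nz: "cmod z = exp (Re v)" by (simp add: z_def norm_mult \<zeta>_def w(4))
    have zb: "z \<in> ball \<zeta> \<epsilon>" using v(1) \<rho>(2) by (auto simp: z_def)
    then have "g z \<in> U"
      using \<open>N \<subseteq> U\<close> v(2) nz by (auto simp: N_def)
    from boett[OF this] obtain n where "R < cmod (p n (g z))" "Q (1 / p n (g z)) = q (g z) ^ 2 ^ n"
      by (rule locally_boettcherD)
    then show "\<exists>n. R < cmod (p n (g (\<zeta> * exp v))) \<and> cmod (Q (1 / p n (g (\<zeta> * exp v)))) = exp (Re v) ^ 2 ^ n"
      using qg(1)[OF zb] nz unfolding z_def[symmetric] by (auto simp: norm_power)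
  qed
qed

lemma barrier_Q:
  assumes "a \<notin> {-2, 2, 4}"
  shows "barrier_of_singularities Q (K_p a)"
  unfolding barrier_of_singularities_def
proof (intro allI impI notI)
  fix \<gamma> assume \<gamma>: "path \<gamma> \<and> pathstart \<gamma> = Fin 0 \<and> \<gamma> ` {0..<1} \<subseteq> K_p a \<and> pathfinish \<gamma> \<in> frontier (K_p a)"
  assume "\<exists>\<phi>. analytic_continuation_along Q \<gamma> \<phi>"
  then obtain \<phi> where \<phi>: "analytic_continuation_along Q \<gamma> \<phi>" by blast
  have \<gamma>_basin: "\<gamma> t \<in> basin" if "0 \<le> t" "t < 1" for t
  proof -
    have "\<gamma> t \<in> \<gamma> ` {0..<1}" using that by simp
    then show ?thesis using \<gamma> K_p_subset_basin by blast
  qed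
  have cont: "\<exists>n. \<forall>\<^sub>F q in nhds (\<gamma> t). continues_Q (\<phi> t) n q" if "0 \<le> t" "t < 1" for t
    using \<gamma> by (intro continues_Q_along \<gamma>_basin \<phi> that) (auto simp: pathstart_def)
  have endpoint: "\<gamma> 1 \<notin> basin"
    using \<gamma> frontier_K_p_disjoint_basin by (auto simp: pathfinish_def)
  \<comment> \<open>\<open>Fin 0\<close> is in the basin, so the endpoint has an x coordinate;
    \<open>x0 = 0\<close> is the case of a path ending at \<open>Infty\<close>.\<close>
  then obtain x0 where x0: "\<gamma> 1 = inv_chart x0" "x0 \<notin> escaping"
    by (cases "\<gamma> 1" rule: inv_chart_cases) (auto simp: basin_def)
  have \<phi>_an: "analytic_at_sphere (\<phi> 1) (\<gamma> 1)"
    and \<phi>_coh: "\<forall>\<^sub>F s in at 1 within {0..1}. \<forall>\<^sub>F q in nhds (\<gamma> s). \<phi> s q = \<phi> 1 q"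
    using \<phi> by (auto simp: analytic_continuation_along_def)
  define q where "q x = \<phi> 1 (inv_chart x)" for x
  have "q analytic_on {x0}"
    unfolding q_def[abs_def] using \<phi>_an x0(1) by (intro analytic_inv_chart) simp
  then obtain e where e: "e > 0" "q holomorphic_on ball x0 e"
    by (auto simp: analytic_on_def)
  have "x0 \<in> closure {x. locally_boettcher q x}"
    unfolding mem_closure_iff_open
  proof (intro allI impI)
    fix S assume S: "open S" "x0 \<in> S"
    have "\<forall>\<^sub>F s in at 1 within {0..1}. \<gamma> s \<in> inv_chart ` S"
      using \<gamma> S x0(1) by (intro path_eventually_in open_inv_chart_image) auto
    with \<phi>_coh have "\<forall>\<^sub>F s in at 1 within {0..1}. \<gamma> s \<in> inv_chart ` S \<and> (\<forall>\<^sub>F q in nhds (\<gamma> s). \<phi> s q = \<phi> 1 q)"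
      by eventually_elim simp
    from eventually_at_Icc_ball[OF this] obtain d where d: "d > 0" "\<And>s. \<lbrakk>s \<in> {0..1}; s \<noteq> 1; dist s 1 < d\<rbrakk> \<Longrightarrow>
        \<gamma> s \<in> inv_chart ` S \<and> (\<forall>\<^sub>F q in nhds (\<gamma> s). \<phi> s q = \<phi> 1 q)"
      by blast
    define s where "s = max 0 (1 - d / 2)"
    have s: "0 \<le> s" "s < 1" "dist s 1 < d"
      using d(1) by (auto simp: s_def dist_real_def max_def)
    then have ds: "\<gamma> s \<in> inv_chart ` S" "\<forall>\<^sub>F q in nhds (\<gamma> s). \<phi> s q = \<phi> 1 q"
      using d(2)[of s] by auto
    then obtain x where x: "x \<in> S" "\<gamma> s = inv_chart x" by blast
    obtain n where "\<forall>\<^sub>F q in nhds (\<gamma> s). continues_Q (\<phi> s) n q"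
      using cont[OF s(1,2)] by blast
    with ds(2) have "\<forall>\<^sub>F q in nhds (\<gamma> s). continues_Q (\<phi> 1) n q"
      by eventually_elim (simp add: continues_Q_def)
    then have "\<forall>\<^sub>F y in nhds x. continues_Q (\<phi> 1) n (inv_chart y)"
      unfolding x(2) by (rule eventually_nhds_continuous[OF continuous_on_inv_chart])
    then have "\<forall>\<^sub>F y in nhds x. R < cmod (p n y) \<and> Q (1 / p n y) = q y ^ 2 ^ n"
      by eventually_elim (auto simp: continues_Q_def basin_level_def level_inv_chart q_def)
    then have "locally_boettcher q x" unfolding locally_boettcher_def by blast
    with x(1) show "\<exists>y. y \<in> {x. locally_boettcher q x} \<and> y \<in> S" by blast
  qed
  then have "a \<in> {-2, 2, 4}"
    by (rule parameter_of_inverse_germ[OF e(2,1) x0(2)])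
  with assms show False by blast
qed

end

subsection \<open>The exceptional parameters\<close>

lemma complex_quadratic_root:
  fixes A B C :: complex
  assumes "A \<noteq> 0"
  shows "\<exists>w. A * w\<^sup>2 + B * w + C = 0"
proof -
  define s where "s = csqrt (B\<^sup>2 - 4 * A * C)"
  have s: "s\<^sup>2 = B\<^sup>2 - 4 * A * C"
    unfolding s_def by (rule power2_csqrt)
  define w where "w = (s - B) / (2 * A)"
  have w: "2 * A * w + B = s"
    using assms by (simp add: w_def)
  have "4 * A * (A * w\<^sup>2 + B * w + C) = (2 * A * w + B)\<^sup>2 - (B\<^sup>2 - 4 * A * C)"
    by (simp add: power2_eq_square algebra_simps)
  also have "\<dots> = 0" unfolding w s by simp
  finally show ?thesis using assms by auto
qed

lemma solves_functional_equationI: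
  assumes "F analytic_on {0}" "F 0 = 0" "(F has_field_derivative - a) (at 0)"
    and D: "open D" "0 \<in> D" "\<And>z. z \<in> D \<Longrightarrow> F (z\<^sup>2) = (F z)\<^sup>2 / (a * (F z - 1))"
  shows "solves_functional_equation a F"
proof -
  have "\<forall>\<^sub>F z in nhds 0. z \<in> D"
    using D(1,2) by (rule eventually_nhds_in_open)
  then have "\<forall>\<^sub>F z in nhds 0. F (z\<^sup>2) = (F z)\<^sup>2 / (a * (F z - 1))"
    by eventually_elim (rule D(3))
  then show ?thesis
    unfolding solves_functional_equation_def using assms(1-3) by (auto intro: DERIV_imp_deriv)
qed

lemma solves_recurrenceI:
  assumes rec: "\<And>z. \<lbrakk>z \<notin> P; F z \<noteq> 1\<rbrakk> \<Longrightarrow> z\<^sup>2 \<notin> P \<and> F (z\<^sup>2) = (F z)\<^sup>2 / (a * (F z - 1))"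
    and surj: "\<And>y. y \<in> Y \<Longrightarrow> \<exists>w. w \<notin> P \<and> F w = y"
  shows "solves_recurrence a F P Y"
proof -
  have pow: "w ^ 2 ^ Suc n = (w ^ 2 ^ n)\<^sup>2" for w :: complex and n
    by (simp add: mult.commute flip: power_mult)
  show ?thesis
    unfolding solves_recurrence_def pow using rec surj by blast
qed

text \<open>The denominator at \<open>z\<^sup>2\<close> factors as (z^2 + z + 1)(z^2 - z + 1), and
  the second factor is the numerator of 1 minus the function at z.\<close>

lemma functional_identity_minus_2:
  fixes z :: complex
  assumes "z\<^sup>2 + z + 1 \<noteq> 0"
  shows "2 * z\<^sup>2 / ((z\<^sup>2)\<^sup>2 + z\<^sup>2 + 1) = (2 * z / (z\<^sup>2 + z + 1))\<^sup>2 / (- 2 * (2 * z / (z\<^sup>2 + z + 1) - 1))"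
proof -
  define D E where "D = z\<^sup>2 + z + 1" and "E = z\<^sup>2 - z + 1"
  have D: "D \<noteq> 0" using assms by (simp add: D_def)
  have DE: "(z\<^sup>2)\<^sup>2 + z\<^sup>2 + 1 = D * E"
    by (simp add: D_def E_def power2_eq_square algebra_simps)
  have "D - 2 * z = E" by (simp add: D_def E_def)
  then have "- 2 * (2 * z / D - 1) = 2 * E / D"
    using D by (simp add: field_simps)
  \<comment> \<open>If \<open>E = 0\<close>, both denominators vanish and both sides are 0 by the
    convention for division by 0.\<close>
  then show ?thesis
    using D unfolding DE D_def[symmetric] by (cases "E = 0") (simp_all add: power2_eq_square)
qed

lemma functional_identity_2:
  fixes z :: complex
  assumes "z \<noteq> 1"
  shows "2 * z\<^sup>2 / (z\<^sup>2 - 1) = (2 * z / (z - 1))\<^sup>2 / (2 * (2 * z / (z - 1) - 1))"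
proof -
  define D E where "D = z - 1" and "E = z + 1"
  have D: "D \<noteq> 0" using assms by (simp add: D_def)
  have DE: "z\<^sup>2 - 1 = D * E"
    by (simp add: D_def E_def power2_eq_square algebra_simps)
  have "2 * z - D = E" by (simp add: D_def E_def)
  then have "2 * (2 * z / D - 1) = 2 * E / D"
    using D by (simp add: field_simps)
  then show ?thesis
    using D unfolding DE D_def[symmetric] by (cases "E = 0") (simp_all add: power2_eq_square)
qed

text \<open>The function is -4 times the Koebe function. The relation (z + 1)^2 = 4 z + (z - 1)^2
  turns the function minus 1 into minus a perfect square.\<close>

lemma functional_identity_4:
  fixes z :: complex
  assumes "z \<noteq> 1"
  shows "- (4 * z\<^sup>2 / (z\<^sup>2 - 1)\<^sup>2) = (- (4 * z / (z - 1)\<^sup>2))\<^sup>2 / (4 * (- (4 * z / (z - 1)\<^sup>2) - 1))"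
proof -
  define D E where "D = z - 1" and "E = z + 1"
  have D: "D \<noteq> 0" using assms by (simp add: D_def)
  have DE: "z\<^sup>2 - 1 = D * E"
    by (simp add: D_def E_def power2_eq_square algebra_simps)
  have "E\<^sup>2 = 4 * z + D\<^sup>2"
    by (simp add: D_def E_def power2_eq_square algebra_simps)
  then have "4 * (- (4 * z / D\<^sup>2) - 1) = - (4 * E\<^sup>2 / D\<^sup>2)"
    using D by (simp add: field_simps)
  then show ?thesis
    using D unfolding DE D_def[symmetric] by (cases "E = 0") (simp_all add: power2_eq_square)
qed

lemma explicit_solution_minus_2:
  "solves_functional_equation (- 2) (\<lambda>z. 2 * z / (z\<^sup>2 + z + 1))"
proof (rule solves_functional_equationI)
  show "open {z::complex. z\<^sup>2 + z + 1 \<noteq> 0}"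
    by (intro open_Collect_neq continuous_intros)
  show "((\<lambda>z::complex. 2 * z / (z\<^sup>2 + z + 1)) has_field_derivative - (- 2)) (at 0)"
    by (auto intro!: derivative_eq_intros)
qed (use functional_identity_minus_2 in \<open>auto intro!: analytic_intros\<close>)

lemma explicit_solution_2:
  "solves_functional_equation 2 (\<lambda>z. 2 * z / (z - 1))"
proof (rule solves_functional_equationI)
  show "open (- {1::complex})" by auto
  show "((\<lambda>z::complex. 2 * z / (z - 1)) has_field_derivative - 2) (at 0)"
    by (auto intro!: derivative_eq_intros)
qed (use functional_identity_2 in \<open>auto intro!: analytic_intros\<close>)

lemma explicit_solution_4:
  "solves_functional_equation 4 (\<lambda>z. - (4 * z / (z - 1)\<^sup>2))"
proof (rule solves_functional_equationI)
  show "open (- {1::complex})" by auto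
  show "((\<lambda>z::complex. - (4 * z / (z - 1)\<^sup>2)) has_field_derivative - 4) (at 0)"
    by (auto intro!: derivative_eq_intros)
qed (use functional_identity_4 in \<open>auto intro!: analytic_intros\<close>)

lemma explicit_recurrence_minus_2:
  "solves_recurrence (- 2) (\<lambda>z. 2 * z / (z\<^sup>2 + z + 1)) {z. z\<^sup>2 + z + 1 = 0} UNIV"
proof (rule solves_recurrenceI)
  fix z :: complex
  assume "z \<notin> {z. z\<^sup>2 + z + 1 = 0}" and ne: "2 * z / (z\<^sup>2 + z + 1) \<noteq> 1"
  then have D: "z\<^sup>2 + z + 1 \<noteq> 0" by simp
  \<comment> \<open>The value 1 is taken exactly where the other factor of the denominator at
    \<open>z\<^sup>2\<close> vanishes.\<close>
  with ne have "z\<^sup>2 + z + 1 - 2 * z \<noteq> 0" by auto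
  moreover have "(z\<^sup>2)\<^sup>2 + z\<^sup>2 + 1 = (z\<^sup>2 + z + 1) * (z\<^sup>2 + z + 1 - 2 * z)"
    by (simp add: power2_eq_square algebra_simps)
  ultimately have "(z\<^sup>2)\<^sup>2 + z\<^sup>2 + 1 \<noteq> 0" using D by simp
  then show "z\<^sup>2 \<notin> {z. z\<^sup>2 + z + 1 = 0} \<and> 2 * z\<^sup>2 / ((z\<^sup>2)\<^sup>2 + z\<^sup>2 + 1)
      = (2 * z / (z\<^sup>2 + z + 1))\<^sup>2 / (- 2 * (2 * z / (z\<^sup>2 + z + 1) - 1))"
    using functional_identity_minus_2[OF D] by simp
next
  fix y :: complex
  show "\<exists>w. w \<notin> {z. z\<^sup>2 + z + 1 = 0} \<and> 2 * w / (w\<^sup>2 + w + 1) = y"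
  proof (cases "y = 0")
    case True
    then show ?thesis by (intro exI[of _ 0]) simp
  next
    case False
    from complex_quadratic_root[OF this, of "y - 2" y]
    obtain w where w: "y * w\<^sup>2 + (y - 2) * w + y = 0" ..
    have eq: "y * (w\<^sup>2 + w + 1) = 2 * w"
      using w by (simp add: algebra_simps)
    have "w\<^sup>2 + w + 1 \<noteq> 0"
    proof
      assume 0: "w\<^sup>2 + w + 1 = 0"
      with eq have "w = 0" by simp
      with 0 show False by simp
    qed
    then show ?thesis
      using eq by (intro exI[of _ w]) (simp add: divide_eq_eq)
  qed
qed

text \<open>The initial value 2 is excluded: it is the limit of the function at infinity and is not
  attained. It is a fixed point of the recurrence.\<close>

lemma explicit_recurrence_2:
  "solves_recurrence 2 (\<lambda>z. 2 * z / (z - 1)) {1} (- {2})"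
proof (rule solves_recurrenceI)
  fix z :: complex
  assume z: "z \<notin> {1}" "2 * z / (z - 1) \<noteq> 1"
  then have "z \<noteq> - 1" by auto
  with z have "z\<^sup>2 \<noteq> 1" by (simp add: power2_eq_1_iff)
  then show "z\<^sup>2 \<notin> {1} \<and> 2 * z\<^sup>2 / (z\<^sup>2 - 1) = (2 * z / (z - 1))\<^sup>2 / (2 * (2 * z / (z - 1) - 1))"
    using functional_identity_2[of z] z by simp
next
  fix y :: complex assume "y \<in> - {2}"
  then have y: "y - 2 \<noteq> 0" by simp
  have w: "y / (y - 2) - 1 = 2 / (y - 2)"
    using y by (simp add: field_simps)
  then have "y / (y - 2) - 1 \<noteq> 0"
    using y by (simp only: divide_eq_0_iff) simp
  then have "y / (y - 2) \<notin> {1}"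
    by (simp only: right_minus_eq singleton_iff not_False_eq_True)
  moreover have "2 * (y / (y - 2)) / (y / (y - 2) - 1) = y"
    unfolding w using y by simp
  ultimately show "\<exists>w. w \<notin> {1} \<and> 2 * w / (w - 1) = y"
    by (intro exI[of _ "y / (y - 2)"] conjI)
qed

lemma explicit_recurrence_4:
  "solves_recurrence 4 (\<lambda>z. - (4 * z / (z - 1)\<^sup>2)) {1} UNIV"
proof (rule solves_recurrenceI)
  fix z :: complex
  assume z: "z \<notin> {1}" "- (4 * z / (z - 1)\<^sup>2) \<noteq> 1"
  then have "z \<noteq> - 1" by auto
  with z have "z\<^sup>2 \<noteq> 1" by (simp add: power2_eq_1_iff)
  then show "z\<^sup>2 \<notin> {1} \<and> - (4 * z\<^sup>2 / (z\<^sup>2 - 1)\<^sup>2)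
      = (- (4 * z / (z - 1)\<^sup>2))\<^sup>2 / (4 * (- (4 * z / (z - 1)\<^sup>2) - 1))"
    using functional_identity_4[of z] z by simp
next
  fix y :: complex
  show "\<exists>w. w \<notin> {1} \<and> - (4 * w / (w - 1)\<^sup>2) = y"
  proof (cases "y = 0")
    case True
    then show ?thesis by (intro exI[of _ 0]) simp
  next
    case False
    from complex_quadratic_root[OF this, of "4 - 2 * y" y]
    obtain w where w: "y * w\<^sup>2 + (4 - 2 * y) * w + y = 0" ..
    have eq: "y * (w - 1)\<^sup>2 = - (4 * w)"
    proof -
      have "y * (w - 1)\<^sup>2 + 4 * w = 0"
        using w by (simp add: power2_eq_square algebra_simps)
      then show ?thesis by (simp add: eq_neg_iff_add_eq_0)
    qed
    \<comment> \<open>At w = 1 the quadratic has the value 4, whatever y is.\<close>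
    have "w \<noteq> 1"
    proof
      assume "w = 1"
      with w show False by simp
    qed
    then have D: "(w - 1)\<^sup>2 \<noteq> 0" by simp
    have "- (4 * w / (w - 1)\<^sup>2) = y * (w - 1)\<^sup>2 / (w - 1)\<^sup>2"
      unfolding eq by (rule minus_divide_left)
    also have "\<dots> = y"
      using D by (rule nonzero_mult_div_cancel_right)
    finally show ?thesis
      using \<open>w \<noteq> 1\<close> by (intro exI[of _ w] conjI) (simp_all only: singleton_iff not_False_eq_True)
  qed
qed

text \<open>By uniqueness of the germ, an explicit solution \<open>g\<close> that is holomorphic off
  a finite set is a single-valued extension of \<open>F\<close>.\<close>

lemma only_isolated_explicit:
  assumes "solves_functional_equation a F" "solves_functional_equation a g" "a \<noteq> 0"
    and "finite S" "0 \<notin> S" "g holomorphic_on - S"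
  shows "only_isolated_singularities F"
  unfolding only_isolated_singularities_def
proof (intro exI conjI)
  show "closed S" using assms(4) by (rule finite_imp_closed)
  show "discrete S"
    using islimpt_finite[OF assms(4)] by (auto simp: discrete_def isolated_in_islimpt_iff)
  show "\<forall>\<^sub>F z in nhds 0. g z = F z"
    by (rule solution_unique[OF assms(2,1,3)])
qed (use assms in auto)

text \<open>A closed discrete set has finitely many points in the closed unit disk, so some radius
  avoids it. Along this radius the extension continues the germ up to the circle, against the
  barrier.\<close>

lemma barrier_not_only_isolated:
  assumes "barrier_of_singularities F (Fin ` ball 0 1)"
  shows "\<not> only_isolated_singularities F"
proof
  assume "only_isolated_singularities F"
  then obtain S g where S: "closed S" "discrete S" "0 \<notin> S" and g: "g holomorphic_on - S"
    and gF: "\<forall>\<^sub>F z in nhds 0. g z = F z"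
    unfolding only_isolated_singularities_def by blast
  have "\<not> z islimpt S" for z
    using S(1,2) by (auto simp: closed_limpt discrete_def isolated_in_islimpt_iff)
  then have "finite (cball 0 1 \<inter> S)"
    by (intro finite_not_islimpt_in_compact) auto
  \<comment> \<open>\<open>sgn\<close> projects radially onto the circle; a direction outside this
    finite image gives a radius free of singularities.\<close>
  then have "finite (sgn ` (cball 0 1 \<inter> S))" by simp
  moreover have "infinite (sphere (0::complex) 1)"
  proof
    assume fin: "finite (sphere (0::complex) 1)"
    have "connected (sphere (0::complex) 1)"
      by (rule connected_sphere) simp
    from connected_finite_iff_sing[OF this] fin
    have "sphere (0::complex) 1 = {} \<or> (\<exists>c. sphere (0::complex) 1 = {c})"
      by simp
    moreover have mem: "(1::complex) \<in> sphere 0 1" "(- 1::complex) \<in> sphere 0 1"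
      by simp_all
    ultimately obtain c where "sphere (0::complex) 1 = {c}"
      by (elim disjE exE) (simp_all only: empty_iff)
    with mem have "(1::complex) = c" "(- 1::complex) = c"
      by (simp_all only: singleton_iff)
    then have "(1::complex) = - 1" by (simp only:)
    then show False by simp
  qed
  ultimately have "infinite (sphere 0 1 - sgn ` (cball 0 1 \<inter> S))"
    by (rule Diff_infinite_finite)
  then obtain \<zeta> where "\<zeta> \<in> sphere 0 1 - sgn ` (cball 0 1 \<inter> S)"
    using infinite_imp_nonempty by blast
  then have \<zeta>: "cmod \<zeta> = 1" "\<zeta> \<notin> sgn ` (cball 0 1 \<inter> S)"
    by simp_all
  have ray: "of_real t * \<zeta> \<notin> S" if "t \<in> {0..1}" for t
  proof
    assume *: "of_real t * \<zeta> \<in> S"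
    then have "t > 0" using S(3) that by (cases "t = 0") auto
    have "sgn (of_real t * \<zeta>) = of_real t * \<zeta> / of_real (cmod (of_real t * \<zeta>))"
      by (rule sgn_eq)
    also have "cmod (of_real t * \<zeta>) = t"
      using \<open>t > 0\<close> \<zeta>(1) by (simp add: norm_mult)
    finally have "\<zeta> = sgn (of_real t * \<zeta>)"
      using \<open>t > 0\<close> by simp
    moreover have "of_real t * \<zeta> \<in> cball 0 1 \<inter> S"
      using * that \<zeta>(1) by (simp add: norm_mult)
    ultimately show False using \<zeta>(2) by blast
  qed
  define \<gamma> where "\<gamma> t = Fin (of_real t * \<zeta>)" for t
  \<comment> \<open>One function serves for all t, since \<open>g\<close> is single-valued; the
    value at \<open>Infty\<close> is a default away from the radius.\<close>
  define \<phi> where "\<phi> t q = (case q of Fin z \<Rightarrow> g z | Infty \<Rightarrow> 0)" for t :: real and q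
  have "path \<gamma>"
    unfolding path_def \<gamma>_def
    by (intro continuous_on_compose2[OF continuous_on_Fin[of UNIV]] continuous_intros) auto
  moreover have "\<gamma> ` {0..<1} \<subseteq> Fin ` ball 0 1"
    using \<zeta>(1) by (auto simp: \<gamma>_def norm_mult)
  moreover have "pathfinish \<gamma> \<in> frontier (Fin ` ball 0 1)" "pathstart \<gamma> = Fin 0"
    unfolding frontier_unit_disk using \<zeta>(1) by (auto simp: \<gamma>_def pathfinish_def pathstart_def)
  moreover have "analytic_continuation_along F \<gamma> \<phi>"
    unfolding analytic_continuation_along_def
  proof (intro conjI ballI)
    show "analytic_at_sphere (\<phi> t) (\<gamma> t)" if "t \<in> {0..1}" for t
      using g ray[OF that] S(1) by (auto simp: \<gamma>_def \<phi>_def analytic_at)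
    show "\<forall>\<^sub>F z in nhds 0. \<phi> 0 (Fin z) = F z"
      using gF by (simp add: \<phi>_def)
  qed (simp add: \<phi>_def)
  ultimately show False
    using assms unfolding barrier_of_singularities_def by blast
qed

theorem lemma7:
  fixes a :: complex
  assumes "a \<noteq> 0"
  shows
    "(\<exists>F. solves_functional_equation a F) \<and>
     (\<forall>F F'. solves_functional_equation a F \<and> solves_functional_equation a F' \<longrightarrow>
        (\<forall>\<^sub>F z in nhds 0. F z = F' z)) \<and>
     (\<forall>F. solves_functional_equation a F \<longrightarrow>
        (only_isolated_singularities F \<longleftrightarrow> a \<in> {-2, 2, 4})) \<and>
     (a = -2 \<longrightarrow>
        solves_functional_equation a (\<lambda>z. 2 * z / (z\<^sup>2 + z + 1)) \<and>
        solves_recurrence a (\<lambda>z. 2 * z / (z\<^sup>2 + z + 1)) {z. z\<^sup>2 + z + 1 = 0} UNIV) \<and>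
     (a = 2 \<longrightarrow>
        solves_functional_equation a (\<lambda>z. 2 * z / (z - 1)) \<and>
        solves_recurrence a (\<lambda>z. 2 * z / (z - 1)) {1} (- {2})) \<and>
     (a = 4 \<longrightarrow>
        solves_functional_equation a (\<lambda>z. - (4 * z / (z - 1)\<^sup>2)) \<and>
        solves_recurrence a (\<lambda>z. - (4 * z / (z - 1)\<^sup>2)) {1} UNIV) \<and>
     (a \<notin> {-2, 2, 4} \<longrightarrow>
        (\<forall>F. solves_functional_equation a F \<longrightarrow>
           barrier_of_singularities F (Fin ` ball 0 1) \<and>
           (\<exists>Q. local_inverse_at_0 F Q) \<and>
           (\<forall>Q. local_inverse_at_0 F Q \<longrightarrow> barrier_of_singularities Q (K_p a))))"
proof -
  have barriers: "barrier_of_singularities F (Fin ` ball 0 1) \<and> barrier_of_singularities Q (K_p a)"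
    if "a \<notin> {-2, 2, 4}" and F: "solves_functional_equation a F" and Q: "local_inverse_at_0 F Q" for F Q
  proof -
    obtain R r m where "boettcher_coordinates a F Q R r m"
      by (rule boettcher_coordinates_exist[OF assms F Q])
    then interpret boettcher_coordinates a F Q R r m .
    show ?thesis using barrier_F barrier_Q that(1) by blast
  qed
  have isolated: "only_isolated_singularities F \<longleftrightarrow> a \<in> {-2, 2, 4}" if F: "solves_functional_equation a F" for F
  proof
    assume iso: "only_isolated_singularities F"
    obtain Q where "local_inverse_at_0 F Q"
      using local_inverse_exists[OF F assms] by blast
    then show "a \<in> {-2, 2, 4}"
      using barriers[OF _ F] barrier_not_only_isolated iso by blast
  next
    assume "a \<in> {-2, 2, 4}"
    then consider "a = -2" | "a = 2" | "a = 4" by blast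
    then show "only_isolated_singularities F"
    proof cases
      case 1
      have "{z::complex. z\<^sup>2 + z + 1 = 0} = {z. poly [:1, 1, 1:] z = 0}"
        by (simp add: power2_eq_square algebra_simps)
      then have fin: "finite {z::complex. z\<^sup>2 + z + 1 = 0}"
        using poly_roots_finite[of "[:1, 1, 1::complex:]"] by simp
      show ?thesis
        by (rule only_isolated_explicit[OF F _ assms fin])
          (use 1 explicit_solution_minus_2 in \<open>auto intro!: holomorphic_intros\<close>)
    next
      case 2
      show ?thesis
        by (rule only_isolated_explicit[OF F _ assms, of "\<lambda>z. 2 * z / (z - 1)" "{1}"])
          (use 2 explicit_solution_2 in \<open>auto intro!: holomorphic_intros\<close>)
    next
      case 3
      show ?thesis
        by (rule only_isolated_explicit[OF F _ assms, of "\<lambda>z. - (4 * z / (z - 1)\<^sup>2)" "{1}"])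
          (use 3 explicit_solution_4 in \<open>auto intro!: holomorphic_intros\<close>)
    qed
  qed
  show ?thesis
  proof (intro conjI allI impI)
    show "\<exists>F. solves_functional_equation a F"
      by (rule solution_exists[OF assms])
    show "\<forall>\<^sub>F z in nhds 0. F z = F' z"
      if "solves_functional_equation a F \<and> solves_functional_equation a F'" for F F'
      using solution_unique[of a F F'] that assms by simp
    show "only_isolated_singularities F \<longleftrightarrow> a \<in> {-2, 2, 4}" if "solves_functional_equation a F" for F
      using that by (rule isolated)
    show "\<exists>Q. local_inverse_at_0 F Q" if "solves_functional_equation a F" for F
      using that assms by (rule local_inverse_exists)
    show "barrier_of_singularities F (Fin ` ball 0 1)"
      if "a \<notin> {-2, 2, 4}" and F: "solves_functional_equation a F" for F
    proof -
      \<comment> \<open>The locale is built from a pair of germs, so the statement about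
        \<open>F\<close> alone also starts from some local inverse.\<close>
      obtain Q where "local_inverse_at_0 F Q"
        using local_inverse_exists[OF F assms] by blast
      from barriers[OF \<open>a \<notin> {-2, 2, 4}\<close> F this] show ?thesis ..
    qed
    show "barrier_of_singularities Q (K_p a)"
      if "a \<notin> {-2, 2, 4}" "solves_functional_equation a F" "local_inverse_at_0 F Q" for F Q
      using barriers[OF that] ..
  qed (use explicit_solution_minus_2 explicit_recurrence_minus_2 explicit_solution_2 explicit_recurrence_2
      explicit_solution_4 explicit_recurrence_4 in simp_all)
qed

end
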